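(* Let $C\subseteq M$ be an open convex set and suppose that $f:C\to\mathbb{R}$ is $\sigma$-self-concordant. For $x\in C$, let $\overline{u}\in T_x$ be the Newton direction of $f$ at $x$, let $x^+:=\exp_x\overline{u}$, and let $\lambda_f(x)$ be the Newton decrement. If $\lambda_f(x)<1/\sigma$, then $x^+\in C$ and $$\lambda_f(x^+)\le \frac{\sigma\lambda_f(x)^2}{(1-\sigma\lambda_f(x))^2}.$$ In particular, if $\lambda_f(x)<\frac{3-\sqrt5}{2\sigma}=0.3819\cdots/\sigma$, then the point $x$ belongs to the region of quadratic convergence of the Newton iteration.
   Context: Setting. $M$ is a smooth finite-dimensional manifold with an affine connection $\nabla$ that is torsion-free and such that for every $x\in M$ the exponential map $\exp_x$ is defined on all of $T_x=T_xM$ and maps onto $M$. Functions are assumed sufficiently smooth. Geodesics are those of $\nabla$ (affinely parametrized). A set $C\subseteq M$ is convex if every geodesic $\gamma:[a,b]\to M$ with $\gamma(a),\gamma(b)\in C$ satisfies $\gamma(t)\in C$ for all $t\in[a,b]$. A function $f:C\to\mathbb{R}$ on an open convex set is convex if $f\circ\gamma$ is convex for every geodesic $\gamma$ in $C$. $Df$ is the differential of $f$ and $Hf$ is the Hessian, $Hf(X,Y)=X(Df(Y))-Df(\nabla_XY)$, a symmetric $(0,2)$-tensor field; $\nabla_vHf$ is its covariant derivative. $f$ is nondegenerate if $Hf_x$ is positive definite for all $x\in C$, and closed if its epigraph $\{(x,y)\in C\times\mathbb{R}: y\ge f(x)\}$ is a closed set (in $M\times\mathbb{R}$). A closed nondegenerate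 convex $f:C\to\mathbb{R}$ is $\sigma$-self-concordant, $\sigma\ge0$, if $|(\nabla_vHf)(u,u)|\le 2\sigma\,Hf(v,v)^{1/2}Hf(u,u)$ for all $x\in C$ and $u,v\in T_x$. Local norm: $\|u\|_{f,x}:=\sqrt{Hf_x(u,u)}$. The Newton direction at $x\in C$ is the vector $\overline{u}\in T_x$ with $Df_x(\cdot)+Hf_x(\overline{u},\cdot)=0$; the Newton decrement is $\lambda_f(x):=\|\overline{u}\|_{f,x}$. The Newton iteration is the repeated update $x\leftarrow x^+$. Convention: $1/\sigma=+\infty$ when $\sigma=0$. *)

theory Defs
  imports "HOL-Analysis.Analysis"
begin

section \<open>Functions of class C^k on open subsets of a Euclidean space\<close>

text \<open>In finite dimension, being C^(n+1) means being differentiable with all directional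
  derivatives of class C^n; this form keeps the codomain fixed in the recursion.
  Only used on open sets.\<close>

primrec Ck_on :: "nat \<Rightarrow> 'a::euclidean_space set \<Rightarrow> ('a \<Rightarrow> 'b::real_normed_vector) \<Rightarrow> bool" where
  "Ck_on 0 S f = continuous_on S f"
| "Ck_on (Suc n) S f =
     ((\<forall>x\<in>S. f differentiable (at x)) \<and> (\<forall>v. Ck_on n S (\<lambda>x. frechet_derivative f (at x) v)))"


section \<open>Smooth manifolds\<close>

text \<open>A chart is a pair of an open domain and a coordinate map. The manifold is the whole type
  \<open>'m\<close>, with its given topology and a smooth atlas \<open>A\<close> (not required to be maximal).\<close>

type_synonym ('m, 'e) chart = "'m set \<times> ('m \<Rightarrow> 'e)"

abbreviation chart_dom :: "('m, 'e) chart \<Rightarrow> 'm set" where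
  "chart_dom c \<equiv> fst c"

abbreviation chart_map :: "('m, 'e) chart \<Rightarrow> 'm \<Rightarrow> 'e" where
  "chart_map c \<equiv> snd c"

definition chart_inv :: "('m, 'e) chart \<Rightarrow> 'e \<Rightarrow> 'm" where
  "chart_inv c = inv_into (chart_dom c) (chart_map c)"

definition smooth_atlas ::
  "('m::{t2_space,second_countable_topology}, 'e::euclidean_space) chart set \<Rightarrow> bool" where
  "smooth_atlas A \<longleftrightarrow>
     (\<Union>c\<in>A. chart_dom c) = UNIV \<and>
     (\<forall>c\<in>A. open (chart_dom c) \<and> open (chart_map c ` chart_dom c) \<and>
        homeomorphism (chart_dom c) (chart_map c ` chart_dom c) (chart_map c) (chart_inv c)) \<and>
     (\<forall>c\<in>A. \<forall>d\<in>A. \<forall>k. Ck_on k (chart_map c ` (chart_dom c \<inter> chart_dom d)) (chart_map d \<circ> chart_inv c))"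

text \<open>A tangent vector is given by its coordinates in every chart around the base point,
  which are related by the derivatives of the coordinate changes; the value \<open>0\<close> at the
  irrelevant arguments makes the representation unique. Vector space operations are pointwise.\<close>

type_synonym ('m, 'e) tvec = "('m, 'e) chart \<Rightarrow> 'e"

definition tangent_space ::
  "('m::{t2_space,second_countable_topology}, 'e::euclidean_space) chart set \<Rightarrow> 'm \<Rightarrow> ('m, 'e) tvec set" where
  "tangent_space A x =
     {u. (\<forall>c\<in>A. \<forall>d\<in>A. x \<in> chart_dom c \<inter> chart_dom d \<longrightarrow>
            u d = frechet_derivative (chart_map d \<circ> chart_inv c) (at (chart_map c x)) (u c)) \<and>
         (\<forall>c. \<not> (c \<in> A \<and> x \<in> chart_dom c) \<longrightarrow> u c = 0)}"

text \<open>The tangent vector at \<open>x\<close> with coordinates \<open>w\<close> in the chart \<open>c\<close>; only meaningful for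
  \<open>c \<in> A\<close> and \<open>x\<close> in the domain of \<open>c\<close>.\<close>

definition chart_tangent ::
  "('m::{t2_space,second_countable_topology}, 'e::euclidean_space) chart set \<Rightarrow>
   ('m, 'e) chart \<Rightarrow> 'm \<Rightarrow> 'e \<Rightarrow> ('m, 'e) tvec" where
  "chart_tangent A c x w =
     (\<lambda>d. if d \<in> A \<and> x \<in> chart_dom d
          then frechet_derivative (chart_map d \<circ> chart_inv c) (at (chart_map c x)) w else 0)"

definition Ck_fun ::
  "('m::{t2_space,second_countable_topology}, 'e::euclidean_space) chart set \<Rightarrow>
   nat \<Rightarrow> 'm set \<Rightarrow> ('m \<Rightarrow> real) \<Rightarrow> bool" where
  "Ck_fun A k U g \<longleftrightarrow> (\<forall>c\<in>A. Ck_on k (chart_map c ` (U \<inter> chart_dom c)) (g \<circ> chart_inv c))"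

definition smooth_field ::
  "('m::{t2_space,second_countable_topology}, 'e::euclidean_space) chart set \<Rightarrow>
   'm set \<Rightarrow> ('m \<Rightarrow> ('m, 'e) tvec) \<Rightarrow> bool" where
  "smooth_field A U X \<longleftrightarrow>
     (\<forall>x\<in>U. X x \<in> tangent_space A x) \<and>
     (\<forall>c\<in>A. \<forall>k. Ck_on k (chart_map c ` (U \<inter> chart_dom c)) (\<lambda>p. X (chart_inv c p) c))"

text \<open>The number \<open>Dg\<^sub>x(u)\<close>, the derivative of \<open>g\<close> at \<open>x\<close> in the direction
  \<open>u\<close>. For a vector field \<open>X\<close>, the function \<open>X(g)\<close> is \<open>\<lambda>p. differential A g p (X p)\<close>.\<close>

definition differential ::
  "('m::{t2_space,second_countable_topology}, 'e::euclidean_space) chart set \<Rightarrow>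
   ('m \<Rightarrow> real) \<Rightarrow> 'm \<Rightarrow> ('m, 'e) tvec \<Rightarrow> real" where
  "differential A g x u =
     (THE r. \<forall>c\<in>A. x \<in> chart_dom c \<longrightarrow>
        r = frechet_derivative (g \<circ> chart_inv c) (at (chart_map c x)) (u c))"


section \<open>Affine connections\<close>

text \<open>The vector \<open>nabla x v Y\<close> is \<open>\<nabla>\<^sub>v Y\<close> at \<open>x\<close>, where \<open>v\<close> is tangent at \<open>x\<close> and \<open>Y\<close> is a
  vector field that is smooth on some open neighbourhood \<open>U\<close> of \<open>x\<close>. A connection acts on the
  vector fields of all open subsets compatibly with restriction, hence the locality clause:
  the values of \<open>Y\<close> away from \<open>x\<close> do not matter.\<close>

definition affine_connection ::
  "('m::{t2_space,second_countable_topology}, 'e::euclidean_space) chart set \<Rightarrow>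
   ('m \<Rightarrow> ('m, 'e) tvec \<Rightarrow> ('m \<Rightarrow> ('m, 'e) tvec) \<Rightarrow> ('m, 'e) tvec) \<Rightarrow> bool" where
  "affine_connection A nabla \<longleftrightarrow>
     (\<forall>U. open U \<longrightarrow>
       (\<forall>x\<in>U. \<forall>v\<in>tangent_space A x. \<forall>Y. smooth_field A U Y \<longrightarrow>
          nabla x v Y \<in> tangent_space A x \<and>
          (\<forall>w\<in>tangent_space A x. \<forall>a b.
             nabla x (\<lambda>c. a *\<^sub>R v c + b *\<^sub>R w c) Y = (\<lambda>c. a *\<^sub>R nabla x v Y c + b *\<^sub>R nabla x w Y c)) \<and>
          (\<forall>Z. smooth_field A U Z \<longrightarrow>
             nabla x v (\<lambda>p c. Y p c + Z p c) = (\<lambda>c. nabla x v Y c + nabla x v Z c)) \<and>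
          (\<forall>g. (\<forall>k. Ck_fun A k U g) \<longrightarrow>
             nabla x v (\<lambda>p c. g p *\<^sub>R Y p c) =
               (\<lambda>c. differential A g x v *\<^sub>R Y x c + g x *\<^sub>R nabla x v Y c)) \<and>
          (\<forall>Z. smooth_field A U Z \<and> (\<forall>p\<in>U. Y p = Z p) \<longrightarrow> nabla x v Y = nabla x v Z)) \<and>
       (\<forall>X Y. smooth_field A U X \<and> smooth_field A U Y \<longrightarrow>
          smooth_field A U (\<lambda>p. nabla p (X p) Y)))"

text \<open>The identity \<open>\<nabla>\<^sub>X Y - \<nabla>\<^sub>Y X = [X,Y]\<close>, where the Lie bracket is the commutator
  \<open>[X,Y](g) = X(Y(g)) - Y(X(g))\<close>.\<close>

definition torsion_free ::
  "('m::{t2_space,second_countable_topology}, 'e::euclidean_space) chart set \<Rightarrow>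
   ('m \<Rightarrow> ('m, 'e) tvec \<Rightarrow> ('m \<Rightarrow> ('m, 'e) tvec) \<Rightarrow> ('m, 'e) tvec) \<Rightarrow> bool" where
  "torsion_free A nabla \<longleftrightarrow>
     (\<forall>U X Y g. open U \<and> smooth_field A U X \<and> smooth_field A U Y \<and> (\<forall>k. Ck_fun A k U g) \<longrightarrow>
       (\<forall>x\<in>U. differential A g x (\<lambda>c. nabla x (X x) Y c - nabla x (Y x) X c) =
          differential A (\<lambda>p. differential A g p (Y p)) x (X x)
          - differential A (\<lambda>p. differential A g p (X p)) x (Y x)))"

text \<open>In coordinates, \<open>christoffel A nabla c x u w\<close> is the vector with components
  \<open>\<Gamma>\<^sup>k\<^sub>i\<^sub>j u\<^sup>i w\<^sup>j\<close>: the covariant derivative of the field with constant coordinates \<open>w\<close>.\<close>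

definition christoffel ::
  "('m::{t2_space,second_countable_topology}, 'e::euclidean_space) chart set \<Rightarrow>
   ('m \<Rightarrow> ('m, 'e) tvec \<Rightarrow> ('m \<Rightarrow> ('m, 'e) tvec) \<Rightarrow> ('m, 'e) tvec) \<Rightarrow>
   ('m, 'e) chart \<Rightarrow> 'm \<Rightarrow> 'e \<Rightarrow> 'e \<Rightarrow> 'e" where
  "christoffel A nabla c x u w = nabla x (chart_tangent A c x u) (\<lambda>p. chart_tangent A c p w) c"


section \<open>Geodesics and the exponential map\<close>

definition curve_velocity ::
  "('m::{t2_space,second_countable_topology}, 'e::euclidean_space) chart set \<Rightarrow>
   real set \<Rightarrow> (real \<Rightarrow> 'm) \<Rightarrow> (real \<Rightarrow> ('m, 'e) tvec) \<Rightarrow> bool" where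
  "curve_velocity A I \<gamma> V \<longleftrightarrow>
     continuous_on I \<gamma> \<and>
     (\<forall>t\<in>I. V t \<in> tangent_space A (\<gamma> t) \<and>
        (\<forall>c\<in>A. \<gamma> t \<in> chart_dom c \<longrightarrow>
           ((chart_map c \<circ> \<gamma>) has_vector_derivative V t c) (at t within I)))"

text \<open>The field \<open>W\<close> along \<open>\<gamma>\<close> is parallel: in every chart its covariant derivative
  \<open>W' + \<Gamma>(\<gamma>', W)\<close> vanishes.\<close>

definition parallel_along ::
  "('m::{t2_space,second_countable_topology}, 'e::euclidean_space) chart set \<Rightarrow>
   ('m \<Rightarrow> ('m, 'e) tvec \<Rightarrow> ('m \<Rightarrow> ('m, 'e) tvec) \<Rightarrow> ('m, 'e) tvec) \<Rightarrow>
   real set \<Rightarrow> (real \<Rightarrow> 'm) \<Rightarrow> (real \<Rightarrow> ('m, 'e) tvec) \<Rightarrow> (real \<Rightarrow> ('m, 'e) tvec) \<Rightarrow> bool" where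
  "parallel_along A nabla I \<gamma> V W \<longleftrightarrow>
     (\<forall>t\<in>I. W t \<in> tangent_space A (\<gamma> t) \<and>
        (\<forall>c\<in>A. \<gamma> t \<in> chart_dom c \<longrightarrow>
           ((\<lambda>s. W s c) has_vector_derivative - christoffel A nabla c (\<gamma> t) (V t c) (W t c))
             (at t within I)))"

definition geodesic_with_velocity ::
  "('m::{t2_space,second_countable_topology}, 'e::euclidean_space) chart set \<Rightarrow>
   ('m \<Rightarrow> ('m, 'e) tvec \<Rightarrow> ('m \<Rightarrow> ('m, 'e) tvec) \<Rightarrow> ('m, 'e) tvec) \<Rightarrow>
   real set \<Rightarrow> (real \<Rightarrow> 'm) \<Rightarrow> (real \<Rightarrow> ('m, 'e) tvec) \<Rightarrow> bool" where
  "geodesic_with_velocity A nabla I \<gamma> V \<longleftrightarrow>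
     curve_velocity A I \<gamma> V \<and> parallel_along A nabla I \<gamma> V V"

definition geodesic ::
  "('m::{t2_space,second_countable_topology}, 'e::euclidean_space) chart set \<Rightarrow>
   ('m \<Rightarrow> ('m, 'e) tvec \<Rightarrow> ('m \<Rightarrow> ('m, 'e) tvec) \<Rightarrow> ('m, 'e) tvec) \<Rightarrow>
   real set \<Rightarrow> (real \<Rightarrow> 'm) \<Rightarrow> bool" where
  "geodesic A nabla I \<gamma> \<longleftrightarrow> (\<exists>V. geodesic_with_velocity A nabla I \<gamma> V)"

definition exp_map ::
  "('m::{t2_space,second_countable_topology}, 'e::euclidean_space) chart set \<Rightarrow>
   ('m \<Rightarrow> ('m, 'e) tvec \<Rightarrow> ('m \<Rightarrow> ('m, 'e) tvec) \<Rightarrow> ('m, 'e) tvec) \<Rightarrow>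
   'm \<Rightarrow> ('m, 'e) tvec \<Rightarrow> 'm" where
  "exp_map A nabla x v =
     (THE y. \<exists>\<gamma> V. geodesic_with_velocity A nabla {0..1} \<gamma> V \<and> \<gamma> 0 = x \<and> V 0 = v \<and> \<gamma> 1 = y)"

definition exp_defined ::
  "('m::{t2_space,second_countable_topology}, 'e::euclidean_space) chart set \<Rightarrow>
   ('m \<Rightarrow> ('m, 'e) tvec \<Rightarrow> ('m \<Rightarrow> ('m, 'e) tvec) \<Rightarrow> ('m, 'e) tvec) \<Rightarrow>
   'm \<Rightarrow> ('m, 'e) tvec \<Rightarrow> bool" where
  "exp_defined A nabla x v \<longleftrightarrow>
     (\<exists>\<gamma> V. geodesic_with_velocity A nabla {0..1} \<gamma> V \<and> \<gamma> 0 = x \<and> V 0 = v)"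


section \<open>Convexity, Hessian and self-concordance\<close>

definition geodesically_convex ::
  "('m::{t2_space,second_countable_topology}, 'e::euclidean_space) chart set \<Rightarrow>
   ('m \<Rightarrow> ('m, 'e) tvec \<Rightarrow> ('m \<Rightarrow> ('m, 'e) tvec) \<Rightarrow> ('m, 'e) tvec) \<Rightarrow> 'm set \<Rightarrow> bool" where
  "geodesically_convex A nabla C \<longleftrightarrow>
     (\<forall>a b \<gamma>. a \<le> b \<and> geodesic A nabla {a..b} \<gamma> \<and> \<gamma> a \<in> C \<and> \<gamma> b \<in> C \<longrightarrow> \<gamma> ` {a..b} \<subseteq> C)"

definition convex_function ::
  "('m::{t2_space,second_countable_topology}, 'e::euclidean_space) chart set \<Rightarrow>
   ('m \<Rightarrow> ('m, 'e) tvec \<Rightarrow> ('m \<Rightarrow> ('m, 'e) tvec) \<Rightarrow> ('m, 'e) tvec) \<Rightarrow>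
   'm set \<Rightarrow> ('m \<Rightarrow> real) \<Rightarrow> bool" where
  "convex_function A nabla C f \<longleftrightarrow>
     (\<forall>a b \<gamma>. a \<le> b \<and> geodesic A nabla {a..b} \<gamma> \<and> \<gamma> ` {a..b} \<subseteq> C \<longrightarrow> convex_on {a..b} (f \<circ> \<gamma>))"

text \<open>\<open>Hf(X,Y) = X(Df(Y)) - Df(\<nabla>\<^sub>X Y)\<close> for vector fields \<open>X\<close>, \<open>Y\<close>, evaluated at \<open>x\<close>.\<close>

definition hessian_fields ::
  "('m::{t2_space,second_countable_topology}, 'e::euclidean_space) chart set \<Rightarrow>
   ('m \<Rightarrow> ('m, 'e) tvec \<Rightarrow> ('m \<Rightarrow> ('m, 'e) tvec) \<Rightarrow> ('m, 'e) tvec) \<Rightarrow>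
   ('m \<Rightarrow> real) \<Rightarrow> ('m \<Rightarrow> ('m, 'e) tvec) \<Rightarrow> ('m \<Rightarrow> ('m, 'e) tvec) \<Rightarrow> 'm \<Rightarrow> real" where
  "hessian_fields A nabla f X Y x =
     differential A (\<lambda>p. differential A f p (Y p)) x (X x) - differential A f x (nabla x (X x) Y)"

text \<open>The value at \<open>x\<close> of the tensor field \<open>Hf\<close>: any smooth fields near \<open>x\<close> extending the
  given vectors yield the same number.\<close>

definition hessian ::
  "('m::{t2_space,second_countable_topology}, 'e::euclidean_space) chart set \<Rightarrow>
   ('m \<Rightarrow> ('m, 'e) tvec \<Rightarrow> ('m \<Rightarrow> ('m, 'e) tvec) \<Rightarrow> ('m, 'e) tvec) \<Rightarrow>
   ('m \<Rightarrow> real) \<Rightarrow> 'm \<Rightarrow> ('m, 'e) tvec \<Rightarrow> ('m, 'e) tvec \<Rightarrow> real" where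
  "hessian A nabla f x u w =
     (THE r. \<forall>U X Y. open U \<and> x \<in> U \<and> smooth_field A U X \<and> smooth_field A U Y \<and> X x = u \<and> Y x = w
        \<longrightarrow> r = hessian_fields A nabla f X Y x)"

text \<open>\<open>(\<nabla>\<^sub>v Hf)(u,w) = v(Hf(X,Y)) - Hf(\<nabla>\<^sub>v X, Y) - Hf(X, \<nabla>\<^sub>v Y)\<close> for extensions
  \<open>X\<close>, \<open>Y\<close> of \<open>u\<close>, \<open>w\<close>, again independent of their choice.\<close>

definition cov_deriv_hessian ::
  "('m::{t2_space,second_countable_topology}, 'e::euclidean_space) chart set \<Rightarrow>
   ('m \<Rightarrow> ('m, 'e) tvec \<Rightarrow> ('m \<Rightarrow> ('m, 'e) tvec) \<Rightarrow> ('m, 'e) tvec) \<Rightarrow>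
   ('m \<Rightarrow> real) \<Rightarrow> 'm \<Rightarrow> ('m, 'e) tvec \<Rightarrow> ('m, 'e) tvec \<Rightarrow> ('m, 'e) tvec \<Rightarrow> real" where
  "cov_deriv_hessian A nabla f x v u w =
     (THE r. \<forall>U X Y. open U \<and> x \<in> U \<and> smooth_field A U X \<and> smooth_field A U Y \<and> X x = u \<and> Y x = w
        \<longrightarrow> r = differential A (\<lambda>p. hessian A nabla f p (X p) (Y p)) x v
                - hessian A nabla f x (nabla x v X) w - hessian A nabla f x u (nabla x v Y))"

definition nondegenerate ::
  "('m::{t2_space,second_countable_topology}, 'e::euclidean_space) chart set \<Rightarrow>
   ('m \<Rightarrow> ('m, 'e) tvec \<Rightarrow> ('m \<Rightarrow> ('m, 'e) tvec) \<Rightarrow> ('m, 'e) tvec) \<Rightarrow>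
   'm set \<Rightarrow> ('m \<Rightarrow> real) \<Rightarrow> bool" where
  "nondegenerate A nabla C f \<longleftrightarrow>
     (\<forall>x\<in>C. \<forall>u\<in>tangent_space A x. u \<noteq> (\<lambda>c. 0) \<longrightarrow> hessian A nabla f x u u > 0)"

definition closed_function :: "'m::topological_space set \<Rightarrow> ('m \<Rightarrow> real) \<Rightarrow> bool" where
  "closed_function C f \<longleftrightarrow> closed {(x, y). x \<in> C \<and> y \<ge> f x}"

text \<open>Class C^3 is the regularity needed for \<open>\<nabla>Hf\<close> to be defined and continuous.\<close>

definition self_concordant ::
  "('m::{t2_space,second_countable_topology}, 'e::euclidean_space) chart set \<Rightarrow>
   ('m \<Rightarrow> ('m, 'e) tvec \<Rightarrow> ('m \<Rightarrow> ('m, 'e) tvec) \<Rightarrow> ('m, 'e) tvec) \<Rightarrow>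
   'm set \<Rightarrow> real \<Rightarrow> ('m \<Rightarrow> real) \<Rightarrow> bool" where
  "self_concordant A nabla C \<sigma> f \<longleftrightarrow>
     \<sigma> \<ge> 0 \<and> Ck_fun A 3 C f \<and> convex_function A nabla C f \<and> closed_function C f \<and>
     nondegenerate A nabla C f \<and>
     (\<forall>x\<in>C. \<forall>u\<in>tangent_space A x. \<forall>v\<in>tangent_space A x.
        \<bar>cov_deriv_hessian A nabla f x v u u\<bar>
          \<le> 2 * \<sigma> * sqrt (hessian A nabla f x v v) * hessian A nabla f x u u)"


section \<open>Newton's method\<close>

definition local_norm ::
  "('m::{t2_space,second_countable_topology}, 'e::euclidean_space) chart set \<Rightarrow>
   ('m \<Rightarrow> ('m, 'e) tvec \<Rightarrow> ('m \<Rightarrow> ('m, 'e) tvec) \<Rightarrow> ('m, 'e) tvec) \<Rightarrow>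
   ('m \<Rightarrow> real) \<Rightarrow> 'm \<Rightarrow> ('m, 'e) tvec \<Rightarrow> real" where
  "local_norm A nabla f x u = sqrt (hessian A nabla f x u u)"

definition newton_direction ::
  "('m::{t2_space,second_countable_topology}, 'e::euclidean_space) chart set \<Rightarrow>
   ('m \<Rightarrow> ('m, 'e) tvec \<Rightarrow> ('m \<Rightarrow> ('m, 'e) tvec) \<Rightarrow> ('m, 'e) tvec) \<Rightarrow>
   ('m \<Rightarrow> real) \<Rightarrow> 'm \<Rightarrow> ('m, 'e) tvec" where
  "newton_direction A nabla f x =
     (THE u. u \<in> tangent_space A x \<and>
        (\<forall>w\<in>tangent_space A x. differential A f x w + hessian A nabla f x u w = 0))"

definition newton_decrement ::
  "('m::{t2_space,second_countable_topology}, 'e::euclidean_space) chart set \<Rightarrow>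
   ('m \<Rightarrow> ('m, 'e) tvec \<Rightarrow> ('m \<Rightarrow> ('m, 'e) tvec) \<Rightarrow> ('m, 'e) tvec) \<Rightarrow>
   ('m \<Rightarrow> real) \<Rightarrow> 'm \<Rightarrow> real" where
  "newton_decrement A nabla f x = local_norm A nabla f x (newton_direction A nabla f x)"

definition newton_step ::
  "('m::{t2_space,second_countable_topology}, 'e::euclidean_space) chart set \<Rightarrow>
   ('m \<Rightarrow> ('m, 'e) tvec \<Rightarrow> ('m \<Rightarrow> ('m, 'e) tvec) \<Rightarrow> ('m, 'e) tvec) \<Rightarrow>
   ('m \<Rightarrow> real) \<Rightarrow> 'm \<Rightarrow> 'm" where
  "newton_step A nabla f x = exp_map A nabla x (newton_direction A nabla f x)"

text \<open>Quadratic convergence of a sequence of points to \<open>z\<close>: in coordinates around the limit, the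
  error is eventually bounded by a multiple of the square of the preceding error. This notion does
  not depend on the chart.\<close>

definition converges_quadratically ::
  "('m::{t2_space,second_countable_topology}, 'e::euclidean_space) chart set \<Rightarrow>
   (nat \<Rightarrow> 'm) \<Rightarrow> 'm \<Rightarrow> bool" where
  "converges_quadratically A X z \<longleftrightarrow>
     X \<longlonglongrightarrow> z \<and>
     (\<forall>c\<in>A. z \<in> chart_dom c \<longrightarrow>
        (\<exists>K. \<forall>\<^sub>F k in sequentially.
           norm (chart_map c (X (Suc k)) - chart_map c z) \<le> K * (norm (chart_map c (X k) - chart_map c z))\<^sup>2))"

text \<open>The starting points in \<open>C\<close> from which the Newton iteration never leaves \<open>C\<close> and
  converges quadratically to a minimizer of \<open>f\<close>, both as a sequence of points and as measured
  by the Newton decrement.\<close>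

definition quadratic_convergence_region ::
  "('m::{t2_space,second_countable_topology}, 'e::euclidean_space) chart set \<Rightarrow>
   ('m \<Rightarrow> ('m, 'e) tvec \<Rightarrow> ('m \<Rightarrow> ('m, 'e) tvec) \<Rightarrow> ('m, 'e) tvec) \<Rightarrow>
   'm set \<Rightarrow> ('m \<Rightarrow> real) \<Rightarrow> 'm set" where
  "quadratic_convergence_region A nabla C f =
     {x. (\<forall>k. (newton_step A nabla f ^^ k) x \<in> C) \<and>
         (\<exists>z\<in>C. (\<forall>y\<in>C. f z \<le> f y) \<and>
            converges_quadratically A (\<lambda>k. (newton_step A nabla f ^^ k) x) z) \<and>
         (\<lambda>k. newton_decrement A nabla f ((newton_step A nabla f ^^ k) x)) \<longlonglongrightarrow> 0 \<and>
         (\<exists>K. \<forall>k. newton_decrement A nabla f ((newton_step A nabla f ^^ Suc k) x)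
                \<le> K * (newton_decrement A nabla f ((newton_step A nabla f ^^ k) x))\<^sup>2)}"

end

(* Along the geodesic t -> gamma(t) = exp_x(t u) the function f o gamma has derivatives Df(gamma'),
   Hf(gamma', gamma') and (nabla Hf)(gamma', gamma', gamma'), so self-concordance says that
   1 / |gamma'|_f is sigma-Lipschitz. Hence f stays bounded along gamma while sigma |u|_f t < 1, and
   closedness of f keeps gamma inside C (Dikin ellipsoid); in particular x+ lies in C.
   For the decrement at x+ consider the covectors alpha_t = Df + (1 - t) Hf(gamma', .) along the
   Newton geodesic: alpha_0 = 0, alpha_1 = Df at x+, and nabla alpha = (1 - t) (nabla Hf)(gamma', .).
   With a = sigma lambda their dual norm N therefore satisfies
   (N (1 - a t))' <= 2 sigma lambda^2 (1 - t) / (1 - a), and N(1) = lambda(x+) <= sigma lambda^2 / (1 - a)^2.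

   Below the threshold (3 - sqrt 5) / (2 sigma) the decrements of the iterates x_k decrease
   quadratically. Writing x_k = exp_x(v_k), the inequality Df(gamma')|_0^1 >= r^2 / (1 + sigma r) for a
   geodesic of initial length r bounds v_k, and a limit point v of the v_k satisfies
   |v|_f <= lambda / (1 - sigma lambda) < 1 / sigma. So z = exp_x(v) is in C, it is critical, and the
   same inequality at z forces x_k -> z. Near z the decrement is comparable to the distance to z in
   any chart. *)

theory Submission
  imports Defs
begin

section \<open>Calculus in Euclidean spaces\<close>

text \<open>The factor \<open>1 - t\<close> in the covector makes its own derivative cancel the
  Hessian term that comes from differentiating \<open>Df\<close>; only a third-order term is left,
  which self-concordance controls. With \<open>p\<close> the speed of the geodesic this gives N' <=
  2 \<sigma> (1 - t) p^2 + \<sigma> p N. Since p (1 - a t) <= \<lambda>, the weight 1 - a t absorbs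
  the term in N and one of the two factors p; the bound p <= \<lambda> / (1 - a) handles the other.
  Self-concordance speaks of equal arguments only. Torsion-freeness makes the Hessian symmetric, and
  polarization then yields the mixed arguments that occur above. Two obstacles shape the proof. N
  need not be differentiable where it vanishes, so the inequality is derived at a maximum by means
  of a support function. No distance is given on the manifold, so the limit of the iterates is found
  in the fixed space T_x; its image stays in C if \<sigma> \<lambda> / (1 - \<sigma> \<lambda>) < 1,
  that is \<sigma> \<lambda> < 1/2. The number (3 - sqrt 5) / 2 is the smaller root of a = (1 -
  a)^2: below it a step contracts the decrement.\<close>

abbreviation fd :: "('a::real_normed_vector \<Rightarrow> 'b::real_normed_vector) \<Rightarrow> 'a \<Rightarrow> 'a \<Rightarrow> 'b" where
  "fd g y \<equiv> frechet_derivative g (at y)"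

text \<open>\<open>fd\<close> looks at a whole neighbourhood, so agreement on \<open>S\<close>
  passes to the derivatives because \<open>S\<close> is open.\<close>

lemma Ck_on_cong:
  fixes g h :: "'a::euclidean_space \<Rightarrow> 'b::real_normed_vector"
  assumes "open S" "\<And>x. x \<in> S \<Longrightarrow> g x = h x" "Ck_on k S g"
  shows "Ck_on k S h"
  using assms(2,3)
proof (induction k arbitrary: g h)
  case 0
  then show ?case by (simp cong: continuous_on_cong)
next
  case (Suc k)
  have *: "(h has_derivative fd g x) (at x)" if "x \<in> S" for x
  proof -
    have "(g has_derivative fd g x) (at x)"
      using Suc.prems that by (auto simp: frechet_derivative_works)
    then show ?thesis
      using has_derivative_transform_within_open[OF _ \<open>open S\<close> that] Suc.prems by blast
  qed
  have "Ck_on k S (\<lambda>x. fd h x v)" for v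
    by (rule Suc.IH[of "\<lambda>x. fd g x v"]) (use Suc.prems frechet_derivative_at[OF *] in auto)
  with * show ?case by (auto simp: differentiable_def)
qed

lemma Ck_on_Suc_has_derivative:
  fixes f :: "'a::euclidean_space \<Rightarrow> 'b::real_normed_vector"
  assumes "open S" "\<And>x. x \<in> S \<Longrightarrow> (f has_derivative f' x) (at x)"
    and "\<And>v. Ck_on k S (\<lambda>x. f' x v)"
  shows "Ck_on (Suc k) S f"
proof -
  have "Ck_on k S (\<lambda>x. fd f x v)" for v
    by (rule Ck_on_cong[OF assms(1) _ assms(3)[of v]]) (use frechet_derivative_at[OF assms(2)] in metis)
  then show ?thesis using assms(2) by (auto simp: differentiable_def)
qed

lemma Ck_on_has_derivative:
  "Ck_on (Suc k) S f \<Longrightarrow> x \<in> S \<Longrightarrow> (f has_derivative fd f x) (at x)"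
  by (simp flip: frechet_derivative_works)

lemma Ck_on_SucD: "Ck_on (Suc k) S f \<Longrightarrow> Ck_on k S f"
proof (induction k arbitrary: f)
  case 0
  then show ?case
    by (auto intro!: continuous_at_imp_continuous_on differentiable_imp_continuous_within)
next
  case (Suc k)
  then show ?case by simp
qed

lemma Ck_on_mono: "Ck_on k S f \<Longrightarrow> m \<le> k \<Longrightarrow> Ck_on m S f"
  by (induction k) (auto simp: le_Suc_eq dest: Ck_on_SucD simp del: Ck_on.simps(2))

lemma Ck_on_subset: "Ck_on k S f \<Longrightarrow> T \<subseteq> S \<Longrightarrow> Ck_on k T f"
  by (induction k arbitrary: f) (auto intro: continuous_on_subset)

lemma Ck_on_continuous: "Ck_on k S f \<Longrightarrow> continuous_on S f"
  using Ck_on_mono[of k S f 0] by simp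

lemma Ck_on_const [simp]: "Ck_on k S (\<lambda>x. a)"
  by (induction k arbitrary: a) auto

lemma Ck_on_add:
  assumes "open S" "Ck_on k S f" "Ck_on k S g"
  shows "Ck_on k S (\<lambda>x. f x + g x)"
  using assms(2,3)
proof (induction k arbitrary: f g)
  case 0
  then show ?case by (auto intro: continuous_intros)
next
  case (Suc k)
  show ?case
    by (rule Ck_on_Suc_has_derivative[OF assms(1)
          has_derivative_add[OF Ck_on_has_derivative Ck_on_has_derivative]])
      (use Suc in auto)
qed

lemma Ck_on_sum:
  assumes "open S" "\<And>i. i \<in> I \<Longrightarrow> Ck_on k S (f i)"
  shows "Ck_on k S (\<lambda>x. \<Sum>i\<in>I. f i x)"
  using assms(2) by (induction I rule: infinite_finite_induct) (auto intro: Ck_on_add[OF assms(1)])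

lemma Ck_on_bounded_linear:
  assumes "open S" "bounded_linear L" "Ck_on k S f"
  shows "Ck_on k S (\<lambda>x. L (f x))"
  using assms(3)
proof (induction k arbitrary: f)
  case 0
  then show ?case using assms(2) by (auto intro: bounded_linear.continuous_on)
next
  case (Suc k)
  show ?case
    by (rule Ck_on_Suc_has_derivative[OF assms(1)
          bounded_linear.has_derivative[OF assms(2) Ck_on_has_derivative]])
      (use Suc in auto)
qed

lemma Ck_on_linear: "open S \<Longrightarrow> bounded_linear L \<Longrightarrow> Ck_on k S L"
proof (cases k)
  case (Suc n)
  assume "open S" "bounded_linear L"
  then show ?thesis
    unfolding Suc by (intro Ck_on_Suc_has_derivative[where f'="\<lambda>_. L"])
      (auto intro: bounded_linear_imp_has_derivative)
qed (auto simp: linear_continuous_on)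

lemma Ck_on_scaleR:
  fixes g :: "'a::euclidean_space \<Rightarrow> real"
  assumes "open S" "Ck_on k S g" "Ck_on k S f"
  shows "Ck_on k S (\<lambda>x. g x *\<^sub>R f x)"
  using assms(2,3)
proof (induction k arbitrary: g f)
  case 0
  then show ?case by (auto intro: continuous_intros)
next
  case (Suc k)
  show ?case
  proof (rule Ck_on_Suc_has_derivative[OF assms(1)
          has_derivative_scaleR[OF Ck_on_has_derivative Ck_on_has_derivative]])
    show "Ck_on k S (\<lambda>x. g x *\<^sub>R fd f x v + fd g x v *\<^sub>R f x)" for v
      using Suc.prems Suc.prems[THEN Ck_on_SucD] by (intro Ck_on_add assms(1) Suc.IH) auto
  qed (use Suc.prems in auto)
qed

lemma linear_basis_sum:
  fixes L :: "'a::euclidean_space \<Rightarrow> 'b::real_vector"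
  assumes "linear L"
  shows "L w = (\<Sum>i\<in>Basis. (w \<bullet> i) *\<^sub>R L i)"
proof -
  have "L w = L (\<Sum>i\<in>Basis. (w \<bullet> i) *\<^sub>R i)" by (simp add: euclidean_representation)
  also have "\<dots> = (\<Sum>i\<in>Basis. (w \<bullet> i) *\<^sub>R L i)"
    using assms by (simp add: linear_sum linear_cmul)
  finally show ?thesis .
qed

text \<open>By the chain rule the derivative in direction \<open>v\<close> is a sum of products of
  the coordinates of the derivative of \<open>f\<close> with composites of the partial derivatives
  of \<open>g\<close> with the same \<open>f\<close>. Hence the induction generalizes over
  \<open>g\<close> only.\<close>

lemma Ck_on_compose:
  fixes f :: "'a::euclidean_space \<Rightarrow> 'b::euclidean_space"
    and g :: "'b \<Rightarrow> 'c::real_normed_vector"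
  assumes "open S" "open T" "f ` S \<subseteq> T" "Ck_on k S f" "Ck_on k T g"
  shows "Ck_on k S (\<lambda>x. g (f x))"
  using assms(4,5)
proof (induction k arbitrary: g)
  case 0
  then show ?case using assms(3) by (auto intro: continuous_on_compose2)
next
  case (Suc k)
  have mem: "f x \<in> T" if "x \<in> S" for x using assms(3) that by auto
  let ?Df = "\<lambda>x. fd f x" and ?Dg = "\<lambda>y. fd g y"
  have der: "((\<lambda>x. g (f x)) has_derivative (\<lambda>v. ?Dg (f x) (?Df x v))) (at x)" if "x \<in> S" for x
    using has_derivative_compose[OF Ck_on_has_derivative[OF Suc.prems(1) that], of g]
      Ck_on_has_derivative[OF Suc.prems(2) mem[OF that]] by blast
  show ?case
  proof (rule Ck_on_Suc_has_derivative[OF assms(1) der])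
    fix v
    have "Ck_on k S (\<lambda>x. \<Sum>i\<in>Basis. (?Df x v \<bullet> i) *\<^sub>R ?Dg (f x) i)"
      using Suc.prems Suc.prems(1)[THEN Ck_on_SucD]
      by (intro Ck_on_sum Ck_on_scaleR assms(1) Suc.IH Ck_on_bounded_linear[OF _ bounded_linear_inner_left])
        auto
    then show "Ck_on k S (\<lambda>x. ?Dg (f x) (?Df x v))"
    proof (rule Ck_on_cong[OF assms(1), rotated])
      fix x assume "x \<in> S"
      have "linear (?Dg (f x))"
        using Suc.prems(2) mem[OF \<open>x \<in> S\<close>] by (intro linear_frechet_derivative) auto
      then show "(\<Sum>i\<in>Basis. (?Df x v \<bullet> i) *\<^sub>R ?Dg (f x) i) = ?Dg (f x) (?Df x v)"
        by (simp add: linear_basis_sum[of "?Dg (f x)" "?Df x v"])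
    qed
  qed
qed

text \<open>Mean value theorem applied twice: first along \<open>u\<close> to the increment of
  \<open>f\<close> across \<open>s *\<^sub>R v\<close>, then along \<open>v\<close> to the resulting
  increment of the derivative in direction \<open>u\<close>. The second difference is symmetric in
  \<open>u\<close> and \<open>v\<close>, which is the source of the symmetry of second
  derivatives.\<close>

lemma second_difference_mvt:
  fixes f :: "'a::euclidean_space \<Rightarrow> real"
  assumes S: "ball x r \<subseteq> S" and f: "Ck_on 2 S f" and s: "s > 0" "s * (norm u + norm v) < r"
  obtains p where "p \<in> ball x r"
    "f (x + s *\<^sub>R u + s *\<^sub>R v) - f (x + s *\<^sub>R u) - f (x + s *\<^sub>R v) + f x
      = s^2 * fd (\<lambda>y. fd f y u) p v"
proof -
  let ?D = "\<lambda>y. fd f y u"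
  have inball: "x + a *\<^sub>R u + b *\<^sub>R v \<in> ball x r" if "0 \<le> a" "a \<le> s" "0 \<le> b" "b \<le> s" for a b
  proof -
    have "norm (a *\<^sub>R u + b *\<^sub>R v) \<le> a * norm u + b * norm v"
      using norm_triangle_ineq[of "a *\<^sub>R u" "b *\<^sub>R v"] that by simp
    also have "\<dots> \<le> s * (norm u + norm v)"
      using that by (simp add: distrib_left add_mono mult_right_mono)
    finally have "norm (a *\<^sub>R u + b *\<^sub>R v) < r" using s by simp
    moreover have "dist x (x + a *\<^sub>R u + b *\<^sub>R v) = norm (a *\<^sub>R u + b *\<^sub>R v)"
      by (metis add.assoc add_diff_cancel_left' dist_commute dist_norm)
    ultimately show ?thesis by simp
  qed
  have f2: "Ck_on (Suc (Suc 0)) S f" using f by (simp add: numeral_2_eq_2)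
  have df: "(f has_derivative fd f y) (at y)" if "y \<in> ball x r" for y
    using Ck_on_has_derivative[OF f2] that S by blast
  have dD: "(?D has_derivative fd ?D y) (at y)" if "y \<in> ball x r" for y
  proof -
    have "Ck_on (Suc 0) S ?D" using f2 by simp
    from Ck_on_has_derivative[OF this] that S show ?thesis by blast
  qed
  have line: "((\<lambda>a. f (x + a *\<^sub>R u + b *\<^sub>R v)) has_real_derivative ?D (x + a *\<^sub>R u + b *\<^sub>R v)) (at a)"
    if "0 \<le> a" "a \<le> s" "0 \<le> b" "b \<le> s" for a b
  proof -
    have "((\<lambda>a. x + a *\<^sub>R u + b *\<^sub>R v) has_derivative (\<lambda>h. h *\<^sub>R u)) (at a)"
      by (auto intro!: derivative_eq_intros)
    from has_derivative_compose[OF this df[OF inball[OF that]]]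
    show ?thesis
      using linear_cmul[OF has_derivative_linear[OF df[OF inball[OF that]]]]
      by (simp add: has_field_derivative_def mult_commute_abs)
  qed
  have "\<exists>a. 0 < a \<and> a < s \<and> (f (x + s *\<^sub>R u + s *\<^sub>R v) - f (x + s *\<^sub>R u + 0 *\<^sub>R v)) - (f (x + 0 *\<^sub>R u + s *\<^sub>R v) - f (x + 0 *\<^sub>R u + 0 *\<^sub>R v))
      = (s - 0) * (?D (x + a *\<^sub>R u + s *\<^sub>R v) - ?D (x + a *\<^sub>R u + 0 *\<^sub>R v))"
  proof (rule MVT2[OF s(1)])
    fix a assume "0 \<le> a" "a \<le> s"
    then show "((\<lambda>a. f (x + a *\<^sub>R u + s *\<^sub>R v) - f (x + a *\<^sub>R u + 0 *\<^sub>R v)) has_real_derivative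
        ?D (x + a *\<^sub>R u + s *\<^sub>R v) - ?D (x + a *\<^sub>R u + 0 *\<^sub>R v)) (at a)"
      using s by (intro DERIV_diff line) auto
  qed
  then obtain a where a: "0 < a" "a < s" and "(f (x + s *\<^sub>R u + s *\<^sub>R v) - f (x + s *\<^sub>R u + 0 *\<^sub>R v)) - (f (x + 0 *\<^sub>R u + s *\<^sub>R v) - f (x + 0 *\<^sub>R u + 0 *\<^sub>R v))
      = (s - 0) * (?D (x + a *\<^sub>R u + s *\<^sub>R v) - ?D (x + a *\<^sub>R u + 0 *\<^sub>R v))" by blast
  then have a3: "f (x + s *\<^sub>R u + s *\<^sub>R v) - f (x + s *\<^sub>R u) - f (x + s *\<^sub>R v) + f x
      = s * (?D (x + a *\<^sub>R u + s *\<^sub>R v) - ?D (x + a *\<^sub>R u))" by simp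
  have line2: "((\<lambda>b. ?D (x + a *\<^sub>R u + b *\<^sub>R v)) has_real_derivative
      fd ?D (x + a *\<^sub>R u + b *\<^sub>R v) v) (at b)"
    if "0 \<le> b" "b \<le> s" for b
  proof -
    have *: "((\<lambda>b. x + a *\<^sub>R u + b *\<^sub>R v) has_derivative (\<lambda>h. h *\<^sub>R v)) (at b)"
      by (auto intro!: derivative_eq_intros)
    have m: "x + a *\<^sub>R u + b *\<^sub>R v \<in> ball x r" using a that by (intro inball) auto
    from has_derivative_compose[OF * dD[OF m]]
    show ?thesis
      using linear_cmul[OF has_derivative_linear[OF dD[OF m]]]
      by (simp add: has_field_derivative_def mult_commute_abs)
  qed
  have "\<exists>b. 0 < b \<and> b < s \<and> ?D (x + a *\<^sub>R u + s *\<^sub>R v) - ?D (x + a *\<^sub>R u + 0 *\<^sub>R v)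
      = (s - 0) * fd ?D (x + a *\<^sub>R u + b *\<^sub>R v) v"
    by (rule MVT2[OF s(1)]) (use line2 in auto)
  then obtain b where b: "0 < b" "b < s" "?D (x + a *\<^sub>R u + s *\<^sub>R v) - ?D (x + a *\<^sub>R u)
      = s * fd ?D (x + a *\<^sub>R u + b *\<^sub>R v) v" by auto
  show thesis
    using that[OF inball[of a b]] a a3 b by (simp add: power2_eq_square)
qed

text \<open>Exchanging \<open>u\<close> and \<open>v\<close> leaves the second difference unchanged,
  so the two mixed derivatives take a common value at points \<open>p\<close> and \<open>q\<close>
  arbitrarily close to \<open>x\<close>; continuity carries this to \<open>x\<close>.\<close>

lemma second_derivative_symmetric:
  fixes f :: "'a::euclidean_space \<Rightarrow> real"
  assumes "open S" "x \<in> S" and f: "Ck_on 2 S f"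
  shows "fd (\<lambda>y. fd f y u) x v
       = fd (\<lambda>y. fd f y v) x u"
proof -
  let ?A = "\<lambda>p. fd (\<lambda>y. fd f y u) p v"
  let ?B = "\<lambda>p. fd (\<lambda>y. fd f y v) p u"
  have "continuous_on S ?A" "continuous_on S ?B" using f by (simp_all add: numeral_2_eq_2)
  then have cA: "isCont ?A x" and cB: "isCont ?B x"
    using assms continuous_on_eq_continuous_at by blast+
  have "\<bar>?A x - ?B x\<bar> \<le> e" if "e > 0" for e
  proof -
    obtain r1 where r1: "r1 > 0" "\<And>y. dist y x < r1 \<Longrightarrow> dist (?A y) (?A x) < e/2"
      using cA \<open>e > 0\<close> unfolding continuous_at_eps_delta by (metis half_gt_zero)
    obtain r2 where r2: "r2 > 0" "\<And>y. dist y x < r2 \<Longrightarrow> dist (?B y) (?B x) < e/2"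
      using cB \<open>e > 0\<close> unfolding continuous_at_eps_delta by (metis half_gt_zero)
    obtain r3 where r3: "r3 > 0" "ball x r3 \<subseteq> S" using assms(1,2) openE by blast
    define r where "r = min r1 (min r2 r3)"
    have r: "r > 0" "ball x r \<subseteq> S" using r1 r2 r3 by (auto simp: r_def)
    \<comment> \<open>This size keeps the parallelogram inside the ball; the summand 1 covers
      \<open>u = v = 0\<close>.\<close>
    define s where "s = r / (2 * (norm u + norm v + 1))"
    have pos: "norm u + norm v + 1 > 0" by (smt (verit) norm_ge_zero)
    have s: "s > 0" using r pos by (simp add: s_def)
    have "s * (norm u + norm v) \<le> s * (norm u + norm v + 1)"
      using s by (intro mult_left_mono) auto
    also have "s * (norm u + norm v + 1) = r / 2"
      unfolding s_def using pos by (simp add: field_simps)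
    finally have ss: "s * (norm u + norm v) < r" using r by simp
    obtain p where p: "p \<in> ball x r" "f (x + s *\<^sub>R u + s *\<^sub>R v) - f (x + s *\<^sub>R u) - f (x + s *\<^sub>R v) + f x = s^2 * ?A p"
      using second_difference_mvt[OF r(2) f s ss] by blast
    obtain q where q: "q \<in> ball x r" "f (x + s *\<^sub>R v + s *\<^sub>R u) - f (x + s *\<^sub>R v) - f (x + s *\<^sub>R u) + f x = s^2 * ?B q"
      using second_difference_mvt[OF r(2) f s, of v u] ss by (metis add.commute)
    have "s^2 * ?A p = s^2 * ?B q" using p q by (simp add: algebra_simps)
    then have "?A p = ?B q" using s by simp
    moreover have "dist (?A p) (?A x) < e/2" "dist (?B q) (?B x) < e/2"
      using p q r1 r2 by (auto simp: r_def dist_commute)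
    ultimately show ?thesis unfolding dist_real_def by linarith
  qed
  then have "\<bar>?A x - ?B x\<bar> \<le> 0" by (rule field_le_epsilon) simp
  then show ?thesis by simp
qed

text \<open>Derivatives of \<open>L\<close> are known only for each fixed argument. Expanding in the
  basis reduces to finitely many coefficient functions, without assuming that \<open>L'\<close> is
  linear in that argument.\<close>

lemma has_derivative_linear_family_sum:
  fixes L :: "'z::real_normed_vector \<Rightarrow> 'a::euclidean_space \<Rightarrow> 'b::real_normed_vector"
  assumes t: "t \<in> I" and lin: "\<forall>\<^sub>F s in at t within I. linear (L s)" "linear (L t)"
    and L: "\<And>u. ((\<lambda>s. L s u) has_derivative L' u) (at t within I)"
    and u: "(u has_derivative u') (at t within I)"
  shows "((\<lambda>s. L s (u s)) has_derivative
      (\<lambda>x. \<Sum>i\<in>Basis. (u t \<bullet> i) *\<^sub>R L' i x + (u' x \<bullet> i) *\<^sub>R L t i)) (at t within I)"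
proof (rule has_derivative_transform_eventually[OF _ _ _ t])
  show "((\<lambda>s. \<Sum>i\<in>Basis. (u s \<bullet> i) *\<^sub>R L s i) has_derivative
      (\<lambda>x. \<Sum>i\<in>Basis. (u t \<bullet> i) *\<^sub>R L' i x + (u' x \<bullet> i) *\<^sub>R L t i)) (at t within I)"
    by (intro has_derivative_sum has_derivative_scaleR[OF _ L]
        bounded_linear.has_derivative[OF bounded_linear_inner_left u])
  show "\<forall>\<^sub>F s in at t within I. (\<Sum>i\<in>Basis. (u s \<bullet> i) *\<^sub>R L s i) = L s (u s)"
    using lin(1) by eventually_elim (simp flip: linear_basis_sum)
  show "(\<Sum>i\<in>Basis. (u t \<bullet> i) *\<^sub>R L t i) = L t (u t)"
    by (simp flip: linear_basis_sum[OF lin(2)])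
qed

lemma has_derivative_linear_family:
  fixes L :: "'z::real_normed_vector \<Rightarrow> 'a::euclidean_space \<Rightarrow> 'b::real_normed_vector"
  assumes lin: "\<forall>\<^sub>F s in at t. linear (L s)" "linear (L t)"
    and L: "\<And>u. ((\<lambda>s. L s u) has_derivative L' u) (at t)"
    and u: "(u has_derivative u') (at t)"
  shows "((\<lambda>s. L s (u s)) has_derivative (\<lambda>x. L' (u t) x + L t (u' x))) (at t)"
proof -
  note sum = has_derivative_linear_family_sum[OF UNIV_I lin L]
  \<comment> \<open>For a constant argument the derivative is \<open>L' (u t)\<close> by assumption,
    so uniqueness of derivatives identifies the basis sum.\<close>
  have "(\<lambda>x. \<Sum>i\<in>Basis. (u t \<bullet> i) *\<^sub>R L' i x) = L' (u t)"
    using has_derivative_unique[OF sum[OF has_derivative_const[of "u t"]] L] by simp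
  then show ?thesis
    using sum[OF u] by (simp add: sum.distrib fun_eq_iff linear_basis_sum[OF lin(2), symmetric])
qed

lemma has_vector_derivative_linear_family:
  fixes L :: "real \<Rightarrow> 'a::euclidean_space \<Rightarrow> 'b::real_normed_vector"
  assumes t: "t \<in> I" and lin: "\<forall>\<^sub>F s in at t within I. linear (L s)" "linear (L t)"
    and L: "\<And>u. ((\<lambda>s. L s u) has_vector_derivative L' u) (at t within I)"
    and u: "(u has_vector_derivative u') (at t within I)"
  shows "((\<lambda>s. L s (u s)) has_vector_derivative (L' (u t) + L t u')) (at t within I)"
\<comment> \<open>At an isolated point of \<open>I\<close> derivatives are not unique, which blocks
  the identification of the basis sum; there every derivative claim holds trivially.\<close>
proof (cases "at t within I = bot")
  case True
  then show ?thesis by (auto simp: has_vector_derivative_def has_derivative_def bounded_linear_scaleR_left)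
next
  case False
  have sum: "((\<lambda>s. L s (w s)) has_vector_derivative
      (\<Sum>i\<in>Basis. (w t \<bullet> i) *\<^sub>R L' i + (w' \<bullet> i) *\<^sub>R L t i)) (at t within I)"
    if "(w has_vector_derivative w') (at t within I)" for w w'
    using has_derivative_linear_family_sum[OF t lin L[unfolded has_vector_derivative_def]
        that[unfolded has_vector_derivative_def]]
    by (simp add: has_vector_derivative_def scaleR_sum_right algebra_simps sum.distrib)
  have "L' (u t) = (\<Sum>i\<in>Basis. (u t \<bullet> i) *\<^sub>R L' i)"
    using vector_derivative_unique_within[OF False L sum[OF has_vector_derivative_const[of "u t"]]] by simp
  then show ?thesis
    using sum[OF u] linear_basis_sum[OF lin(2), of u'] by (simp add: sum.distrib)
qed

section \<open>Positive definite bilinear forms\<close>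

definition sym_form :: "('a::euclidean_space \<Rightarrow> 'a \<Rightarrow> real) \<Rightarrow> bool" where
  "sym_form h \<longleftrightarrow> (\<forall>u. linear (h u)) \<and> (\<forall>u w. h u w = h w u)"

definition pos_form :: "('a::euclidean_space \<Rightarrow> 'a \<Rightarrow> real) \<Rightarrow> bool" where
  "pos_form h \<longleftrightarrow> sym_form h \<and> (\<forall>u. u \<noteq> 0 \<longrightarrow> h u u > 0)"

lemma sym_form_simps:
  assumes "sym_form h"
  shows "h u (v + w) = h u v + h u w" "h (v + w) u = h v u + h w u"
    "h u (a *\<^sub>R w) = a * h u w" "h (a *\<^sub>R w) u = a * h w u"
    "h u (v - w) = h u v - h u w" "h (v - w) u = h v u - h w u" "h u 0 = 0" "h 0 u = 0"
proof -
  have *: "linear (h u)" for u using assms by (simp add: sym_form_def)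
  have s: "h v w = h w v" for v w using assms by (simp add: sym_form_def)
  show 1: "h u (v + w) = h u v + h u w" "h u (a *\<^sub>R w) = a * h u w" "h u (v - w) = h u v - h u w" "h u 0 = 0"
    using * by (simp_all add: linear_add linear_cmul linear_diff linear_0)
  then show "h (v + w) u = h v u + h w u" "h (a *\<^sub>R w) u = a * h w u" "h (v - w) u = h v u - h w u" "h 0 u = 0"
    by (simp_all add: s[of _ u])
qed

lemma sym_form_sym: "sym_form h \<Longrightarrow> h u w = h w u"
  by (simp add: sym_form_def)

lemma pos_form_sym_form: "pos_form h \<Longrightarrow> sym_form h"
  by (simp add: pos_form_def)

lemma pos_form_nonneg: "pos_form h \<Longrightarrow> h u u \<ge> 0"
  by (metis less_eq_real_def pos_form_def sym_form_simps(7))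

text \<open>By polarization the operator norm of a symmetric form is attained on the diagonal.\<close>

lemma sym_form_polarization_bound:
  assumes h: "pos_form h" and B: "sym_form B" and bd: "\<And>u. \<bar>B u u\<bar> \<le> K * h u u"
  shows "\<bar>B u w\<bar> \<le> K * sqrt (h u u) * sqrt (h w w)"
proof (cases "u = 0 \<or> w = 0")
  case True
  then show ?thesis using sym_form_simps(7,8)[OF B] sym_form_simps(7,8)[OF pos_form_sym_form[OF h]] by auto
next
  case False
  note hs = sym_form_simps[OF pos_form_sym_form[OF h]] and Bs = sym_form_simps[OF B]
  have pos: "h u u > 0" "h w w > 0" using h False by (auto simp: pos_form_def)
  define x where "x = (1 / sqrt (h u u)) *\<^sub>R u"
  define y where "y = (1 / sqrt (h w w)) *\<^sub>R w"
  have hx: "h x x = 1" "h y y = 1" using pos by (auto simp: x_def y_def hs)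
  have "4 * B x y = B (x + y) (x + y) - B (x - y) (x - y)"
    by (simp add: Bs sym_form_sym[OF B, of y x])
  \<comment> \<open>Parallelogram law for \<open>h\<close>-unit vectors; it makes the two diagonal
    bounds add up to \<open>K * 4\<close>.\<close>
  moreover have "h (x + y) (x + y) + h (x - y) (x - y) = 4"
    by (simp add: hs hx)
  then have "K * h (x + y) (x + y) + K * h (x - y) (x - y) = K * 4"
    by (simp flip: distrib_left)
  ultimately have "\<bar>4 * B x y\<bar> \<le> K * 4"
    using bd[of "x + y"] bd[of "x - y"] by linarith
  then have "\<bar>B x y\<bar> \<le> K" by simp
  moreover have "B x y = B u w / (sqrt (h u u) * sqrt (h w w))"
    by (simp add: x_def y_def Bs)
  ultimately show ?thesis using pos by (simp add: abs_mult divide_le_eq mult.assoc)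
qed

lemma pos_form_Cauchy:
  assumes "pos_form h" shows "\<bar>h u w\<bar> \<le> sqrt (h u u) * sqrt (h w w)"
  using sym_form_polarization_bound[OF assms pos_form_sym_form[OF assms], of 1]
    pos_form_nonneg[OF assms] by simp

lemma pos_form_unique:
  assumes "pos_form h" "\<And>w. h u w = h v w" shows "u = v"
proof -
  have "h (u - v) (u - v) = 0"
    using assms(2) by (simp add: sym_form_simps[OF pos_form_sym_form[OF assms(1)]])
  then show ?thesis using assms(1) by (metis eq_iff_diff_eq_0 less_irrefl pos_form_def)
qed

text \<open>The map from \<open>u\<close> to the coordinates of \<open>h u\<close> is linear, and
  injective by definiteness, hence onto in finite dimension.\<close>

lemma pos_form_riesz:
  fixes h :: "'a::euclidean_space \<Rightarrow> 'a \<Rightarrow> real"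
  assumes "pos_form h" "linear \<alpha>"
  obtains u where "\<And>w. h u w = \<alpha> w"
proof -
  note hs = sym_form_simps[OF pos_form_sym_form[OF assms(1)]]
  have lin: "linear (h u)" for u using assms by (simp add: pos_form_def sym_form_def)
  define F where "F u = (\<Sum>i\<in>Basis. h u i *\<^sub>R i)" for u
  have "linear F"
    by (rule linearI) (simp_all add: F_def hs scaleR_left_distrib sum.distrib scaleR_sum_right)
  moreover have comp: "F u \<bullet> i = h u i" if "i \<in> Basis" for u i
    using that by (simp add: F_def)
  have "inj F"
  proof (rule injI)
    fix u v assume "F u = F v"
    then have "h u i = h v i" if "i \<in> Basis" for i using comp that by metis
    then have "h u w = h v w" for w
      using linear_basis_sum[OF lin[of u], of w] linear_basis_sum[OF lin[of v], of w] by simp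
    then show "u = v" by (rule pos_form_unique[OF assms(1)])
  qed
  ultimately have "surj F" by (simp add: linear_injective_imp_surjective)
  then obtain u where u: "F u = (\<Sum>i\<in>Basis. \<alpha> i *\<^sub>R i)" by (metis surjD)
  have "h u i = \<alpha> i" if "i \<in> Basis" for i using comp[OF that, of u] that by (simp add: u)
  then have "h u w = \<alpha> w" for w
    using linear_basis_sum[OF lin[of u], of w] linear_basis_sum[OF assms(2), of w] by simp
  then show thesis by (rule that)
qed

lemma sym_form_entry_bound:
  assumes "sym_form B"
  shows "\<bar>B u w\<bar> \<le> (\<Sum>i\<in>Basis. \<Sum>j\<in>Basis. \<bar>B i j\<bar>) * norm u * norm w"
proof -
  have lin: "linear (B u)" "linear (\<lambda>u. B u w)" for u w
    using assms by (simp_all add: sym_form_def linear_iff)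
  have "B u w = (\<Sum>i\<in>Basis. (u \<bullet> i) * (\<Sum>j\<in>Basis. (w \<bullet> j) * B i j))"
    using linear_basis_sum[OF lin(2), of u w] linear_basis_sum[OF lin(1), of _ w] by simp
  also have "\<bar>\<dots>\<bar> \<le> (\<Sum>i\<in>Basis. norm u * (\<Sum>j\<in>Basis. norm w * \<bar>B i j\<bar>))"
    by (intro order.trans[OF sum_abs] sum_mono)
      (auto simp: abs_mult Basis_le_norm intro!: mult_mono order.trans[OF sum_abs] sum_mono)
  also have "\<dots> = (\<Sum>i\<in>Basis. \<Sum>j\<in>Basis. \<bar>B i j\<bar>) * norm u * norm w"
    by (simp add: sum_distrib_left sum_distrib_right mult_ac)
  finally show ?thesis .
qed

text \<open>\<open>m\<close> is the minimum of the quadratic form over the compact unit sphere,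
  extended by homogeneity.\<close>

lemma pos_form_lower_bound:
  fixes h :: "'a::euclidean_space \<Rightarrow> 'a \<Rightarrow> real"
  assumes h: "pos_form h"
  obtains m where "m > 0" "\<And>u. m * (norm u)\<^sup>2 \<le> h u u"
proof -
  note hs = sym_form_simps[OF pos_form_sym_form[OF h]]
  have lin: "linear (h u)" for u using h by (simp add: pos_form_def sym_form_def)
  have eq: "h u u = (\<Sum>i\<in>Basis. (u \<bullet> i) * h u i)" for u
    using linear_basis_sum[OF lin[of u], of u] by simp
  have "continuous_on UNIV (\<lambda>u. h u i)" for i
    using linear_continuous_on[OF lin[of i, unfolded linear_conv_bounded_linear]]
    by (simp add: sym_form_sym[OF pos_form_sym_form[OF h], of _ i])
  then have "continuous_on UNIV (\<lambda>u. h u u)"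
    by (subst eq) (auto intro!: continuous_intros)
  then have "continuous_on (sphere 0 1) (\<lambda>u. h u u)" using continuous_on_subset by blast
  then obtain x where x: "x \<in> sphere 0 1" "\<And>y. y \<in> sphere 0 1 \<Longrightarrow> h x x \<le> h y y"
    using continuous_attains_inf[of "sphere 0 1" "\<lambda>u. h u u"] by (auto simp: compact_sphere)
  have "h x x * (norm u)\<^sup>2 \<le> h u u" for u
  proof (cases "u = 0")
    case False
    define v where "v = (1 / norm u) *\<^sub>R u"
    have "u = norm u *\<^sub>R v" using False by (simp add: v_def)
    then have "h u u = (norm u)\<^sup>2 * h v v" by (metis hs(3,4) mult.assoc power2_eq_square)
    moreover have "h x x \<le> h v v" using False by (intro x(2)) (simp add: v_def)
    ultimately show ?thesis by (simp add: mult.commute mult_right_mono)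
  qed (simp add: hs)
  moreover have "x \<noteq> 0" using x(1) by auto
  then have "h x x > 0" using h by (simp add: pos_form_def)
  ultimately show thesis using that by blast
qed

text \<open>A form has finitely many entries, so entrywise convergence already pushes the entry sum
  of the difference below half the coercivity constant, uniformly in both arguments; the bounds of
  the limit form survive with that loss.\<close>

lemma pos_form_eventually_bounds:
  fixes h :: "'b \<Rightarrow> 'a::euclidean_space \<Rightarrow> 'a \<Rightarrow> real"
  assumes h0: "pos_form h0" and h: "\<forall>\<^sub>F s in F. sym_form (h s)"
    and lim: "\<And>u w. ((\<lambda>s. h s u w) \<longlongrightarrow> h0 u w) F"
  obtains m M where "m > 0" "M > 0"
    "\<forall>\<^sub>F s in F. \<forall>u w. m * (norm u)\<^sup>2 \<le> h s u u \<and> \<bar>h s u w\<bar> \<le> M * norm u * norm w"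
proof -
  obtain m where m: "m > 0" "\<And>u. m * (norm u)\<^sup>2 \<le> h0 u u" using pos_form_lower_bound[OF h0] by blast
  define K where "K = (\<Sum>i\<in>Basis. \<Sum>j\<in>Basis. \<bar>h0 i j\<bar>)"
  have "K \<ge> 0" by (auto simp: K_def intro!: sum_nonneg)
  have "((\<lambda>s. \<Sum>i\<in>Basis. \<Sum>j\<in>Basis. \<bar>h s i j - h0 i j\<bar>) \<longlongrightarrow> (\<Sum>i\<in>(Basis::'a set). \<Sum>j\<in>(Basis::'a set). \<bar>h0 i j - h0 i j\<bar>)) F"
    by (intro tendsto_intros lim)
  then have "\<forall>\<^sub>F s in F. (\<Sum>i\<in>Basis. \<Sum>j\<in>Basis. \<bar>h s i j - h0 i j\<bar>) < m / 2"
    using m by (intro order_tendstoD) auto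
  with h have "\<forall>\<^sub>F s in F. \<forall>u w. m/2 * (norm u)\<^sup>2 \<le> h s u u \<and> \<bar>h s u w\<bar> \<le> (K + m/2) * norm u * norm w"
  proof eventually_elim
    case (elim s)
    define d where "d = (\<Sum>i\<in>Basis. \<Sum>j\<in>Basis. \<bar>h s i j - h0 i j\<bar>)"
    have "sym_form (\<lambda>u w. h s u w - h0 u w)"
      using elim(1) h0 by (auto simp: pos_form_def sym_form_def intro: linear_compose_sub)
    from sym_form_entry_bound[OF this]
    have b: "\<bar>h s u w - h0 u w\<bar> \<le> d * norm u * norm w" for u w by (simp add: d_def)
    have d: "d * norm u * norm w \<le> m/2 * norm u * norm w" for u w
      using elim(2) by (intro mult_right_mono) (auto simp: d_def)
    have "\<bar>h0 u w\<bar> \<le> K * norm u * norm w" for u w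
      using sym_form_entry_bound[OF pos_form_sym_form[OF h0]] by (simp add: K_def)
    with b d have "\<bar>h s u w\<bar> \<le> K * norm u * norm w + m/2 * norm u * norm w" for u w
      by (smt (verit))
    moreover have "m/2 * (norm u)\<^sup>2 \<le> h s u u" for u
      using b[of u u] d[of u u] m(2)[of u] by (simp add: power2_eq_square mult.assoc)
    ultimately show ?case by (simp add: distrib_right)
  qed
  moreover have "m/2 > 0" "K + m/2 > 0" using m \<open>K \<ge> 0\<close> by auto
  ultimately show thesis using that by blast
qed

text \<open>Coercivity argument: for the difference d of the Riesz vectors, m |d|^2 <= h d d, and h
  d is the residual \<open>b\<close>, which tends to 0 on each basis vector. No formula for the
  Riesz vector is involved, so the lemma suits objects given by an equation such as Newton
  directions.\<close>

lemma riesz_tendsto: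
  fixes h :: "'b \<Rightarrow> 'a::euclidean_space \<Rightarrow> 'a \<Rightarrow> real"
  assumes h0: "pos_form h0" and h: "\<forall>\<^sub>F s in F. sym_form (h s)"
    and lim: "\<And>u w. ((\<lambda>s. h s u w) \<longlongrightarrow> h0 u w) F"
    and a: "\<And>w. ((\<lambda>s. a s w) \<longlongrightarrow> a0 w) F"
    and U: "\<forall>\<^sub>F s in F. \<forall>w. h s (U s) w = a s w" and U0: "\<And>w. h0 U0 w = a0 w"
  shows "(U \<longlongrightarrow> U0) F"
proof -
  obtain m M where m: "m > 0" and
    ev: "\<forall>\<^sub>F s in F. \<forall>u w. m * (norm u)\<^sup>2 \<le> h s u u \<and> \<bar>h s u w\<bar> \<le> M * norm u * norm w"
    using pos_form_eventually_bounds[OF h0 h lim] by blast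
  define b where "b s w = a s w - h s U0 w" for s w
  have b: "((\<lambda>s. b s w) \<longlongrightarrow> 0) F" for w
    unfolding b_def using tendsto_diff[OF a[of w] lim[of U0 w]] U0 by simp
  have "((\<lambda>s. (\<Sum>i\<in>Basis. \<bar>b s i\<bar>) / m) \<longlongrightarrow> (\<Sum>i\<in>(Basis::'a set). \<bar>0\<bar>) / m) F"
    using m by (intro tendsto_intros b) auto
  then have lim0: "((\<lambda>s. (\<Sum>i\<in>Basis. \<bar>b s i\<bar>) / m) \<longlongrightarrow> 0) F" by simp
  have "\<forall>\<^sub>F s in F. norm (U s - U0) \<le> (\<Sum>i\<in>Basis. \<bar>b s i\<bar>) / m"
    using ev h U
  proof eventually_elim
    case (elim s)
    let ?d = "U s - U0"
    have hb: "h s ?d w = b s w" for w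
      using elim(2,3) by (simp add: b_def sym_form_simps)
    have "h s ?d ?d = (\<Sum>i\<in>Basis. (?d \<bullet> i) * b s i)"
      using linear_basis_sum[of "h s ?d" ?d] elim(2) by (simp add: hb sym_form_def)
    also have "\<dots> \<le> (\<Sum>i\<in>Basis. norm ?d * \<bar>b s i\<bar>)"
    proof (rule sum_mono)
      fix i :: 'a assume "i \<in> Basis"
      have "(?d \<bullet> i) * b s i \<le> \<bar>?d \<bullet> i\<bar> * \<bar>b s i\<bar>" by (metis abs_ge_self abs_mult)
      also have "\<dots> \<le> norm ?d * \<bar>b s i\<bar>"
        using Basis_le_norm[OF \<open>i \<in> Basis\<close>] by (intro mult_right_mono) auto
      finally show "(?d \<bullet> i) * b s i \<le> norm ?d * \<bar>b s i\<bar>" .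
    qed
    finally have "m * (norm ?d)\<^sup>2 \<le> norm ?d * (\<Sum>i\<in>Basis. \<bar>b s i\<bar>)"
      using elim(1)[rule_format, of ?d 0] by (simp add: sum_distrib_left)
    then show ?case
      using m by (cases "norm ?d = 0") (auto simp: power2_eq_square field_simps sum_nonneg)
  qed
  then have "((\<lambda>s. U s - U0) \<longlongrightarrow> 0) F"
    by (rule Lim_null_comparison[OF _ lim0])
  then show ?thesis by (simp add: LIM_zero_iff)
qed

lemma linear_family_tendsto:
  fixes L :: "'b \<Rightarrow> 'a::euclidean_space \<Rightarrow> 'c::real_normed_vector"
  assumes "\<forall>\<^sub>F s in F. linear (L s)" "linear L0" "\<And>u. ((\<lambda>s. L s u) \<longlongrightarrow> L0 u) F" "(u \<longlongrightarrow> u0) F"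
  shows "((\<lambda>s. L s (u s)) \<longlongrightarrow> L0 u0) F"
proof -
  have "((\<lambda>s. \<Sum>i\<in>Basis. (u s \<bullet> i) *\<^sub>R L s i) \<longlongrightarrow> (\<Sum>i\<in>Basis. (u0 \<bullet> i) *\<^sub>R L0 i)) F"
    by (intro tendsto_intros assms)
  moreover have "\<forall>\<^sub>F s in F. (\<Sum>i\<in>Basis. (u s \<bullet> i) *\<^sub>R L s i) = L s (u s)"
    using assms(1) by eventually_elim (simp flip: linear_basis_sum)
  ultimately show ?thesis
    unfolding linear_basis_sum[OF assms(2), of u0] by (simp cong: tendsto_cong)
qed

section \<open>Functions of one real variable\<close>

text \<open>Real induction: the infimum of the counterexamples can neither be a counterexample
  (\<open>left\<close>) nor be approached by counterexamples from the right (\<open>right\<close>).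
  It replaces arguments about a first exit time.\<close>

lemma interval_induct [consumes 1, case_names left right]:
  fixes a b :: real
  assumes "a \<le> t" "t \<le> b"
    and left: "\<And>t. a \<le> t \<Longrightarrow> t \<le> b \<Longrightarrow> (\<And>s. a \<le> s \<Longrightarrow> s < t \<Longrightarrow> P s) \<Longrightarrow> P t"
    and right: "\<And>t. a \<le> t \<Longrightarrow> t < b \<Longrightarrow> (\<And>s. a \<le> s \<Longrightarrow> s \<le> t \<Longrightarrow> P s) \<Longrightarrow>
      \<exists>h>0. \<forall>s. t < s \<and> s < t + h \<and> s \<le> b \<longrightarrow> P s"
  shows "P t"
proof (rule ccontr)
  assume "\<not> P t"
  define N where "N = {s. a \<le> s \<and> s \<le> b \<and> \<not> P s}"
  have N: "t \<in> N" "bdd_below N" using assms \<open>\<not> P t\<close> by (auto simp: N_def)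
  define i where "i = Inf N"
  have i: "a \<le> i" "i \<le> t" using N unfolding i_def by (auto intro!: cInf_greatest cInf_lower) (auto simp: N_def)
  have P: "P s" if "a \<le> s" "s < i" for s
  proof (rule ccontr)
    assume "\<not> P s"
    then have "s \<in> N" using that i assms(1,2) by (auto simp: N_def)
    from cInf_lower[OF this N(2)] show False using that by (simp add: i_def)
  qed
  have Pi: "P i" using left[OF i(1)] i assms(1,2) P by auto
  then have "i \<noteq> t" using \<open>\<not> P t\<close> by auto
  then have "i < b" using i assms(1,2) by auto
  then obtain h where h: "h > 0" "\<And>s. i < s \<and> s < i + h \<and> s \<le> b \<Longrightarrow> P s"
    using right[OF i(1)] P Pi by (metis less_eq_real_def)
  have "i + h \<le> s" if "s \<in> N" for s
  proof (rule ccontr)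
    assume "\<not> i + h \<le> s"
    moreover have "i \<le> s" using cInf_lower[OF that N(2)] by (simp add: i_def)
    moreover have "s \<noteq> i" "s \<le> b" "\<not> P s" using that Pi by (auto simp: N_def)
    ultimately show False using h(2)[of s] by auto
  qed
  then have "i + h \<le> i" using N unfolding i_def by (intro cInf_greatest) auto
  then show False using h by simp
qed

lemma at_within_Ico_at_left: "a < t \<Longrightarrow> at t within {a..<t} = at_left (t :: real)"
  by (intro at_within_nhd[of _ "{a<..}"]) auto

text \<open>The difference quotients from the left are nonnegative. Only points left of
  \<open>t\<close> are compared, so a maximum at the right endpoint is covered.\<close>

lemma left_derivative_at_max_nonneg:
  fixes \<phi> :: "real \<Rightarrow> real"
  assumes d: "(\<phi> has_real_derivative d) (at t within {a..b})" and t: "a < t" "t \<le> b"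
    and max: "\<forall>\<^sub>F s in at t within {a..b}. s < t \<longrightarrow> \<phi> s \<le> \<phi> t"
  shows "d \<ge> 0"
proof -
  have sub: "at t within {a..<t} \<le> at t within {a..b}" using t by (intro at_le) auto
  have "((\<lambda>s. (\<phi> s - \<phi> t) / (s - t)) \<longlongrightarrow> d) (at t within {a..<t})"
    using d sub unfolding has_field_derivative_iff by (rule tendsto_mono[rotated])
  moreover have "\<forall>\<^sub>F s in at t within {a..<t}. (\<phi> s - \<phi> t) / (s - t) \<ge> 0"
  proof -
    have "\<forall>\<^sub>F s in at t within {a..<t}. s < t \<longrightarrow> \<phi> s \<le> \<phi> t"
      using max sub by (rule filter_leD[rotated])
    moreover have "\<forall>\<^sub>F s in at t within {a..<t}. s < t" by (simp add: eventually_at_filter)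
    ultimately show ?thesis by eventually_elim (simp add: divide_nonpos_neg)
  qed
  moreover have "at t within {a..<t} \<noteq> bot" using t by (simp add: at_within_Ico_at_left)
  ultimately show ?thesis by (rule tendsto_lowerbound)
qed

text \<open>The inequality says that \<open>1/\<surd>q\<close> is \<open>\<sigma>\<close>-Lipschitz, multiplied out so that \<open>q\<close> may
  vanish.\<close>

lemma self_concordant_real:
  fixes q q' :: "real \<Rightarrow> real"
  assumes d: "\<And>t. t \<in> {a..b} \<Longrightarrow> (q has_real_derivative q' t) (at t within {a..b})"
    and nonneg: "\<And>t. t \<in> {a..b} \<Longrightarrow> q t \<ge> 0" and \<sigma>: "\<sigma> \<ge> 0"
    and bd: "\<And>t. t \<in> {a..b} \<Longrightarrow> \<bar>q' t\<bar> \<le> 2 * \<sigma> * sqrt (q t) * q t"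
    and st: "s \<in> {a..b}" "t \<in> {a..b}"
  shows "sqrt (q s) - sqrt (q t) \<le> \<sigma> * \<bar>s - t\<bar> * sqrt (q s) * sqrt (q t)"
proof -
  \<comment> \<open>Where \<open>q\<close> vanishes, 1 / sqrt q has no derivative. The shift by
    \<open>e\<close> keeps the square root positive and preserves the bound on \<open>q'\<close>; at
    the end \<open>e\<close> tends to 0.\<close>
  have eps: "sqrt (q s + e) - sqrt (q t + e) \<le> \<sigma> * \<bar>s - t\<bar> * sqrt (q s + e) * sqrt (q t + e)"
    if "e > 0" for e
  proof -
    define y where "y t = inverse (sqrt (q t + e))" for t
    define y' where "y' t = - (q' t * inverse (sqrt (q t + e)) / 2 * (inverse (sqrt (q t + e)))\<^sup>2)" for t
    have y: "(y has_field_derivative y' t) (at t within {a..b})" if "t \<in> {a..b}" for t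
      unfolding y_def y'_def using d[OF that] nonneg[OF that] \<open>e > 0\<close>
      by (auto intro!: derivative_eq_intros simp: power2_eq_square)
    have bound: "norm (y' t) \<le> \<sigma>" if "t \<in> {a..b}" for t
    proof -
      have "\<bar>q' t\<bar> \<le> 2 * \<sigma> * (sqrt (q t) * q t)" using bd[OF that] by (simp add: mult_ac)
      also have "\<dots> \<le> 2 * \<sigma> * (sqrt (q t + e) * (q t + e))"
        using nonneg[OF that] \<open>e > 0\<close> \<sigma> by (intro mult_left_mono mult_mono) auto
      finally have *: "\<bar>q' t\<bar> \<le> 2 * \<sigma> * (sqrt (q t + e) * (q t + e))" .
      define S where "S = sqrt (q t + e)"
      have S: "S > 0" "q t + e = S * S" using nonneg[OF that] \<open>e > 0\<close> by (simp_all add: S_def)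
      have "norm (y' t) = \<bar>q' t\<bar> * inverse S / 2 * (inverse S)\<^sup>2"
        using S(1) unfolding y'_def S_def[symmetric] by (simp add: abs_mult)
      also have "\<dots> = \<bar>q' t\<bar> / (2 * (S * (S * S)))"
        by (simp add: inverse_eq_divide power2_eq_square)
      also have "\<dots> \<le> \<sigma>"
      proof -
        have "\<bar>q' t\<bar> \<le> \<sigma> * (2 * (S * (S * S)))"
          using * S by (simp add: S_def[symmetric] mult_ac)
        then show ?thesis using S(1) by (simp add: divide_le_eq)
      qed
      finally show ?thesis .
    qed
    have "norm (y s - y t) \<le> \<sigma> * norm (s - t)"
      by (rule field_differentiable_bound[OF _ y bound st]) auto
    then have "y t - y s \<le> \<sigma> * \<bar>s - t\<bar>" by simp
    moreover define S T where "S = sqrt (q s + e)" and "T = sqrt (q t + e)"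
    moreover have ST: "S > 0" "T > 0" using nonneg st \<open>e > 0\<close> by (auto simp: add_nonneg_pos S_def T_def)
    ultimately have "(1 / T - 1 / S) * (S * T) \<le> \<sigma> * \<bar>s - t\<bar> * (S * T)"
      by (intro mult_right_mono) (auto simp: y_def inverse_eq_divide)
    moreover have "(1 / T - 1 / S) * (S * T) = S - T" using ST by (simp add: left_diff_distrib)
    ultimately show ?thesis by (simp add: S_def T_def mult.assoc)
  qed
  have lim: "((\<lambda>e. sqrt (q s + e) - sqrt (q t + e)) \<longlongrightarrow> sqrt (q s + 0) - sqrt (q t + 0)) (at_right 0)"
    "((\<lambda>e. \<sigma> * \<bar>s - t\<bar> * sqrt (q s + e) * sqrt (q t + e)) \<longlongrightarrow> \<sigma> * \<bar>s - t\<bar> * sqrt (q s + 0) * sqrt (q t + 0)) (at_right 0)"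
    by (intro tendsto_intros)+
  have "\<forall>\<^sub>F e in at_right 0. sqrt (q s + e) - sqrt (q t + e) \<le> \<sigma> * \<bar>s - t\<bar> * sqrt (q s + e) * sqrt (q t + e)"
    using eventually_at_right_less[of "0::real"] by eventually_elim (rule eps)
  from tendsto_le[OF _ lim(2,1) this] show ?thesis by simp
qed

section \<open>Charts and tangent spaces\<close>

abbreviation transition :: "('m, 'e) chart \<Rightarrow> ('m, 'e) chart \<Rightarrow> 'e \<Rightarrow> 'e" where
  "transition c d \<equiv> chart_map d \<circ> chart_inv c"

locale manifold =
  fixes A :: "('m::{t2_space,second_countable_topology}, 'e::euclidean_space) chart set"
  assumes atlas: "smooth_atlas A"
begin

abbreviation TS :: "'m \<Rightarrow> ('m, 'e) tvec set" where
  "TS \<equiv> tangent_space A"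

abbreviation E :: "('m, 'e) chart \<Rightarrow> 'm \<Rightarrow> 'e \<Rightarrow> ('m, 'e) tvec" where
  "E \<equiv> chart_tangent A"

lemma chart_cover: obtains c where "c \<in> A" "x \<in> chart_dom c"
proof -
  have "x \<in> (\<Union>c\<in>A. chart_dom c)" using atlas by (simp add: smooth_atlas_def)
  then show thesis using that by blast
qed

lemma open_chart_dom: "c \<in> A \<Longrightarrow> open (chart_dom c)"
  using atlas by (simp add: smooth_atlas_def)

lemma chart_homeomorphism:
  "c \<in> A \<Longrightarrow> homeomorphism (chart_dom c) (chart_map c ` chart_dom c) (chart_map c) (chart_inv c)"
  using atlas by (simp add: smooth_atlas_def)

lemma chart_inv_map [simp]: "c \<in> A \<Longrightarrow> x \<in> chart_dom c \<Longrightarrow> chart_inv c (chart_map c x) = x"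
  using chart_homeomorphism by (metis homeomorphism_apply1)

lemma open_chart_image:
  assumes "c \<in> A" "open U"
  shows "open (chart_map c ` (U \<inter> chart_dom c))"
proof -
  have "openin (top_of_set (chart_dom c)) (U \<inter> chart_dom c)"
    using assms(2) by (metis Int_commute openin_open_Int)
  then have "openin (top_of_set (chart_map c ` chart_dom c)) (chart_map c ` (U \<inter> chart_dom c))"
    by (rule homeomorphism_imp_open_map[OF chart_homeomorphism[OF assms(1)]])
  moreover have "open (chart_map c ` chart_dom c)" using atlas assms by (simp add: smooth_atlas_def)
  ultimately show ?thesis using openin_open_trans by blast
qed

lemma open_chart_image_subset:
  "c \<in> A \<Longrightarrow> open U \<Longrightarrow> U \<subseteq> chart_dom c \<Longrightarrow> open (chart_map c ` U)"
  using open_chart_image[of c U] by (simp add: Int_absorb2)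

lemma continuous_on_chart_map: "c \<in> A \<Longrightarrow> continuous_on (chart_dom c) (chart_map c)"
  using chart_homeomorphism by (auto simp: homeomorphism_def)

lemma continuous_on_chart_inv: "c \<in> A \<Longrightarrow> continuous_on (chart_map c ` chart_dom c) (chart_inv c)"
  using chart_homeomorphism by (auto simp: homeomorphism_def)

lemma chart_mapsto: "c \<in> A \<Longrightarrow> y \<in> chart_map c ` chart_dom c \<Longrightarrow> chart_inv c y \<in> chart_dom c \<and> chart_map c (chart_inv c y) = y"
  by auto

lemma Ck_transition:
  "c \<in> A \<Longrightarrow> d \<in> A \<Longrightarrow> Ck_on k (chart_map c ` (chart_dom c \<inter> chart_dom d)) (transition c d)"
  using atlas unfolding smooth_atlas_def by blast

lemma open_overlap: "c \<in> A \<Longrightarrow> d \<in> A \<Longrightarrow> open (chart_map c ` (chart_dom c \<inter> chart_dom d))"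
  by (metis Int_commute open_chart_dom open_chart_image)

lemma transition_has_derivative:
  assumes "c \<in> A" "d \<in> A" "x \<in> chart_dom c" "x \<in> chart_dom d"
  shows "(transition c d has_derivative fd (transition c d) (chart_map c x)) (at (chart_map c x))"
  by (rule Ck_on_has_derivative[OF Ck_transition[OF assms(1,2), of "Suc 0"]]) (use assms in auto)

lemma linear_transition:
  assumes "c \<in> A" "d \<in> A" "x \<in> chart_dom c" "x \<in> chart_dom d"
  shows "linear (fd (transition c d) (chart_map c x))"
  using transition_has_derivative[OF assms] by (rule has_derivative_linear)

lemma transition_chain:
  assumes "c \<in> A" "d \<in> A" "e \<in> A" "x \<in> chart_dom c" "x \<in> chart_dom d" "x \<in> chart_dom e"
  shows "fd (transition d e) (chart_map d x) (fd (transition c d) (chart_map c x) w)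
    = fd (transition c e) (chart_map c x) w"
proof -
  have eq: "transition c d (chart_map c x) = chart_map d x" using assms by simp
  have "(transition d e \<circ> transition c d has_derivative
      fd (transition d e) (chart_map d x) \<circ> fd (transition c d) (chart_map c x)) (at (chart_map c x))"
    using transition_has_derivative[of d e x] transition_has_derivative[of c d x] assms eq
    by (intro diff_chain_at) simp_all
  then have "(transition c e has_derivative
      fd (transition d e) (chart_map d x) \<circ> fd (transition c d) (chart_map c x)) (at (chart_map c x))"
    by (rule has_derivative_transform_within_open[OF _ open_overlap[OF assms(1,2)]]) (use assms in auto)
  then show ?thesis using frechet_derivative_at by (metis comp_apply)
qed

lemma transition_same:
  assumes "c \<in> A" "x \<in> chart_dom c"
  shows "fd (transition c c) (chart_map c x) w = w"
proof -
  have "(transition c c has_derivative (\<lambda>w. w)) (at (chart_map c x))"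
    by (rule has_derivative_transform_within_open[OF has_derivative_ident open_overlap[OF assms(1) assms(1)]])
      (use assms in auto)
  then show ?thesis by (metis frechet_derivative_at)
qed

lemma tangent_transition:
  assumes "u \<in> TS x" "c \<in> A" "d \<in> A" "x \<in> chart_dom c" "x \<in> chart_dom d"
  shows "u d = fd (transition c d) (chart_map c x) (u c)"
  using assms unfolding tangent_space_def by blast

lemma chart_tangent_self [simp]:
  "c \<in> A \<Longrightarrow> x \<in> chart_dom c \<Longrightarrow> E c x w c = w"
  by (simp add: chart_tangent_def transition_same)

lemma chart_tangent_mem [simp]:
  assumes "c \<in> A" "x \<in> chart_dom c"
  shows "E c x w \<in> TS x"
  unfolding tangent_space_def chart_tangent_def
  using assms transition_chain[of c _ _ x w] by auto

lemma tangent_eqI: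
  assumes "u \<in> TS x" "v \<in> TS x" "c \<in> A" "x \<in> chart_dom c" "u c = v c"
  shows "u = v"
proof
  fix d
  show "u d = v d"
  proof (cases "d \<in> A \<and> x \<in> chart_dom d")
    case True
    then show ?thesis using assms tangent_transition[of _ x c d] by metis
  next
    case False
    moreover have "w d = 0" if "w \<in> TS x" for w
      using that calculation unfolding tangent_space_def by blast
    ultimately show ?thesis using assms(1,2) by metis
  qed
qed

lemma chart_tangent_coord [simp]:
  "u \<in> TS x \<Longrightarrow> c \<in> A \<Longrightarrow> x \<in> chart_dom c \<Longrightarrow> E c x (u c) = u"
  by (rule tangent_eqI[of _ x _ c]) auto

lemma tangent_combo:
  assumes "u \<in> TS x" "v \<in> TS x"
  shows "(\<lambda>d. a *\<^sub>R u d + b *\<^sub>R v d) \<in> TS x"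
proof -
  have "a *\<^sub>R u d + b *\<^sub>R v d = fd (transition c d) (chart_map c x) (a *\<^sub>R u c + b *\<^sub>R v c)"
    if "c \<in> A" "d \<in> A" "x \<in> chart_dom c" "x \<in> chart_dom d" for c d
    using tangent_transition[OF assms(1) that] tangent_transition[OF assms(2) that] linear_transition[OF that]
    by (simp add: linear_add linear_cmul)
  moreover have "a *\<^sub>R u d + b *\<^sub>R v d = 0" if "\<not> (d \<in> A \<and> x \<in> chart_dom d)" for d
    using assms that unfolding tangent_space_def by (smt (verit) add_0 mem_Collect_eq scaleR_zero_right)
  ultimately show ?thesis
    unfolding tangent_space_def by (intro CollectI conjI ballI allI impI) blast+
qed

lemma tangent_zero [simp]: "(\<lambda>d. 0) \<in> TS x"
proof -
  obtain c where "c \<in> A" "x \<in> chart_dom c" by (rule chart_cover)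
  then show ?thesis
    using tangent_combo[OF chart_tangent_mem[of c x 0] chart_tangent_mem[of c x 0], of 0 0] by simp
qed

lemma tangent_scale: "u \<in> TS x \<Longrightarrow> (\<lambda>d. a *\<^sub>R u d) \<in> TS x"
  using tangent_combo[of u x u a 0] by simp

lemma tangent_sum:
  assumes "\<And>i. i \<in> I \<Longrightarrow> Y i \<in> TS x"
  shows "(\<lambda>d. \<Sum>i\<in>I. Y i d) \<in> TS x"
  using assms
proof (induction I rule: infinite_finite_induct)
  case (insert i I)
  then show ?case using tangent_combo[of "Y i" x "\<lambda>d. \<Sum>i\<in>I. Y i d" 1 1] by simp
qed auto

lemma chart_tangent_combo:
  assumes "c \<in> A" "x \<in> chart_dom c"
  shows "E c x (a *\<^sub>R u + b *\<^sub>R v) = (\<lambda>d. a *\<^sub>R E c x u d + b *\<^sub>R E c x v d)"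
  by (rule tangent_eqI[OF _ _ assms]) (use assms in \<open>auto intro: tangent_combo\<close>)

text \<open>One chart around \<open>U\<close> suffices because every other coordinate expression
  arises by composition with a smooth transition map.\<close>

lemma Ck_fun_in_chart:
  assumes c: "c \<in> A" and U: "open U" "U \<subseteq> chart_dom c" and g: "Ck_on k (chart_map c ` U) (g \<circ> chart_inv c)"
  shows "Ck_fun A k U g"
  unfolding Ck_fun_def
proof
  fix d assume d: "d \<in> A"
  let ?S = "chart_map d ` (U \<inter> chart_dom d)"
  have S: "open ?S" using open_chart_image d U by blast
  have "Ck_on k ?S (\<lambda>p. (g \<circ> chart_inv c) (transition d c p))"
  proof (rule Ck_on_compose[OF S open_chart_image_subset[OF c U] _ _ g])
    show "transition d c ` ?S \<subseteq> chart_map c ` U" using d by auto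
    show "Ck_on k ?S (transition d c)"
      by (rule Ck_on_subset[OF Ck_transition[OF d c]]) (use U in auto)
  qed
  then show "Ck_on k ?S (g \<circ> chart_inv d)"
    by (rule Ck_on_cong[OF S, rotated]) (use U c d in auto)
qed

text \<open>In another chart the coordinates are multiplied by the Jacobian of the transition map;
  the basis expansion keeps this within sums and products of smooth functions.\<close>

lemma smooth_field_in_chart:
  assumes c: "c \<in> A" and U: "open U" "U \<subseteq> chart_dom c" and Y: "\<And>x. x \<in> U \<Longrightarrow> Y x \<in> TS x"
    and smooth: "\<And>k. Ck_on k (chart_map c ` U) (\<lambda>p. Y (chart_inv c p) c)"
  shows "smooth_field A U Y"
  unfolding smooth_field_def
proof (intro conjI ballI allI)
  fix d k assume d: "d \<in> A"
  let ?S = "chart_map d ` (U \<inter> chart_dom d)"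
  let ?T = "chart_map c ` (U \<inter> chart_dom d)"
  have S: "open ?S" using open_chart_image d U by blast
  have T: "open ?T" using U open_chart_dom[OF d] by (intro open_chart_image_subset c) auto
  let ?G = "\<lambda>q. \<Sum>i\<in>Basis. (Y (chart_inv c q) c \<bullet> i) *\<^sub>R fd (transition c d) q i"
  have "Ck_on k ?T ?G"
  proof (intro Ck_on_sum Ck_on_scaleR T Ck_on_bounded_linear[OF _ bounded_linear_inner_left])
    show "Ck_on k ?T (\<lambda>q. Y (chart_inv c q) c)"
      by (rule Ck_on_subset[OF smooth]) auto
    have "Ck_on k (chart_map c ` (chart_dom c \<inter> chart_dom d)) (\<lambda>q. fd (transition c d) q i)" for i
      using Ck_transition[OF c d, of "Suc k"] by simp
    then show "Ck_on k ?T (\<lambda>q. fd (transition c d) q i)" for i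
      by (rule Ck_on_subset) (use U in auto)
  qed
  then have "Ck_on k ?S (\<lambda>p. ?G (transition d c p))"
  proof (rule Ck_on_compose[OF S T, rotated 2])
    show "transition d c ` ?S \<subseteq> ?T" using d by auto
    show "Ck_on k ?S (transition d c)"
      by (rule Ck_on_subset[OF Ck_transition[OF d c]]) (use U in auto)
  qed
  then show "Ck_on k ?S (\<lambda>p. Y (chart_inv d p) d)"
  proof (rule Ck_on_cong[OF S, rotated])
    fix p assume "p \<in> ?S"
    then obtain x where x: "x \<in> U" "x \<in> chart_dom d" "x \<in> chart_dom c" "p = chart_map d x" using U by auto
    have "Y x d = fd (transition c d) (chart_map c x) (Y x c)"
      using tangent_transition[OF Y[OF x(1)] c d] x by auto
    then show "?G (transition d c p) = Y (chart_inv d p) d"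
      using x c d linear_basis_sum[OF linear_transition[OF c d x(3,2)], of "Y x c"] by simp
  qed
qed (use Y in auto)

lemma smooth_field_const:
  "c \<in> A \<Longrightarrow> smooth_field A (chart_dom c) (\<lambda>p. E c p w)"
  by (rule smooth_field_in_chart)
    (auto simp: open_chart_dom intro!: Ck_on_cong[OF _ _ Ck_on_const[where a=w]] open_chart_image_subset)

lemma smooth_field_subset: "smooth_field A U Y \<Longrightarrow> V \<subseteq> U \<Longrightarrow> smooth_field A V Y"
  unfolding smooth_field_def by (meson Ck_on_subset Int_mono image_mono order_refl subsetD)

lemma smooth_field_scale:
  assumes "open U" "\<And>k. Ck_fun A k U g" "smooth_field A U Y"
  shows "smooth_field A U (\<lambda>p d. g p *\<^sub>R Y p d)"
  using assms unfolding smooth_field_def Ck_fun_def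
  by (auto intro!: tangent_scale Ck_on_scaleR open_chart_image simp: comp_def)

lemma smooth_field_sum:
  assumes "open U" "\<And>i. i \<in> I \<Longrightarrow> smooth_field A U (Y i)"
  shows "smooth_field A U (\<lambda>p d. \<Sum>i\<in>I. Y i p d)"
  using assms unfolding smooth_field_def
  by (auto intro!: tangent_sum Ck_on_sum open_chart_image)

lemma smooth_field_tangent: "smooth_field A U Y \<Longrightarrow> x \<in> U \<Longrightarrow> Y x \<in> TS x"
  unfolding smooth_field_def by blast

lemma smooth_field_Ck:
  "smooth_field A U Y \<Longrightarrow> c \<in> A \<Longrightarrow> Ck_on k (chart_map c ` (U \<inter> chart_dom c)) (\<lambda>p. Y (chart_inv c p) c)"
  unfolding smooth_field_def by blast

text \<open>The chain rule for the transition map and the transformation law of \<open>u\<close>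
  match, so all charts give one value; this is what makes the description in
  \<open>differential\<close> denote.\<close>

lemma differential_chart:
  assumes c: "c \<in> A" "x \<in> chart_dom c" and u: "u \<in> TS x"
    and g: "((g \<circ> chart_inv c) has_derivative g') (at (chart_map c x))"
  shows "differential A g x u = g' (u c)"
  unfolding differential_def
proof (rule the_equality)
  show "\<forall>d\<in>A. x \<in> chart_dom d \<longrightarrow> g' (u c) = fd (g \<circ> chart_inv d) (chart_map d x) (u d)"
  proof (intro ballI impI)
    fix d assume d: "d \<in> A" "x \<in> chart_dom d"
    have eq: "transition d c (chart_map d x) = chart_map c x" using d by simp
    have "((g \<circ> chart_inv c) \<circ> transition d c has_derivative g' \<circ> fd (transition d c) (chart_map d x)) (at (chart_map d x))"
      by (rule diff_chain_at[OF transition_has_derivative[OF d(1) c(1) d(2) c(2)]]) (simp only: eq g)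
    then have "(g \<circ> chart_inv d has_derivative g' \<circ> fd (transition d c) (chart_map d x)) (at (chart_map d x))"
      by (rule has_derivative_transform_within_open[OF _ open_overlap[OF d(1) c(1)]]) (use c d in auto)
    then have "fd (g \<circ> chart_inv d) (chart_map d x) = g' \<circ> fd (transition d c) (chart_map d x)"
      by (metis frechet_derivative_at)
    then show "g' (u c) = fd (g \<circ> chart_inv d) (chart_map d x) (u d)"
      using tangent_transition[OF u d(1) c(1) d(2) c(2)] by simp
  qed
  fix r assume "\<forall>d\<in>A. x \<in> chart_dom d \<longrightarrow> r = fd (g \<circ> chart_inv d) (chart_map d x) (u d)"
  then show "r = g' (u c)" using c frechet_derivative_at[OF g] by simp
qed

end

section \<open>Connections in coordinates\<close>

locale affine_manifold = manifold A
  for A :: "('m::{t2_space,second_countable_topology}, 'e::euclidean_space) chart set" +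
  fixes nabla :: "'m \<Rightarrow> ('m, 'e) tvec \<Rightarrow> ('m \<Rightarrow> ('m, 'e) tvec) \<Rightarrow> ('m, 'e) tvec"
  assumes connection: "affine_connection A nabla" and torsion: "torsion_free A nabla"
begin

abbreviation \<Gamma> :: "('m, 'e) chart \<Rightarrow> 'e \<Rightarrow> 'e \<Rightarrow> 'e \<Rightarrow> 'e" where
  "\<Gamma> c y \<equiv> christoffel A nabla c (chart_inv c y)"

context
  fixes U x v
  assumes U: "open U" "x \<in> U" and v: "v \<in> TS x"
begin

lemmas connection_at = connection[unfolded affine_connection_def, THEN spec[of _ U], THEN mp[OF _ U(1)],
    THEN conjunct1, THEN bspec[OF _ U(2)], THEN bspec[OF _ v], THEN spec, THEN mp]

lemma nabla_tangent: "smooth_field A U Y \<Longrightarrow> nabla x v Y \<in> TS x"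
  by (drule connection_at) (elim conjE)

lemma nabla_combo:
  assumes "smooth_field A U Y" "w \<in> TS x"
  shows "nabla x (\<lambda>c. a *\<^sub>R v c + b *\<^sub>R w c) Y = (\<lambda>c. a *\<^sub>R nabla x v Y c + b *\<^sub>R nabla x w Y c)"
  by (rule connection_at[OF assms(1), THEN conjunct2, THEN conjunct1, THEN bspec[OF _ assms(2)], THEN spec, THEN spec])

lemma nabla_add:
  assumes "smooth_field A U Y" "smooth_field A U Z"
  shows "nabla x v (\<lambda>p c. Y p c + Z p c) = (\<lambda>c. nabla x v Y c + nabla x v Z c)"
  by (rule connection_at[OF assms(1), THEN conjunct2, THEN conjunct2, THEN conjunct1, THEN spec, THEN mp, OF assms(2)])

lemma nabla_leibniz:
  assumes "smooth_field A U Y" "\<And>k. Ck_fun A k U g"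
  shows "nabla x v (\<lambda>p c. g p *\<^sub>R Y p c) = (\<lambda>c. differential A g x v *\<^sub>R Y x c + g x *\<^sub>R nabla x v Y c)"
  by (rule connection_at[OF assms(1), THEN conjunct2, THEN conjunct2, THEN conjunct2, THEN conjunct1, THEN spec, THEN mp])
    (use assms(2) in blast)

lemma nabla_cong:
  assumes "smooth_field A U Y" "smooth_field A U Z" "\<And>p. p \<in> U \<Longrightarrow> Y p = Z p"
  shows "nabla x v Y = nabla x v Z"
  by (rule connection_at[OF assms(1), THEN conjunct2, THEN conjunct2, THEN conjunct2, THEN conjunct2, THEN spec, THEN mp])
    (use assms(2,3) in blast)

lemma nabla_sum:
  assumes "\<And>i. i \<in> I \<Longrightarrow> smooth_field A U (Y i)"
  shows "nabla x v (\<lambda>p d. \<Sum>i\<in>I. Y i p d) = (\<lambda>d. \<Sum>i\<in>I. nabla x v (Y i) d)"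
proof -
  have zero: "nabla x v (\<lambda>p d. 0) = (\<lambda>d. 0)"
  proof -
    have "smooth_field A U (\<lambda>p d. 0)" by (simp add: smooth_field_def)
    from nabla_add[OF this this] have "nabla x v (\<lambda>p d. 0) d = nabla x v (\<lambda>p d. 0) d + nabla x v (\<lambda>p d. 0) d" for d
      by (metis add_0)
    then show ?thesis by (metis add_cancel_left_right ext)
  qed
  show ?thesis
    using assms
  proof (induction I rule: infinite_finite_induct)
    case (insert i I)
    then show ?case
      using nabla_add[of "Y i" "\<lambda>p d. \<Sum>i\<in>I. Y i p d"] smooth_field_sum[OF U(1), of I Y] by simp
  qed (use zero in auto)
qed

end

text \<open>Locality and the Leibniz rule reduce a field to its expansion in fields with constant
  coordinates. The Christoffel part stays a basis sum because linearity of
  \<open>christoffel\<close> in its last argument is itself derived from this formula.\<close>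

lemma nabla_chart_sum:
  assumes c: "c \<in> A" "x \<in> chart_dom c" and U: "open U" "x \<in> U" and v: "v \<in> TS x"
    and Y: "smooth_field A U Y"
  shows "nabla x v Y c = fd (\<lambda>p. Y (chart_inv c p) c) (chart_map c x) (v c)
    + (\<Sum>i\<in>Basis. (Y x c \<bullet> i) *\<^sub>R christoffel A nabla c x (v c) i)"
proof -
  define W where "W = U \<inter> chart_dom c"
  have W: "open W" "x \<in> W" "W \<subseteq> chart_dom c" using U c open_chart_dom[OF c(1)] by (auto simp: W_def)
  let ?E = "\<lambda>i p. E c p i"
  define g where "g i p = Y p c \<bullet> i" for i p
  define Y' where "Y' = (\<lambda>p. Y (chart_inv c p) c)"
  have smooth: "Ck_on k (chart_map c ` W) Y'" for k
    unfolding Y'_def by (rule Ck_on_subset[OF smooth_field_Ck[OF Y c(1)]]) (auto simp: W_def)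
  have gk: "Ck_fun A k W (g i)" for i k
    unfolding g_def using smooth[of k] open_chart_image_subset[OF c(1) W(1,3)]
    by (intro Ck_fun_in_chart[OF c(1) W(1,3)]) (auto simp: comp_def Y'_def intro!: Ck_on_bounded_linear[OF _ bounded_linear_inner_left])
  have E: "smooth_field A W (?E i)" for i
    using smooth_field_const[OF c(1)] W(3) smooth_field_subset by blast
  have gE: "smooth_field A W (\<lambda>p d. g i p *\<^sub>R ?E i p d)" for i
    by (rule smooth_field_scale[OF W(1) gk E])
  have Yp: "Y p = (\<lambda>d. \<Sum>i\<in>Basis. g i p *\<^sub>R ?E i p d)" if "p \<in> W" for p
  proof (rule tangent_eqI[of _ p _ c])
    show "Y p \<in> TS p" using smooth_field_tangent[OF Y] that by (simp add: W_def)
    show "(\<lambda>d. \<Sum>i\<in>Basis. g i p *\<^sub>R ?E i p d) \<in> TS p"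
      using c that W by (intro tangent_sum tangent_scale) auto
    show "Y p c = (\<Sum>i\<in>Basis. g i p *\<^sub>R ?E i p c)"
      using c that W by (auto simp: g_def euclidean_representation)
  qed (use c that W in auto)
  have "nabla x v Y = nabla x v (\<lambda>p d. \<Sum>i\<in>Basis. g i p *\<^sub>R ?E i p d)"
    using Yp by (intro nabla_cong[OF W(1,2) v] smooth_field_sum gE smooth_field_subset[OF Y] W) (auto simp: W_def)
  also have "\<dots> = (\<lambda>d. \<Sum>i\<in>Basis. nabla x v (\<lambda>p d. g i p *\<^sub>R ?E i p d) d)"
    by (rule nabla_sum[OF W(1,2) v gE])
  finally have "nabla x v Y c = (\<Sum>i\<in>Basis. differential A (g i) x v *\<^sub>R ?E i x c + g i x *\<^sub>R nabla x v (?E i) c)"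
    by (simp add: nabla_leibniz[OF W(1,2) v E gk])
  moreover have dY: "(Y' has_derivative fd Y' (chart_map c x)) (at (chart_map c x))"
    by (rule Ck_on_has_derivative[OF smooth[of "Suc 0"]]) (use W in auto)
  then have "differential A (g i) x v = fd Y' (chart_map c x) (v c) \<bullet> i" for i
    unfolding g_def by (intro differential_chart[OF c v])
      (auto simp: comp_def Y'_def intro!: bounded_linear.has_derivative[OF bounded_linear_inner_left])
  ultimately show ?thesis
    using c v by (simp add: sum.distrib euclidean_representation g_def Y'_def christoffel_def)
qed

text \<open>Instance of \<open>nabla_chart_sum\<close> for the field with constant coordinates
  \<open>w\<close>, whose coordinate derivative vanishes.\<close>

lemma christoffel_sum_right:
  assumes c: "c \<in> A" "x \<in> chart_dom c"
  shows "christoffel A nabla c x u w = (\<Sum>i\<in>Basis. (w \<bullet> i) *\<^sub>R christoffel A nabla c x u i)"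
proof -
  have "((\<lambda>p. E c (chart_inv c p) w c) has_derivative (\<lambda>_. 0)) (at (chart_map c x))"
    by (rule has_derivative_transform_within_open[OF has_derivative_const[of w] open_chart_image_subset[OF c(1) open_chart_dom[OF c(1)] order_refl]])
      (use c in auto)
  then have "fd (\<lambda>p. E c (chart_inv c p) w c) (chart_map c x) = (\<lambda>_. 0)"
    by (metis frechet_derivative_at)
  then show ?thesis
    using nabla_chart_sum[OF c open_chart_dom[OF c(1)] c(2) chart_tangent_mem[OF c] smooth_field_const[OF c(1)], of u w] c
    by (simp add: christoffel_def)
qed

lemma linear_christoffel:
  assumes c: "c \<in> A" "x \<in> chart_dom c"
  shows "linear (christoffel A nabla c x u)" "linear (\<lambda>u. christoffel A nabla c x u w)"
proof -
  show "linear (christoffel A nabla c x u)"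
    by (rule linearI; subst (1 2) christoffel_sum_right[OF c])
      (simp_all add: christoffel_sum_right[OF c, symmetric] inner_add_left scaleR_left_distrib sum.distrib
        scaleR_scaleR[symmetric] scaleR_sum_right[symmetric] del: scaleR_scaleR)
  have "christoffel A nabla c x (a *\<^sub>R u + b *\<^sub>R v) w = a *\<^sub>R christoffel A nabla c x u w + b *\<^sub>R christoffel A nabla c x v w" for a b u v
    using nabla_combo[OF open_chart_dom[OF c(1)] c(2) chart_tangent_mem[OF c] smooth_field_const[OF c(1)] chart_tangent_mem[OF c], of a u b v w]
    by (simp add: christoffel_def chart_tangent_combo[OF c])
  from this[of 1 _ 1] this[of _ _ 0] show "linear (\<lambda>u. christoffel A nabla c x u w)"
    by (intro linearI) auto
qed

lemma nabla_chart:
  assumes c: "c \<in> A" "x \<in> chart_dom c" and U: "open U" "x \<in> U" and v: "v \<in> TS x"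
    and Y: "smooth_field A U Y"
  shows "nabla x v Y c = fd (\<lambda>p. Y (chart_inv c p) c) (chart_map c x) (v c) + christoffel A nabla c x (v c) (Y x c)"
  using nabla_chart_sum[OF assms] christoffel_sum_right[OF c, of "v c" "Y x c"] by simp

lemma Ck_christoffel:
  assumes c: "c \<in> A"
  shows "Ck_on k (chart_map c ` chart_dom c) (\<lambda>y. \<Gamma> c y u w)"
proof -
  have "smooth_field A (chart_dom c) (\<lambda>p. nabla p (E c p u) (\<lambda>p. E c p w))"
    by (rule connection[unfolded affine_connection_def, THEN spec, THEN mp, THEN conjunct2,
          THEN spec, THEN spec, THEN mp, OF open_chart_dom[OF c] conjI[OF smooth_field_const[OF c] smooth_field_const[OF c]]])
  from smooth_field_Ck[OF this c] show ?thesis by (simp add: christoffel_def)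
qed

text \<open>Torsion-freeness is stated through brackets acting on functions. Tested on the
  coordinate functions with two constant-coordinate fields, the bracket side vanishes and only the
  difference of the Christoffel vectors remains.\<close>

lemma christoffel_sym:
  assumes c: "c \<in> A" "x \<in> chart_dom c"
  shows "christoffel A nabla c x u w = christoffel A nabla c x w u"
proof (rule euclidean_eqI)
  fix i :: 'e assume "i \<in> Basis"
  let ?E = "\<lambda>w p. E c p w"
  define g where "g p = chart_map c p \<bullet> i" for p
  have D: "open (chart_map c ` chart_dom c)" using open_chart_image_subset[OF c(1) open_chart_dom[OF c(1)]] by simp
  have gk: "Ck_fun A k (chart_dom c) g" for k
    by (intro Ck_fun_in_chart[OF c(1) open_chart_dom[OF c(1)] order_refl]
        Ck_on_cong[OF D _ Ck_on_linear[OF D bounded_linear_inner_left[of i]]]) (use c in \<open>auto simp: g_def\<close>)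
  have dg: "differential A g p z = z c \<bullet> i" if "p \<in> chart_dom c" "z \<in> TS p" for p z
  proof (rule differential_chart[OF c(1) that])
    show "(g \<circ> chart_inv c has_derivative (\<lambda>z. z \<bullet> i)) (at (chart_map c p))"
      by (rule has_derivative_transform_within_open[OF bounded_linear_imp_has_derivative[OF bounded_linear_inner_left[of i]] D])
        (use c that in \<open>auto simp: g_def\<close>)
  qed
  have ddg: "differential A (\<lambda>p. differential A g p (?E w p)) x z = 0" if "z \<in> TS x" for w z
  proof (rule differential_chart[OF c that])
    show "((\<lambda>p. differential A g p (?E w p)) \<circ> chart_inv c has_derivative (\<lambda>z. 0)) (at (chart_map c x))"
      by (rule has_derivative_transform_within_open[OF has_derivative_const[of "w \<bullet> i"] D])
        (use c dg in auto)
  qed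
  have "differential A g x (\<lambda>d. nabla x (?E u x) (?E w) d - nabla x (?E w x) (?E u) d) =
      differential A (\<lambda>p. differential A g p (?E w p)) x (?E u x) - differential A (\<lambda>p. differential A g p (?E u p)) x (?E w x)"
    by (rule torsion[unfolded torsion_free_def, THEN spec, THEN spec, THEN spec, THEN spec, THEN mp, THEN bspec, OF _ c(2)])
      (intro conjI allI open_chart_dom[OF c(1)] smooth_field_const[OF c(1)] gk)
  also have "\<dots> = 0" using ddg c by simp
  finally have 0: "differential A g x (\<lambda>d. nabla x (?E u x) (?E w) d - nabla x (?E w x) (?E u) d) = 0" .
  have T: "nabla x (?E u x) (?E w) \<in> TS x" for u w
    by (rule nabla_tangent[OF open_chart_dom[OF c(1)] c(2) chart_tangent_mem[OF c] smooth_field_const[OF c(1)]])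
  have "(\<lambda>d. nabla x (?E u x) (?E w) d - nabla x (?E w x) (?E u) d) \<in> TS x"
    using tangent_combo[OF T[of u w] T[of w u], of 1 "-1"] by simp
  with 0 dg[OF c(2)] show "christoffel A nabla c x u w \<bullet> i = christoffel A nabla c x w u \<bullet> i"
    by (simp add: christoffel_def inner_diff_left)
qed

end

section \<open>The Hessian and its covariant derivative in coordinates\<close>

locale C3_function = affine_manifold A nabla
  for A :: "('m::{t2_space,second_countable_topology}, 'e::euclidean_space) chart set" and nabla +
  fixes C :: "'m set" and f :: "'m \<Rightarrow> real"
  assumes C_open: "open C" and C3: "Ck_fun A 3 C f"
begin

abbreviation df :: "('m, 'e) chart \<Rightarrow> 'e \<Rightarrow> 'e \<Rightarrow> real" where
  "df c y \<equiv> fd (f \<circ> chart_inv c) y"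

text \<open>Coordinate form of the Hessian, as \<open>dhess\<close> is of its covariant derivative.
  On an open subset of a vector space these can be differentiated in the base point, which the
  descriptions \<open>hessian\<close> and \<open>cov_deriv_hessian\<close> do not allow
  directly.\<close>

definition hess :: "('m, 'e) chart \<Rightarrow> 'e \<Rightarrow> 'e \<Rightarrow> 'e \<Rightarrow> real" where
  "hess c y u w = fd (\<lambda>y. df c y w) y u - df c y (\<Gamma> c y u w)"

definition dhess :: "('m, 'e) chart \<Rightarrow> 'e \<Rightarrow> 'e \<Rightarrow> 'e \<Rightarrow> 'e \<Rightarrow> real" where
  "dhess c y v u w = fd (\<lambda>y. hess c y u w) y v - hess c y (\<Gamma> c y v u) w - hess c y u (\<Gamma> c y v w)"

abbreviation D where "D \<equiv> differential A f"
abbreviation H where "H \<equiv> hessian A nabla f"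
abbreviation DH where "DH \<equiv> cov_deriv_hessian A nabla f"

abbreviation dom :: "('m, 'e) chart \<Rightarrow> 'e set" where
  "dom c \<equiv> chart_map c ` (C \<inter> chart_dom c)"

lemma open_dom: "c \<in> A \<Longrightarrow> open (dom c)"
  using open_chart_image[OF _ C_open] .

lemma Ck_f: "c \<in> A \<Longrightarrow> Ck_on 3 (dom c) (f \<circ> chart_inv c)"
  using C3 by (simp add: Ck_fun_def)

lemma Ck_df: "c \<in> A \<Longrightarrow> Ck_on 2 (dom c) (\<lambda>y. df c y w)"
  using Ck_f[of c] by (simp add: eval_nat_numeral)

lemma Ck_ddf: "c \<in> A \<Longrightarrow> Ck_on 1 (dom c) (\<lambda>y. fd (\<lambda>y. df c y w) y u)"
  using Ck_df[of c w] by (simp add: eval_nat_numeral)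

lemma f_has_derivative: "c \<in> A \<Longrightarrow> y \<in> dom c \<Longrightarrow> (f \<circ> chart_inv c has_derivative df c y) (at y)"
  using Ck_on_has_derivative[of 2 "dom c" "f \<circ> chart_inv c" y] Ck_f[of c] by (simp add: eval_nat_numeral)

lemma linear_df: "c \<in> A \<Longrightarrow> y \<in> dom c \<Longrightarrow> linear (df c y)"
  using f_has_derivative has_derivative_linear by blast

lemma df_has_derivative:
  "c \<in> A \<Longrightarrow> y \<in> dom c \<Longrightarrow> ((\<lambda>y. df c y w) has_derivative fd (\<lambda>y. df c y w) y) (at y)"
  using Ck_on_has_derivative[of 1 "dom c" "\<lambda>y. df c y w" y] Ck_df[of c] by (simp add: eval_nat_numeral)

lemma ddf_sym: "c \<in> A \<Longrightarrow> y \<in> dom c \<Longrightarrow> fd (\<lambda>y. df c y w) y u = fd (\<lambda>y. df c y u) y w"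
  using second_derivative_symmetric[OF open_dom, of c y "f \<circ> chart_inv c"] Ck_on_mono[OF Ck_f, of c 2] by simp

lemma linear_ddf: "c \<in> A \<Longrightarrow> y \<in> dom c \<Longrightarrow> linear (fd (\<lambda>y. df c y w) y)"
  using df_has_derivative has_derivative_linear by blast

lemma Ck_hess:
  assumes c: "c \<in> A"
  shows "Ck_on 1 (dom c) (\<lambda>y. hess c y u w)"
proof -
  let ?G = "\<lambda>y. \<Sum>i\<in>Basis. (\<Gamma> c y u w \<bullet> i) *\<^sub>R df c y i"
  have "Ck_on 1 (dom c) ?G"
  proof (intro Ck_on_sum Ck_on_scaleR open_dom c Ck_on_bounded_linear[OF _ bounded_linear_inner_left])
    show "Ck_on 1 (dom c) (\<lambda>y. \<Gamma> c y u w)"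
      by (rule Ck_on_subset[OF Ck_christoffel[OF c]]) auto
    show "Ck_on 1 (dom c) (\<lambda>y. df c y i)" for i
      using Ck_on_mono[OF Ck_df[OF c], of 1] by simp
  qed
  then have "Ck_on 1 (dom c) (\<lambda>y. fd (\<lambda>y. df c y w) y u + (-1) *\<^sub>R ?G y)"
    by (intro Ck_on_add open_dom c Ck_ddf Ck_on_scaleR Ck_on_const)
  then show ?thesis
  proof (rule Ck_on_cong[OF open_dom[OF c], rotated])
    fix y assume "y \<in> dom c"
    then show "fd (\<lambda>y. df c y w) y u + (-1) *\<^sub>R ?G y = hess c y u w"
      using linear_basis_sum[OF linear_df[OF c], of y "\<Gamma> c y u w"] by (simp add: hess_def)
  qed
qed

lemma hess_has_derivative:
  "c \<in> A \<Longrightarrow> y \<in> dom c \<Longrightarrow> ((\<lambda>y. hess c y u w) has_derivative fd (\<lambda>y. hess c y u w) y) (at y)"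
  using Ck_on_has_derivative[of 0 "dom c" "\<lambda>y. hess c y u w" y] Ck_hess[of c] by simp

text \<open>Second derivatives commute and the Christoffel term is symmetric by torsion-freeness.
  Linearity is read off after swapping the arguments, when \<open>w\<close> has become the direction
  of a derivative.\<close>

lemma sym_form_hess:
  assumes c: "c \<in> A" and y: "y \<in> dom c"
  shows "sym_form (hess c y)"
proof -
  have ic: "chart_inv c y \<in> chart_dom c" using chart_mapsto[OF c] y by blast
  have sym: "hess c y u w = hess c y w u" for u w
    using ddf_sym[OF c y] christoffel_sym[OF c ic] by (simp add: hess_def)
  have "linear (hess c y u)" for u
  proof -
    have "hess c y u = (\<lambda>w. fd (\<lambda>y. df c y u) y w - df c y (\<Gamma> c y u w))"
      using ddf_sym[OF c y] by (simp add: hess_def fun_eq_iff)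
    then show ?thesis
      using linear_compose_sub[OF linear_ddf[OF c y] linear_compose[OF linear_christoffel(1)[OF c ic] linear_df[OF c y]]]
      by (simp add: comp_def)
  qed
  with sym show ?thesis by (simp add: sym_form_def)
qed

text \<open>The algebraic identities of \<open>hess\<close> hold on an open set of base points and
  so pass to its derivative. They are needed to polarize the self-concordance bound.\<close>

lemma sym_form_dhess:
  assumes c: "c \<in> A" and y: "y \<in> dom c"
  shows "sym_form (dhess c y v)"
proof -
  note sf = sym_form_hess[OF c]
  have ic: "chart_inv c y \<in> chart_dom c" using chart_mapsto[OF c] y by blast
  note tr = has_derivative_transform_within_open[OF _ open_dom[OF c] y]
  have sym: "fd (\<lambda>y. hess c y u w) y = fd (\<lambda>y. hess c y w u) y" for u w
    by (rule frechet_derivative_at[OF tr[OF hess_has_derivative[OF c y]]])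
      (use sf sym_form_sym in blast)
  have add: "fd (\<lambda>y. hess c y u (w + z)) y v = fd (\<lambda>y. hess c y u w) y v + fd (\<lambda>y. hess c y u z) y v" for u w z
  proof -
    have "((\<lambda>y. hess c y u (w + z)) has_derivative (\<lambda>v. fd (\<lambda>y. hess c y u w) y v + fd (\<lambda>y. hess c y u z) y v)) (at y)"
      by (rule tr[OF has_derivative_add[OF hess_has_derivative[OF c y] hess_has_derivative[OF c y]]])
        (use sym_form_simps[OF sf] in simp)
    from frechet_derivative_at[OF this] show ?thesis by metis
  qed
  have scale: "fd (\<lambda>y. hess c y u (a *\<^sub>R w)) y v = a * fd (\<lambda>y. hess c y u w) y v" for u w a
  proof -
    have "((\<lambda>y. hess c y u (a *\<^sub>R w)) has_derivative (\<lambda>v. a * fd (\<lambda>y. hess c y u w) y v)) (at y)"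
      by (rule tr[OF has_derivative_mult_right[OF hess_has_derivative[OF c y]]])
        (use sym_form_simps[OF sf] in simp)
    from frechet_derivative_at[OF this] show ?thesis by metis
  qed
  have "linear (dhess c y v u)" for u
    by (rule linearI)
      (simp_all add: dhess_def add scale sym_form_simps[OF sf[OF y]] algebra_simps
        linear_add[OF linear_christoffel(1)[OF c ic]] linear_cmul[OF linear_christoffel(1)[OF c ic]])
  moreover have "dhess c y v u w = dhess c y v w u" for u w
    by (simp add: dhess_def sym[of u w] sym_form_sym[OF sf[OF y], of u] sym_form_sym[OF sf[OF y], of "\<Gamma> c y v u"])
  ultimately show ?thesis by (simp add: sym_form_def)
qed

lemma differential_f:
  assumes "c \<in> A" "x \<in> C" "x \<in> chart_dom c" "u \<in> TS x"
  shows "D x u = df c (chart_map c x) (u c)"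
  using assms by (intro differential_chart f_has_derivative) auto

lemma smooth_field_has_derivative:
  assumes "c \<in> A" "x \<in> chart_dom c" "x \<in> U" "smooth_field A U Y"
  shows "((\<lambda>p. Y (chart_inv c p) c) has_derivative fd (\<lambda>p. Y (chart_inv c p) c) (chart_map c x)) (at (chart_map c x))"
  by (rule Ck_on_has_derivative[OF smooth_field_Ck[OF assms(4,1), of "Suc 0"]]) (use assms in auto)

text \<open>The derivative of the coordinates of \<open>Y\<close> contributes the same term to both
  summands of \<open>hessian_fields\<close>; its cancellation makes the value depend on the fields
  only through \<open>X x\<close> and \<open>Y x\<close>.\<close>

lemma hessian_fields_chart:
  assumes c: "c \<in> A" "x \<in> chart_dom c" and x: "x \<in> C" and U: "open U" "x \<in> U"
    and X: "X x \<in> TS x" and Y: "smooth_field A U Y"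
  shows "hessian_fields A nabla f X Y x = hess c (chart_map c x) (X x c) (Y x c)"
proof -
  let ?y = "chart_map c x" and ?Y = "\<lambda>p. Y (chart_inv c p) c"
  let ?W = "chart_map c ` (C \<inter> U \<inter> chart_dom c)"
  have y: "?y \<in> dom c" using c x by auto
  have W: "open ?W" "?y \<in> ?W" using open_chart_image[of c "C \<inter> U"] c U x C_open by auto
  have "((\<lambda>y. df c y (?Y y)) has_derivative (\<lambda>h. fd (\<lambda>y. df c y (?Y ?y)) ?y h + df c ?y (fd ?Y ?y h))) (at ?y)"
  proof (rule has_derivative_linear_family[OF _ _ df_has_derivative smooth_field_has_derivative])
    show "\<forall>\<^sub>F s in at ?y. linear (df c s)"
      by (rule eventually_mono[OF eventually_at_in_open'[OF open_dom[OF c(1)] y]]) (rule linear_df[OF c(1)])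
  qed (use linear_df c y U Y in auto)
  then have "((\<lambda>p. D p (Y p)) \<circ> chart_inv c has_derivative
      (\<lambda>h. fd (\<lambda>y. df c y (?Y ?y)) ?y h + df c ?y (fd ?Y ?y h))) (at ?y)"
  proof (rule has_derivative_transform_within_open[OF _ W])
    fix p assume "p \<in> ?W"
    then obtain q where q: "q \<in> C" "q \<in> U" "q \<in> chart_dom c" "p = chart_map c q" by auto
    then show "df c p (?Y p) = ((\<lambda>p. D p (Y p)) \<circ> chart_inv c) p"
      using differential_f[OF c(1) q(1,3)] smooth_field_tangent[OF Y q(2)] c by simp
  qed
  from differential_chart[OF c X this]
  have "differential A (\<lambda>p. D p (Y p)) x (X x) =
      fd (\<lambda>y. df c y (Y x c)) ?y (X x c) + df c ?y (fd ?Y ?y (X x c))" using c by simp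
  moreover have "D x (nabla x (X x) Y)
      = df c ?y (fd ?Y ?y (X x c)) + df c ?y (christoffel A nabla c x (X x c) (Y x c))"
    using differential_f[OF c(1) x c(2) nabla_tangent[OF U X Y]] nabla_chart[OF c U X Y]
      linear_add[OF linear_df[OF c(1) y]] by simp
  ultimately show ?thesis using c by (simp add: hessian_fields_def hess_def)
qed

lemma hessian_chart:
  assumes c: "c \<in> A" "x \<in> chart_dom c" and x: "x \<in> C"
    and u: "u \<in> TS x" "w \<in> TS x"
  shows "H x u w = hess c (chart_map c x) (u c) (w c)"
  unfolding hessian_def
proof (rule the_equality)
  show "\<forall>U X Y. open U \<and> x \<in> U \<and> smooth_field A U X \<and> smooth_field A U Y \<and> X x = u \<and> Y x = w \<longrightarrow>
      hess c (chart_map c x) (u c) (w c) = hessian_fields A nabla f X Y x"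
    using hessian_fields_chart[OF c x] u by metis
  fix r
  assume *: "\<forall>U X Y. open U \<and> x \<in> U \<and> smooth_field A U X \<and> smooth_field A U Y \<and> X x = u \<and> Y x = w \<longrightarrow>
      r = hessian_fields A nabla f X Y x"
  \<comment> \<open>Extensions with constant coordinates show that the condition characterizing
    \<open>r\<close> is not vacuous.\<close>
  let ?X = "\<lambda>p. E c p (u c)" and ?Y = "\<lambda>p. E c p (w c)"
  have "r = hessian_fields A nabla f ?X ?Y x"
    using *[rule_format, of "chart_dom c" ?X ?Y] open_chart_dom[OF c(1)] smooth_field_const[OF c(1)] c u by simp
  also have "\<dots> = hess c (chart_map c x) (u c) (w c)"
    using hessian_fields_chart[OF c x open_chart_dom[OF c(1)] c(2) _ smooth_field_const[OF c(1)], of ?X "w c"] c u by simp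
  finally show "r = hess c (chart_map c x) (u c) (w c)" .
qed

lemma hessian_combo_has_derivative:
  assumes c: "c \<in> A" and y: "y \<in> dom c"
    and X: "(X has_derivative X') (at y)" and Y: "(Y has_derivative Y') (at y)"
  shows "((\<lambda>p. hess c p (X p) (Y p)) has_derivative
    (\<lambda>h. fd (\<lambda>p. hess c p (X y) (Y y)) y h + hess c y (X y) (Y' h) + hess c y (X' h) (Y y))) (at y)"
proof -
  have ev: "\<forall>\<^sub>F s in at y. sym_form (hess c s)"
    by (rule eventually_mono[OF eventually_at_in_open'[OF open_dom[OF c] y]]) (rule sym_form_hess[OF c])
  have lin: "linear (h u)" "linear (\<lambda>u. h u (w::'e))" if "sym_form h" for u w and h :: "'e \<Rightarrow> 'e \<Rightarrow> real"
    using that by (auto simp: sym_form_def linear_iff)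
  have 1: "((\<lambda>p. hess c p u (Y p)) has_derivative (\<lambda>h. fd (\<lambda>p. hess c p u (Y y)) y h + hess c y u (Y' h))) (at y)" for u
    by (rule has_derivative_linear_family[OF _ _ hess_has_derivative[OF c y] Y])
      (use eventually_mono[OF ev lin(1)] lin(1) sym_form_hess[OF c y] in auto)
  show ?thesis
    by (rule has_derivative_linear_family[where L="\<lambda>p u. hess c p u (Y p)", OF _ _ 1 X])
      (use eventually_mono[OF ev lin(2)] lin(2) sym_form_hess[OF c y] in auto)
qed

text \<open>As for the Hessian, the derivatives of the coordinates of \<open>X\<close> and
  \<open>Y\<close> cancel against those inside the covariant derivatives and leave a tensorial
  expression.\<close>

lemma cov_deriv_hessian_fields:
  assumes c: "c \<in> A" "x \<in> chart_dom c" and x: "x \<in> C" and v: "v \<in> TS x"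
    and U: "open U" "x \<in> U" and X: "smooth_field A U X" and Y: "smooth_field A U Y"
  shows "differential A (\<lambda>p. H p (X p) (Y p)) x v
      - H x (nabla x v X) (Y x) - H x (X x) (nabla x v Y)
    = dhess c (chart_map c x) (v c) (X x c) (Y x c)"
proof -
  let ?y = "chart_map c x" and ?X = "\<lambda>p. X (chart_inv c p) c" and ?Y = "\<lambda>p. Y (chart_inv c p) c"
  let ?W = "chart_map c ` (C \<inter> U \<inter> chart_dom c)"
  have y: "?y \<in> dom c" using c x by auto
  have W: "open ?W" "?y \<in> ?W" using open_chart_image[of c "C \<inter> U"] c U x C_open by auto
  have tX: "X x \<in> TS x" and tY: "Y x \<in> TS x" using smooth_field_tangent[OF X] smooth_field_tangent[OF Y] U by auto
  note dX = smooth_field_has_derivative[OF c U(2) X] and dY = smooth_field_has_derivative[OF c U(2) Y]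
  have "((\<lambda>p. H p (X p) (Y p)) \<circ> chart_inv c has_derivative
      (\<lambda>h. fd (\<lambda>p. hess c p (?X ?y) (?Y ?y)) ?y h + hess c ?y (?X ?y) (fd ?Y ?y h) + hess c ?y (fd ?X ?y h) (?Y ?y))) (at ?y)"
  proof (rule has_derivative_transform_within_open[OF hessian_combo_has_derivative[OF c(1) y dX dY] W])
    fix p assume "p \<in> ?W"
    then obtain q where q: "q \<in> C" "q \<in> U" "q \<in> chart_dom c" "p = chart_map c q" by auto
    then show "hess c p (?X p) (?Y p) = ((\<lambda>p. H p (X p) (Y p)) \<circ> chart_inv c) p"
      using hessian_chart[OF c(1) q(3,1)] smooth_field_tangent[OF X q(2)] smooth_field_tangent[OF Y q(2)] c by simp
  qed
  from differential_chart[OF c v this]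
  have "differential A (\<lambda>p. H p (X p) (Y p)) x v =
     fd (\<lambda>p. hess c p (X x c) (Y x c)) ?y (v c) + hess c ?y (X x c) (fd ?Y ?y (v c)) + hess c ?y (fd ?X ?y (v c)) (Y x c)"
    using c by simp
  then show ?thesis
    using hessian_chart[OF c x nabla_tangent[OF U v X] tY] hessian_chart[OF c x tX nabla_tangent[OF U v Y]]
      nabla_chart[OF c U v X] nabla_chart[OF c U v Y] c
    by (simp add: dhess_def sym_form_simps[OF sym_form_hess[OF c(1) y]])
qed

lemma cov_deriv_hessian_chart:
  assumes c: "c \<in> A" "x \<in> chart_dom c" and x: "x \<in> C"
    and u: "u \<in> TS x" "w \<in> TS x" and v: "v \<in> TS x"
  shows "DH x v u w = dhess c (chart_map c x) (v c) (u c) (w c)"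
  unfolding cov_deriv_hessian_def
proof (rule the_equality)
  show "\<forall>U X Y. open U \<and> x \<in> U \<and> smooth_field A U X \<and> smooth_field A U Y \<and> X x = u \<and> Y x = w \<longrightarrow>
      dhess c (chart_map c x) (v c) (u c) (w c) = differential A (\<lambda>p. H p (X p) (Y p)) x v
                - H x (nabla x v X) w - H x u (nabla x v Y)"
  proof (intro allI impI, elim conjE)
    fix U X Y assume "open U" "x \<in> U" "smooth_field A U X" "smooth_field A U Y" "X x = u" "Y x = w"
    from cov_deriv_hessian_fields[OF c x v this(1-4), symmetric] this(5,6)
    show "dhess c (chart_map c x) (v c) (u c) (w c) = differential A (\<lambda>p. H p (X p) (Y p)) x v
                - H x (nabla x v X) w - H x u (nabla x v Y)" by simp
  qed
  fix r
  assume *: "\<forall>U X Y. open U \<and> x \<in> U \<and> smooth_field A U X \<and> smooth_field A U Y \<and> X x = u \<and> Y x = w \<longrightarrow>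
      r = differential A (\<lambda>p. H p (X p) (Y p)) x v
                - H x (nabla x v X) w - H x u (nabla x v Y)"
  let ?X = "\<lambda>p. E c p (u c)" and ?Y = "\<lambda>p. E c p (w c)"
  have "r = differential A (\<lambda>p. H p (?X p) (?Y p)) x v
                - H x (nabla x v ?X) w - H x u (nabla x v ?Y)"
    using *[rule_format, of "chart_dom c" ?X ?Y] open_chart_dom[OF c(1)] smooth_field_const[OF c(1)] c u by simp
  also have "\<dots> = dhess c (chart_map c x) (v c) (u c) (w c)"
    using cov_deriv_hessian_fields[OF c x v open_chart_dom[OF c(1)] c(2) smooth_field_const[OF c(1)] smooth_field_const[OF c(1)], of "u c" "w c"] c u by simp
  finally show "r = dhess c (chart_map c x) (v c) (u c) (w c)" .
qed

end

section \<open>Geodesics depend continuously on their initial data\<close>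

lemma real_derivative_nonpos_imp_le:
  fixes g :: "real \<Rightarrow> real"
  assumes d: "\<And>t. t \<in> {a..b} \<Longrightarrow> (g has_real_derivative g' t) (at t within {a..b})"
    and nonpos: "\<And>t. t \<in> {a..b} \<Longrightarrow> g' t \<le> 0" and ab: "a \<le> b"
  shows "g b \<le> g a"
proof (cases "a = b")
  case False
  then have "a < b" using ab by simp
  then have "\<exists>x\<in>{a<..<b}. g b - g a = g' x * (b - a)"
    by (rule mvt_simple) (use d in \<open>auto simp: has_field_derivative_def\<close>)
  then obtain x where "x \<in> {a<..<b}" "g b - g a = g' x * (b - a)" by blast
  moreover have "g' x * (b - a) \<le> 0" using nonpos[of x] calculation ab by (intro mult_nonpos_nonneg) auto
  ultimately show ?thesis by simp
qed simp

text \<open>The squared distance is differentiable even where the distance vanishes; damped by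
  \<open>exp (- 2 * L * (t - a))\<close> it is nonincreasing.\<close>

lemma gronwall_norm_diff:
  fixes Y Z :: "real \<Rightarrow> 'a::real_inner"
  assumes Y: "\<And>t. t \<in> {a..b} \<Longrightarrow> (Y has_vector_derivative Y' t) (at t within {a..b})"
    and Z: "\<And>t. t \<in> {a..b} \<Longrightarrow> (Z has_vector_derivative Z' t) (at t within {a..b})"
    and L: "\<And>t. t \<in> {a..b} \<Longrightarrow> norm (Z' t - Y' t) \<le> L * norm (Z t - Y t)" and ab: "a \<le> b"
  shows "norm (Z b - Y b) \<le> exp (L * (b - a)) * norm (Z a - Y a)"
proof -
  define D where "D t = (Z t - Y t) \<bullet> (Z t - Y t)" for t
  have D: "(D has_real_derivative 2 * ((Z t - Y t) \<bullet> (Z' t - Y' t))) (at t within {a..b})" if "t \<in> {a..b}" for t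
  proof -
    have "((\<lambda>t. Z t - Y t) has_vector_derivative (Z' t - Y' t)) (at t within {a..b})"
      by (intro has_vector_derivative_diff Y Z that)
    from has_derivative_inner[OF this[unfolded has_vector_derivative_def] this[unfolded has_vector_derivative_def]]
    have "(D has_derivative (\<lambda>h. h * (2 * ((Z t - Y t) \<bullet> (Z' t - Y' t))))) (at t within {a..b})"
      unfolding D_def by (rule has_derivative_eq_rhs) (auto simp: inner_commute algebra_simps)
    then show ?thesis by (simp add: has_field_derivative_def mult_commute_abs)
  qed
  have "D b * exp (- 2 * L * (b - a)) \<le> D a * exp (- 2 * L * (a - a))"
  proof (rule real_derivative_nonpos_imp_le[OF _ _ ab])
    fix t assume t: "t \<in> {a..b}"
    show "((\<lambda>t. D t * exp (- 2 * L * (t - a))) has_real_derivative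
       (2 * ((Z t - Y t) \<bullet> (Z' t - Y' t)) - 2 * L * D t) * exp (- 2 * L * (t - a))) (at t within {a..b})"
      by (auto intro!: derivative_eq_intros D t simp: algebra_simps)
    have "(Z t - Y t) \<bullet> (Z' t - Y' t) \<le> norm (Z t - Y t) * norm (Z' t - Y' t)"
      by (rule norm_cauchy_schwarz)
    also have "\<dots> \<le> norm (Z t - Y t) * (L * norm (Z t - Y t))"
      by (intro mult_left_mono L t) auto
    also have "\<dots> = L * D t" by (simp add: D_def dot_square_norm power2_eq_square)
    finally show "(2 * ((Z t - Y t) \<bullet> (Z' t - Y' t)) - 2 * L * D t) * exp (- 2 * L * (t - a)) \<le> 0"
      by (simp add: mult_le_0_iff)
  qed
  moreover have "exp (- 2 * L * (b - a)) = inverse (exp (2 * (L * (b - a))))"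
    by (simp flip: exp_minus)
  ultimately have "D b / exp (2 * (L * (b - a))) \<le> D a"
    by (simp add: divide_inverse)
  then have "D b \<le> D a * exp (2 * (L * (b - a)))"
    by (simp only: pos_divide_le_eq[OF exp_gt_zero])
  also have "\<dots> = (exp (L * (b - a)) * norm (Z a - Y a))\<^sup>2"
    by (simp only: D_def dot_square_norm power_mult_distrib exp_double mult.commute)
  finally have "(norm (Z b - Y b))\<^sup>2 \<le> (exp (L * (b - a)) * norm (Z a - Y a))\<^sup>2"
    by (simp add: D_def dot_square_norm)
  then show ?thesis by (rule power2_le_imp_le) simp
qed

text \<open>\<open>K\<close> need not be convex, so the mean value inequality is applied on the
  balls around its points; their union is compact, which bounds the derivative uniformly.\<close>

lemma Ck_on_lipschitz_near_compact:
  fixes F :: "'a::euclidean_space \<Rightarrow> 'b::real_normed_vector"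
  assumes S: "open S" and F: "Ck_on 1 S F" and K: "compact K" "K \<subseteq> S"
  obtains \<eta> L where "\<eta> > 0" "L \<ge> 0" "(\<Union>x\<in>K. cball x \<eta>) \<subseteq> S" "compact (\<Union>x\<in>K. cball x \<eta>)"
    "\<And>p q. p \<in> K \<Longrightarrow> dist p q \<le> \<eta> \<Longrightarrow> norm (F q - F p) \<le> L * norm (q - p)"
proof -
  obtain e where e: "e > 0" "(\<Union>x\<in>K. ball x e) \<subseteq> S"
    using compact_subset_open_imp_ball_epsilon_subset[OF K(1) S K(2)] by blast
  define \<eta> where "\<eta> = e / 2"
  define T where "T = (\<Union>x\<in>K. cball x \<eta>)"
  have \<eta>: "\<eta> > 0" using e by (simp add: \<eta>_def)
  have TS: "T \<subseteq> S" using e by (force simp: T_def \<eta>_def)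
  have T: "compact T" unfolding T_def by (rule compact_minkowski_sum_cball[OF K(1)])
  define N where "N z = (\<Sum>i\<in>Basis. norm (fd F z i))" for z
  have "continuous_on T N"
    unfolding N_def using F TS continuous_on_subset
    by (intro continuous_on_sum continuous_on_norm) (simp, blast)
  then have "bounded (N ` T)" using T compact_continuous_image compact_imp_bounded by blast
  then obtain B where B: "\<And>z. z \<in> T \<Longrightarrow> norm (N z) \<le> B" unfolding bounded_iff by blast
  have dF: "(F has_derivative fd F z) (at z)" if "z \<in> S" for z
    using Ck_on_has_derivative[of 0 S F z] F that by simp
  have on: "onorm (fd F z) \<le> max B 0" if "z \<in> T" for z
  proof (rule onorm_le)
    fix w
    have "linear (fd F z)" using dF TS that has_derivative_linear by blast
    from linear_basis_sum[OF this, of w]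
    have "norm (fd F z w) \<le> (\<Sum>i\<in>Basis. norm ((w \<bullet> i) *\<^sub>R fd F z i))" by (metis norm_sum)
    also have "\<dots> \<le> (\<Sum>i\<in>Basis. norm w * norm (fd F z i))"
      by (intro sum_mono) (auto simp: Basis_le_norm intro!: mult_right_mono)
    also have "\<dots> = N z * norm w" by (simp add: N_def sum_distrib_left mult.commute)
    also have "\<dots> \<le> max B 0 * norm w" using B[OF that] by (intro mult_right_mono) auto
    finally show "norm (fd F z w) \<le> max B 0 * norm w" .
  qed
  have "norm (F q - F p) \<le> max B 0 * norm (q - p)" if "p \<in> K" "dist p q \<le> \<eta>" for p q
  proof (rule differentiable_bound[of "cball p \<eta>"])
    have T: "z \<in> T" if "z \<in> cball p \<eta>" for z using that \<open>p \<in> K\<close> by (auto simp: T_def)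
    show "(F has_derivative fd F z) (at z within cball p \<eta>)" if "z \<in> cball p \<eta>" for z
      by (rule has_derivative_at_withinI[OF dF]) (use T[OF that] TS in auto)
    show "onorm (fd F z) \<le> max B 0" if "z \<in> cball p \<eta>" for z
      by (rule on[OF T[OF that]])
  qed (use \<eta> that in auto)
  then show thesis using that[of \<eta> "max B 0"] \<eta> TS T by (simp add: T_def)
qed

lemma continuous_on_real_nbhd:
  fixes g :: "real \<Rightarrow> 'a::topological_space"
  assumes "continuous_on I g" "t \<in> I" "open S" "g t \<in> S"
  obtains d where "d > 0" "\<And>s. s \<in> I \<Longrightarrow> \<bar>s - t\<bar> < d \<Longrightarrow> g s \<in> S"
proof -
  obtain B where B: "open B" "B \<inter> I = g -` S \<inter> I"
    using assms(1,3) by (auto simp: continuous_on_open_invariant)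
  then have "t \<in> B" using assms(2,4) by blast
  then obtain d where d: "d > 0" "ball t d \<subseteq> B" using B(1) openE by blast
  have "g s \<in> S" if "s \<in> I" "\<bar>s - t\<bar> < d" for s
  proof -
    have "s \<in> B" using that d(2) by (auto simp: dist_real_def abs_minus_commute)
    then show ?thesis using that(1) B(2) by blast
  qed
  then show thesis using that d by blast
qed

context affine_manifold
begin

abbreviation geo :: "real set \<Rightarrow> (real \<Rightarrow> 'm) \<Rightarrow> (real \<Rightarrow> ('m, 'e) tvec) \<Rightarrow> bool" where
  "geo \<equiv> geodesic_with_velocity A nabla"

abbreviation Exp :: "'m \<Rightarrow> ('m, 'e) tvec \<Rightarrow> 'm" where
  "Exp \<equiv> exp_map A nabla"

lemma geodesic_subset:
  assumes "geo I g V" "J \<subseteq> I"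
  shows "geo J g V"
proof -
  note D = has_vector_derivative_within_subset[OF _ assms(2)]
  have "continuous_on J g"
    using assms unfolding geodesic_with_velocity_def curve_velocity_def by (blast intro: continuous_on_subset)
  then show ?thesis
    using assms D unfolding geodesic_with_velocity_def curve_velocity_def parallel_along_def by blast
qed

lemma geodesicD:
  assumes "geo I g V"
  shows "continuous_on I g" "t \<in> I \<Longrightarrow> V t \<in> TS (g t)"
    "t \<in> I \<Longrightarrow> c \<in> A \<Longrightarrow> g t \<in> chart_dom c \<Longrightarrow>
       ((\<lambda>s. chart_map c (g s)) has_vector_derivative V t c) (at t within I)"
    "t \<in> I \<Longrightarrow> c \<in> A \<Longrightarrow> g t \<in> chart_dom c \<Longrightarrow>
       ((\<lambda>s. V s c) has_vector_derivative - christoffel A nabla c (g t) (V t c) (V t c)) (at t within I)"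
  using assms unfolding geodesic_with_velocity_def curve_velocity_def parallel_along_def comp_def by blast+

text \<open>The geodesic spray in coordinates: the second-order geodesic equation as an autonomous
  first-order system for position and velocity.\<close>

definition spray :: "('m, 'e) chart \<Rightarrow> 'e \<times> 'e \<Rightarrow> 'e \<times> 'e" where
  "spray c p = (snd p, - \<Gamma> c (fst p) (snd p) (snd p))"

lemma Ck_spray:
  assumes c: "c \<in> A"
  shows "Ck_on k (chart_map c ` chart_dom c \<times> UNIV) (spray c)"
proof -
  let ?D = "chart_map c ` chart_dom c" and ?S = "chart_map c ` chart_dom c \<times> (UNIV :: 'e set)"
  have D: "open ?D" using open_chart_image_subset[OF c open_chart_dom[OF c]] by simp
  then have S: "open ?S" by (intro open_Times) auto
  let ?G = "\<lambda>p. \<Sum>i\<in>Basis. (snd p \<bullet> i) *\<^sub>R (\<Sum>j\<in>Basis. (snd p \<bullet> j) *\<^sub>R \<Gamma> c (fst p) i j)"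
  have \<Gamma>: "Ck_on k ?S (\<lambda>p. \<Gamma> c (fst p) i j)" for i j
    by (rule Ck_on_compose[OF S D _ Ck_on_linear[OF S bounded_linear_fst] Ck_christoffel[OF c]]) auto
  have snd: "Ck_on k ?S (\<lambda>p. snd p \<bullet> i)" for i
    by (intro Ck_on_bounded_linear[OF S bounded_linear_inner_left] Ck_on_linear S bounded_linear_snd)
  have G: "Ck_on k ?S ?G" by (intro Ck_on_sum Ck_on_scaleR S snd \<Gamma>)
  have "Ck_on k ?S (\<lambda>p. (snd p, 0) + (-1) *\<^sub>R (0, ?G p))"
    by (intro Ck_on_add S Ck_on_scaleR Ck_on_const
        Ck_on_bounded_linear[OF S bounded_linear_Pair[OF bounded_linear_zero bounded_linear_ident]]
        Ck_on_bounded_linear[OF S bounded_linear_Pair[OF bounded_linear_ident bounded_linear_zero]]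
        Ck_on_linear bounded_linear_snd G)
  then show ?thesis
  proof (rule Ck_on_cong[OF S, rotated])
    fix p assume "p \<in> ?S"
    then have "chart_inv c (fst p) \<in> chart_dom c" using chart_mapsto[OF c] by auto
    note lin = linear_christoffel[OF c this]
    have "\<Gamma> c (fst p) (snd p) (snd p) = ?G p"
      by (subst linear_basis_sum[OF lin(2)], subst linear_basis_sum[OF lin(1)]) simp
    then show "(snd p, 0) + (-1) *\<^sub>R (0, ?G p) = spray c p"
      by (simp add: spray_def)
  qed
qed

abbreviation state :: "('m, 'e) chart \<Rightarrow> (real \<Rightarrow> 'm) \<Rightarrow> (real \<Rightarrow> ('m, 'e) tvec) \<Rightarrow> real \<Rightarrow> 'e \<times> 'e" where
  "state c g V t \<equiv> (chart_map c (g t), V t c)"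

lemma state_has_derivative:
  assumes g: "geo I g V" and t: "t \<in> I" "c \<in> A" "g t \<in> chart_dom c"
  shows "(state c g V has_vector_derivative spray c (state c g V t)) (at t within I)"
  using has_vector_derivative_Pair[OF geodesicD(3)[OF g t] geodesicD(4)[OF g t]] t by (simp add: spray_def)

lemma state_continuous:
  assumes g: "geo I g V" and t: "t \<in> I" "c \<in> A" "g t \<in> chart_dom c"
  shows "continuous (at t within I) (state c g V)"
  using state_has_derivative[OF assms] has_vector_derivative_continuous by blast

text \<open>Gronwall inside a tube of radius \<open>r\<close> around the reference curve. Staying in
  the chart domain and staying close are propagated together by real induction, since the estimate
  makes sense only while \<open>h\<close> remains in the domain of \<open>c\<close>.\<close>

lemma geodesic_chart_dependence:
  assumes c: "c \<in> A" and g: "geo {a..b} g V"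
    and dom: "g ` {a..b} \<subseteq> chart_dom c"
  obtains \<eta> M where "\<eta> > 0"
    "\<And>h W t. geo {a..b} h W \<Longrightarrow> h a \<in> chart_dom c \<Longrightarrow>
       dist (state c h W a) (state c g V a) < \<eta> \<Longrightarrow> t \<in> {a..b} \<Longrightarrow>
       h t \<in> chart_dom c \<and> dist (state c h W t) (state c g V t) \<le> M * dist (state c h W a) (state c g V a)"
proof -
  let ?D = "chart_map c ` chart_dom c" and ?S = "chart_map c ` chart_dom c \<times> (UNIV :: 'e set)"
  define K where "K = state c g V ` {a..b}"
  have D: "open ?D" using open_chart_image_subset[OF c open_chart_dom[OF c]] by simp
  then have S: "open ?S" by (intro open_Times) auto
  have "continuous_on {a..b} (state c g V)"
    using state_continuous[OF g _ c] dom by (auto simp: continuous_on_eq_continuous_within)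
  then have K: "compact K" unfolding K_def by (intro compact_continuous_image) auto
  have KS: "K \<subseteq> ?S" using dom by (auto simp: K_def)
  obtain r L where rL: "r > 0" "L \<ge> 0" "(\<Union>x\<in>K. cball x r) \<subseteq> ?S" "compact (\<Union>x\<in>K. cball x r)"
    "\<And>p q. p \<in> K \<Longrightarrow> dist p q \<le> r \<Longrightarrow> norm (spray c q - spray c p) \<le> L * norm (q - p)"
    using Ck_on_lipschitz_near_compact[OF S Ck_spray[OF c] K KS] by blast
  define M where "M = exp (L * (b - a))"
  have M: "M > 0" by (simp add: M_def)
  show thesis
  proof (rule that)
    \<comment> \<open>Gronwall enlarges the initial gap at most by the factor \<open>M\<close>, so
      this bound keeps the curves less than \<open>r\<close> apart.\<close>
    show "r / M > 0" using rL M by simp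
    fix h W t
    assume h: "geo {a..b} h W" and ha: "h a \<in> chart_dom c"
      and d: "dist (state c h W a) (state c g V a) < r / M" and t: "t \<in> {a..b}"
    define d0 where "d0 = dist (state c h W a) (state c g V a)"
    define e where "e t = dist (state c h W t) (state c g V t)" for t
    have Md: "M * d0 < r" using d M by (simp add: d0_def pos_less_divide_eq mult.commute)
    have e_cont: "continuous (at s within {a..b}) e" if "s \<in> {a..b}" "h s \<in> chart_dom c" for s
    proof -
      have "g s \<in> chart_dom c" using that(1) dom by blast
      then show ?thesis unfolding e_def
        by (intro continuous_dist state_continuous[OF h that(1) c that(2)] state_continuous[OF g that(1) c])
    qed
    let ?P = "\<lambda>t. h t \<in> chart_dom c \<and> e t \<le> M * d0"
    have "?P t"
    proof (rule interval_induct[of a t b])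
      fix t assume t: "a \<le> t" "t \<le> b" and IH: "\<And>s. a \<le> s \<Longrightarrow> s < t \<Longrightarrow> ?P s"
      show "?P t"
      proof (cases "t = a")
        case True
        have "1 \<le> M" using t rL by (simp add: M_def)
        then have "d0 \<le> M * d0" using mult_right_mono[of 1 M d0] by (simp add: d0_def)
        then show ?thesis using True ha by (simp add: e_def d0_def)
      next
        case False
        let ?F = "at t within {a..<t}"
        have nt: "?F \<noteq> bot" using t False by (simp add: at_within_Ico_at_left)
        have le: "?F \<le> at t within {a..b}" using t by (intro at_le) auto
        have ev: "\<forall>\<^sub>F s in ?F. s \<in> {a..<t}" by (simp add: eventually_at_filter)
        \<comment> \<open>The tube carried to the manifold: compact, hence closed in a Hausdorff
          space. The limit \<open>h t\<close> therefore cannot fall out of the chart domain.\<close>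
        define Q where "Q = chart_inv c ` fst ` (\<Union>x\<in>K. cball x r)"
        have "fst ` (\<Union>x\<in>K. cball x r) \<subseteq> ?D" using rL(3) by auto
        then have "compact Q" unfolding Q_def
          by (intro compact_continuous_image continuous_on_subset[OF continuous_on_chart_inv[OF c]]
              continuous_on_fst continuous_on_id rL(4))
        then have "closed Q" by (rule compact_imp_closed)
        have Qdom: "Q \<subseteq> chart_dom c" using \<open>fst ` _ \<subseteq> ?D\<close> chart_mapsto[OF c] by (auto simp: Q_def)
        have "\<forall>\<^sub>F s in ?F. h s \<in> Q"
          using ev
        proof eventually_elim
          case (elim s)
          then have P: "?P s" using IH by auto
          have "state c h W s \<in> cball (state c g V s) r" "state c g V s \<in> K"
            using P Md elim t by (auto simp: e_def K_def dist_commute)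
          then have "chart_map c (h s) \<in> fst ` (\<Union>x\<in>K. cball x r)"
            by (intro image_eqI[where x="state c h W s"] UN_I) auto
          then show ?case unfolding Q_def using P c by (metis chart_inv_map imageI)
        qed
        moreover have "(h \<longlongrightarrow> h t) ?F"
          using geodesicD(1)[OF h] t by (intro tendsto_mono[OF le]) (auto simp: continuous_on_def)
        ultimately have "h t \<in> Q" using \<open>closed Q\<close> nt by (intro Lim_in_closed_set)
        then have ht: "h t \<in> chart_dom c" using Qdom by auto
        have "(e \<longlongrightarrow> e t) ?F"
          using e_cont[of t] ht t by (intro tendsto_mono[OF le]) (auto simp: continuous_within)
        moreover have "\<forall>\<^sub>F s in ?F. e s \<le> M * d0"
          using ev by eventually_elim (use IH in auto)
        ultimately have "e t \<le> M * d0" using nt by (intro tendsto_upperbound)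
        with ht show ?thesis by simp
      qed
    next
      fix t assume t: "a \<le> t" "t < b" and IH: "\<And>s. a \<le> s \<Longrightarrow> s \<le> t \<Longrightarrow> ?P s"
      have Pt: "?P t" using IH t by auto
      obtain d1 where d1: "d1 > 0" "\<And>s. s \<in> {a..b} \<Longrightarrow> \<bar>s - t\<bar> < d1 \<Longrightarrow> h s \<in> chart_dom c"
        using continuous_on_real_nbhd[OF geodesicD(1)[OF h] _ open_chart_dom[OF c], of t] Pt t by auto
      have "e t < r" using Pt Md by simp
      then have "\<forall>\<^sub>F s in at t within {a..b}. e s < r"
        using e_cont[of t] Pt t unfolding continuous_within by (intro order_tendstoD) auto
      then obtain d2 where d2: "d2 > 0" "\<And>s. s \<in> {a..b} \<Longrightarrow> s \<noteq> t \<Longrightarrow> \<bar>s - t\<bar> < d2 \<Longrightarrow> e s < r"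
        unfolding eventually_at by (auto simp: dist_real_def)
      have "?P s" if s: "t < s" "s < t + min d1 d2" "s \<le> b" for s
      proof -
        have in_dom: "h s' \<in> chart_dom c \<and> e s' \<le> r" if "s' \<in> {a..s}" for s'
        proof (cases "s' \<le> t")
          case True
          then show ?thesis using IH[of s'] that Md by auto
        next
          case False
          then have "s' \<in> {a..b}" "s' \<noteq> t" "\<bar>s' - t\<bar> < d1" "\<bar>s' - t\<bar> < d2" using that s t by auto
          then show ?thesis using d1(2)[of s'] d2(2)[of s'] by simp
        qed
        have sub: "{a..s} \<subseteq> {a..b}" using s by auto
        have "norm (state c h W s - state c g V s) \<le> exp (L * (s - a)) * norm (state c h W a - state c g V a)"
        proof (rule gronwall_norm_diff)
          fix s' assume s': "s' \<in> {a..s}"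
          then have "s' \<in> {a..b}" using s by auto
          then show "(state c g V has_vector_derivative spray c (state c g V s')) (at s' within {a..s})"
            using s' dom by (intro state_has_derivative[OF geodesic_subset[OF g sub] s' c]) auto
          show "(state c h W has_vector_derivative spray c (state c h W s')) (at s' within {a..s})"
            using in_dom[OF s'] by (intro state_has_derivative[OF geodesic_subset[OF h sub] s' c]) auto
          show "norm (spray c (state c h W s') - spray c (state c g V s')) \<le> L * norm (state c h W s' - state c g V s')"
            using in_dom[OF s'] \<open>s' \<in> {a..b}\<close> by (intro rL(5)) (auto simp: K_def e_def dist_commute)
        qed (use s t in auto)
        also have "\<dots> \<le> M * d0"
          unfolding M_def d0_def dist_norm using s rL t by (intro mult_right_mono) (auto intro!: mult_left_mono)
        finally show ?thesis using in_dom[of s] s t by (auto simp: e_def dist_norm)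
      qed
      then show "\<exists>h'>0. \<forall>s. t < s \<and> s < t + h' \<and> s \<le> b \<longrightarrow> ?P s"
        using d1 d2 by (intro exI[of _ "min d1 d2"]) auto
    qed (use t in auto)
    then show "h t \<in> chart_dom c \<and> dist (state c h W t) (state c g V t) \<le> M * dist (state c h W a) (state c g V a)"
      by (simp add: e_def d0_def)
  qed
qed

text \<open>The base points move along with the vectors, so convergence passes from one chart to
  another by continuity of the Jacobian of the transition map.\<close>

lemma tangent_tendsto:
  assumes x: "(x \<longlongrightarrow> p) F" and u: "\<forall>\<^sub>F n in F. u n \<in> TS (x n)" "u0 \<in> TS p"
    and c: "c \<in> A" "p \<in> chart_dom c" and lim: "((\<lambda>n. u n c) \<longlongrightarrow> u0 c) F"
    and d: "d \<in> A" "p \<in> chart_dom d"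
  shows "((\<lambda>n. u n d) \<longlongrightarrow> u0 d) F"
proof -
  have ev: "\<forall>\<^sub>F n in F. x n \<in> chart_dom c \<inter> chart_dom d"
    using x c(2) d(2) open_Int[OF open_chart_dom[OF c(1)] open_chart_dom[OF d(1)]]
    by (intro topological_tendstoD) auto
  have cx: "((\<lambda>n. chart_map c (x n)) \<longlongrightarrow> chart_map c p) F"
    using continuous_on_tendsto_compose[OF continuous_on_chart_map[OF c(1)] x c(2)] ev
    by (simp add: eventually_mono)
  have "((\<lambda>n. fd (transition c d) (chart_map c (x n)) (u n c)) \<longlongrightarrow> fd (transition c d) (chart_map c p) (u0 c)) F"
  proof (rule linear_family_tendsto[OF _ _ _ lim])
    show "\<forall>\<^sub>F n in F. linear (fd (transition c d) (chart_map c (x n)))"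
      using ev by eventually_elim (use linear_transition[OF c(1) d(1)] in auto)
    show "((\<lambda>n. fd (transition c d) (chart_map c (x n)) w) \<longlongrightarrow> fd (transition c d) (chart_map c p) w) F" for w
    proof (rule tendsto_compose[OF _ cx])
      have "continuous_on (chart_map c ` (chart_dom c \<inter> chart_dom d)) (\<lambda>y. fd (transition c d) y w)"
        using Ck_transition[OF c(1) d(1), of "Suc 0"] by simp
      then show "((\<lambda>y. fd (transition c d) y w) \<longlongrightarrow> fd (transition c d) (chart_map c p) w) (at (chart_map c p))"
        using open_overlap[OF c(1) d(1)] c d by (auto simp: continuous_on_eq_continuous_at isCont_def)
    qed
  qed (rule linear_transition[OF c(1) d(1) c(2) d(2)])
  moreover have "\<forall>\<^sub>F n in F. fd (transition c d) (chart_map c (x n)) (u n c) = u n d"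
    using ev u(1) by eventually_elim (metis Int_iff c(1) d(1) tangent_transition)
  ultimately show ?thesis
    unfolding tangent_transition[OF u(2) c(1) d(1) c(2) d(2)] by (rule Lim_transform_eventually)
qed

text \<open>Real induction along the limit geodesic through charts that cover it. All geodesics are
  given on the whole interval, so no existence theorem for the geodesic equation enters.\<close>

lemma geodesic_dependence:
  assumes g: "geo {0..1} g V"
    and h: "\<And>n. geo {0..1} (h n) (W n)"
    and h0: "(\<lambda>n. h n 0) \<longlonglongrightarrow> g 0" and W0: "\<And>c. c \<in> A \<Longrightarrow> g 0 \<in> chart_dom c \<Longrightarrow> (\<lambda>n. W n 0 c) \<longlonglongrightarrow> V 0 c"
    and t: "t \<in> {0..1}"
  shows "(\<lambda>n. h n t) \<longlonglongrightarrow> g t"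
proof -
  \<comment> \<open>Velocities have to converge in every chart around \<open>g t\<close>, so that
    the next step may switch charts.\<close>
  define P where "P t \<longleftrightarrow> (\<lambda>n. h n t) \<longlonglongrightarrow> g t \<and> (\<forall>c\<in>A. g t \<in> chart_dom c \<longrightarrow> (\<lambda>n. W n t c) \<longlonglongrightarrow> V t c)" for t
  have step: "P t" if P: "P s" and c: "c \<in> A" "\<And>t'. t' \<in> {s..t} \<Longrightarrow> g t' \<in> chart_dom c" and st: "0 \<le> s" "s \<le> t" "t \<le> 1" for s t c
  proof -
    have sub: "{s..t} \<subseteq> {0..1}" using st by auto
    obtain \<eta> M where \<eta>: "\<eta> > 0" and dep:
      "\<And>n. h n s \<in> chart_dom c \<Longrightarrow> dist (state c (h n) (W n) s) (state c g V s) < \<eta> \<Longrightarrow>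
        h n t \<in> chart_dom c \<and> dist (state c (h n) (W n) t) (state c g V t) \<le> M * dist (state c (h n) (W n) s) (state c g V s)"
      using geodesic_chart_dependence[OF c(1) geodesic_subset[OF g sub]] geodesic_subset[OF h sub] c(2) st
      by (smt (verit) atLeastAtMost_iff image_subset_iff)
    have gs: "g s \<in> chart_dom c" and gt: "g t \<in> chart_dom c" using c st by auto
    have ev: "\<forall>\<^sub>F n in sequentially. h n s \<in> chart_dom c"
      using P gs open_chart_dom[OF c(1)] unfolding P_def by (intro topological_tendstoD) auto
    have "(\<lambda>n. chart_map c (h n s)) \<longlonglongrightarrow> chart_map c (g s)"
      by (rule continuous_on_tendsto_compose[OF continuous_on_chart_map[OF c(1)] _ gs ev]) (use P in \<open>simp add: P_def\<close>)
    then have "(\<lambda>n. state c (h n) (W n) s) \<longlonglongrightarrow> state c g V s"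
      using P c(1) gs unfolding P_def by (intro tendsto_Pair) auto
    then have lim0: "(\<lambda>n. dist (state c (h n) (W n) s) (state c g V s)) \<longlonglongrightarrow> 0" by (rule tendsto_dist_iff[THEN iffD1])
    then have "\<forall>\<^sub>F n in sequentially. dist (state c (h n) (W n) s) (state c g V s) < \<eta>"
      using \<eta> by (intro order_tendstoD)
    with ev have ev2: "\<forall>\<^sub>F n in sequentially. h n t \<in> chart_dom c \<and>
        dist (state c (h n) (W n) t) (state c g V t) \<le> M * dist (state c (h n) (W n) s) (state c g V s)"
      by eventually_elim (use dep in blast)
    have limM: "(\<lambda>n. M * dist (state c (h n) (W n) s) (state c g V s)) \<longlonglongrightarrow> 0"
      using tendsto_mult_left[OF lim0, of M] by simp
    have "(\<lambda>n. dist (state c (h n) (W n) t) (state c g V t)) \<longlonglongrightarrow> 0"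
      by (rule Lim_null_comparison[OF _ limM]) (use ev2 in eventually_elim, simp)
    then have lim: "(\<lambda>n. state c (h n) (W n) t) \<longlonglongrightarrow> state c g V t" by (rule tendsto_dist_iff[THEN iffD2])
    have lim1: "(\<lambda>n. chart_map c (h n t)) \<longlonglongrightarrow> chart_map c (g t)" using tendsto_fst[OF lim] by simp
    have lim2: "(\<lambda>n. W n t c) \<longlonglongrightarrow> V t c" using tendsto_snd[OF lim] by simp
    have "(\<lambda>n. chart_inv c (chart_map c (h n t))) \<longlonglongrightarrow> chart_inv c (chart_map c (g t))"
      by (rule continuous_on_tendsto_compose[OF continuous_on_chart_inv[OF c(1)] lim1])
        (use gt ev2 in \<open>auto elim: eventually_mono\<close>)
    moreover have "\<forall>\<^sub>F n in sequentially. chart_inv c (chart_map c (h n t)) = h n t"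
      using ev2 by eventually_elim (use c in auto)
    ultimately have "(\<lambda>n. h n t) \<longlonglongrightarrow> chart_inv c (chart_map c (g t))" by (rule Lim_transform_eventually)
    then have lim3: "(\<lambda>n. h n t) \<longlonglongrightarrow> g t" using gt c by simp
    have T: "V t \<in> TS (g t)" "\<And>n. W n t \<in> TS (h n t)"
      using geodesicD(2)[OF g] geodesicD(2)[OF h] st by auto
    show ?thesis unfolding P_def
      using lim3 tangent_tendsto[where u="\<lambda>n. W n t", OF lim3 _ T(1) c(1) gt lim2] T(2) by simp
  qed
  have "P t"
  proof (rule interval_induct[of 0 t 1])
    fix t assume t: "0 \<le> t" "t \<le> (1::real)" and IH: "\<And>s. 0 \<le> s \<Longrightarrow> s < t \<Longrightarrow> P s"
    show "P t"
    proof (cases "t = 0")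
      case True
      then show ?thesis using h0 W0 by (simp add: P_def)
    next
      case False
      obtain c where c: "c \<in> A" "g t \<in> chart_dom c" by (rule chart_cover)
      obtain d where d: "d > 0" "\<And>s. s \<in> {0..1} \<Longrightarrow> \<bar>s - t\<bar> < d \<Longrightarrow> g s \<in> chart_dom c"
        using continuous_on_real_nbhd[OF geodesicD(1)[OF g] _ open_chart_dom[OF c(1)] c(2)] t by auto
      define s where "s = max 0 (t - d / 2)"
      have s: "0 \<le> s" "s < t" using t False d by (auto simp: s_def)
      show ?thesis
        by (rule step[OF IH[OF s] c(1)]) (use s t d in \<open>auto simp: s_def intro!: d(2)\<close>)
    qed
  next
    fix t assume t: "0 \<le> t" "t < (1::real)" and IH: "\<And>s. 0 \<le> s \<Longrightarrow> s \<le> t \<Longrightarrow> P s"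
    obtain c where c: "c \<in> A" "g t \<in> chart_dom c" by (rule chart_cover)
    obtain d where d: "d > 0" "\<And>s. s \<in> {0..1} \<Longrightarrow> \<bar>s - t\<bar> < d \<Longrightarrow> g s \<in> chart_dom c"
      using continuous_on_real_nbhd[OF geodesicD(1)[OF g] _ open_chart_dom[OF c(1)] c(2)] t by auto
    have "P s" if "t < s" "s < t + d" "s \<le> 1" for s
      by (rule step[OF IH[OF t(1) order_refl] c(1)]) (use t that in \<open>auto intro!: d(2)\<close>)
    then show "\<exists>h>0. \<forall>s. t < s \<and> s < t + h \<and> s \<le> 1 \<longrightarrow> P s" using d by blast
  qed (use t in auto)
  then show ?thesis by (simp add: P_def)
qed

text \<open>Continuous dependence applied to the constant sequence \<open>h\<close>. Uniqueness is
  what makes the description in \<open>exp_map\<close> denote.\<close>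

lemma geodesic_unique:
  assumes "geo {0..1} g V" "geo {0..1} h W"
    and "h 0 = g 0" "W 0 = V 0" "t \<in> {0..1}"
  shows "h t = g t"
  using geodesic_dependence[OF assms(1), of "\<lambda>_. h" "\<lambda>_. W" t] assms(2-) by (simp add: LIMSEQ_const_iff)

lemma exp_map_eq:
  assumes "geo {0..1} g V"
  shows "Exp (g 0) (V 0) = g 1"
  unfolding exp_map_def
proof (rule the_equality)
  fix y assume "\<exists>h W. geo {0..1} h W \<and> h 0 = g 0 \<and> W 0 = V 0 \<and> h 1 = y"
  then obtain h W where "geo {0..1} h W" "h 0 = g 0" "W 0 = V 0" "h 1 = y" by blast
  with geodesic_unique[OF assms this(1-3), of 1] show "y = g 1" by simp
qed (use assms in blast)

lemma exp_map_tendsto: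
  assumes v: "v \<in> TS x" "\<And>n. u n \<in> TS x"
    and ex: "exp_defined A nabla x v" "\<And>n. exp_defined A nabla x (u n)"
    and c: "c \<in> A" "x \<in> chart_dom c" and lim: "(\<lambda>n. u n c) \<longlonglongrightarrow> v c"
  shows "(\<lambda>n. Exp x (u n)) \<longlonglongrightarrow> Exp x v"
proof -
  obtain g V where g: "geo {0..1} g V" "g 0 = x" "V 0 = v"
    using ex(1) unfolding exp_defined_def by blast
  have "\<forall>n. \<exists>h W. geo {0..1} h W \<and> h 0 = x \<and> W 0 = u n"
    using ex(2) unfolding exp_defined_def by blast
  then obtain h W where h: "\<And>n. geo {0..1} (h n) (W n)" "\<And>n. h n 0 = x" "\<And>n. W n 0 = u n"
    by metis
  have "(\<lambda>n. h n 1) \<longlonglongrightarrow> g 1"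
  proof (rule geodesic_dependence[OF g(1) h(1)])
    fix d assume "d \<in> A" "g 0 \<in> chart_dom d"
    then show "(\<lambda>n. W n 0 d) \<longlonglongrightarrow> V 0 d"
      using tangent_tendsto[where x="\<lambda>_. x" and u=u and d=d, OF tendsto_const _ v(1) c lim] v(2) g h by simp
  qed (use g h in auto)
  then show ?thesis using exp_map_eq[OF g(1)] exp_map_eq[OF h(1)] g h by simp
qed

lemma exp_map_zero: "Exp x (\<lambda>c. 0) = x"
proof -
  have "geo {0..1} (\<lambda>_. x) (\<lambda>_ _. 0)"
    using linear_0[OF linear_christoffel(1)]
    by (auto simp: geodesic_with_velocity_def curve_velocity_def parallel_along_def comp_def
        has_vector_derivative_const)
  from exp_map_eq[OF this] show ?thesis .
qed

end

section \<open>Self-concordant functions along geodesics\<close>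

lemma has_vector_derivative_compose:
  assumes "(y has_vector_derivative v) (at t within I)" "(\<phi> has_derivative \<phi>') (at (y t))"
  shows "((\<lambda>s. \<phi> (y s)) has_vector_derivative \<phi>' v) (at t within I)"
  using has_derivative_compose[OF assms(1)[unfolded has_vector_derivative_def] assms(2)]
    linear_cmul[OF has_derivative_linear[OF assms(2)]]
  by (simp add: has_vector_derivative_def)

context C3_function
begin

lemma hess_tangent_simps:
  assumes x: "x \<in> C"
    and u: "u \<in> TS x" "v \<in> TS x" "w \<in> TS x"
  shows "H x u w = H x w u"
    "H x (\<lambda>d. a *\<^sub>R u d + b *\<^sub>R v d) w = a * H x u w + b * H x v w"
proof -
  obtain c where c: "c \<in> A" "x \<in> chart_dom c" by (rule chart_cover)
  note sf = sym_form_hess[OF c(1), of "chart_map c x"]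
  have y: "chart_map c x \<in> dom c" using c x by auto
  show "H x u w = H x w u"
    using hessian_chart[OF c x] u sym_form_sym[OF sf[OF y]] by metis
  show "H x (\<lambda>d. a *\<^sub>R u d + b *\<^sub>R v d) w = a * H x u w + b * H x v w"
    using hessian_chart[OF c x tangent_combo[OF u(1,2)] u(3), of a b] hessian_chart[OF c x u(1,3)] hessian_chart[OF c x u(2,3)]
    by (simp add: sym_form_simps[OF sf[OF y]])
qed

context
  fixes I g V t c
  assumes g: "geo I g V" and gC: "g ` I \<subseteq> C"
    and t: "t \<in> I" and c: "c \<in> A" "g t \<in> chart_dom c"
begin

lemma chart_eventually: "\<forall>\<^sub>F s in at t within I. s \<in> I \<and> g s \<in> C \<and> g s \<in> chart_dom c"
proof -
  obtain d where "d > 0" "\<And>s. s \<in> I \<Longrightarrow> \<bar>s - t\<bar> < d \<Longrightarrow> g s \<in> chart_dom c"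
    using continuous_on_real_nbhd[OF geodesicD(1)[OF g] t open_chart_dom[OF c(1)] c(2)] by blast
  then show ?thesis using gC unfolding eventually_at by (intro exI[of _ d]) (auto simp: dist_real_def)
qed

lemma dom_eventually: "\<forall>\<^sub>F s in at t within I. chart_map c (g s) \<in> dom c"
  using chart_eventually by eventually_elim blast

lemma dom_at: "chart_map c (g t) \<in> dom c"
  using gC t c by auto

lemma f_along:
  "((\<lambda>s. f (g s)) has_real_derivative df c (chart_map c (g t)) (V t c)) (at t within I)"
proof -
  have "((\<lambda>s. (f \<circ> chart_inv c) (chart_map c (g s))) has_vector_derivative df c (chart_map c (g t)) (V t c)) (at t within I)"
    by (rule has_vector_derivative_compose[OF geodesicD(3)[OF g t c] f_has_derivative[OF c(1) dom_at]])
  then have "((\<lambda>s. f (g s)) has_vector_derivative df c (chart_map c (g t)) (V t c)) (at t within I)"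
    unfolding has_vector_derivative_def
    by (rule has_derivative_transform_eventually)
      (use chart_eventually t c in \<open>auto elim: eventually_mono\<close>)
  then show ?thesis by (simp add: has_real_derivative_iff_has_vector_derivative)
qed

text \<open>The sum \<open>u' + christoffel A nabla c (g t) (V t c) (u t)\<close> is the covariant
  derivative of \<open>u\<close> along \<open>g\<close>; the Christoffel term in it balances the one
  inside \<open>hess\<close>. It vanishes for the velocity of a geodesic.\<close>

lemma df_along:
  assumes u: "(u has_vector_derivative u') (at t within I)"
  shows "((\<lambda>s. df c (chart_map c (g s)) (u s)) has_vector_derivative
    hess c (chart_map c (g t)) (V t c) (u t)
      + df c (chart_map c (g t)) (u' + christoffel A nabla c (g t) (V t c) (u t))) (at t within I)"
proof -
  let ?y = "chart_map c (g t)"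
  have "((\<lambda>s. df c (chart_map c (g s)) (u s)) has_vector_derivative
    (fd (\<lambda>y. df c y (u t)) ?y (V t c) + df c ?y u')) (at t within I)"
    by (rule has_vector_derivative_linear_family[OF t eventually_mono[OF dom_eventually linear_df[OF c(1)]]
        linear_df[OF c(1) dom_at]
        has_vector_derivative_compose[OF geodesicD(3)[OF g t c] df_has_derivative[OF c(1) dom_at]] u])
  then show ?thesis
    using c by (simp add: hess_def linear_add[OF linear_df[OF c(1) dom_at]])
qed

text \<open>Stated for arbitrary coordinate vectors and not just for the velocity, because the
  support function for the Newton step uses constant ones.\<close>

lemma hess_along:
  assumes u: "(u has_vector_derivative u') (at t within I)" and w: "(w has_vector_derivative w') (at t within I)"
  shows "((\<lambda>s. hess c (chart_map c (g s)) (u s) (w s)) has_vector_derivative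
    dhess c (chart_map c (g t)) (V t c) (u t) (w t)
      + hess c (chart_map c (g t)) (u' + christoffel A nabla c (g t) (V t c) (u t)) (w t)
      + hess c (chart_map c (g t)) (u t) (w' + christoffel A nabla c (g t) (V t c) (w t))) (at t within I)"
proof -
  let ?y = "chart_map c (g t)"
  note sf = sym_form_hess[OF c(1)]
  have lin: "linear (h u)" "linear (\<lambda>u. h u (w::'e))" if "sym_form h" for u w and h :: "'e \<Rightarrow> 'e \<Rightarrow> real"
    using that by (auto simp: sym_form_def linear_iff)
  have 1: "((\<lambda>s. hess c (chart_map c (g s)) z (w s)) has_vector_derivative
      (fd (\<lambda>y. hess c y z (w t)) ?y (V t c) + hess c ?y z w')) (at t within I)" for z
    by (rule has_vector_derivative_linear_family[OF t eventually_mono[OF dom_eventually lin(1)[OF sf]]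
        lin(1)[OF sf[OF dom_at]]
        has_vector_derivative_compose[OF geodesicD(3)[OF g t c] hess_has_derivative[OF c(1) dom_at]] w])
  have "((\<lambda>s. hess c (chart_map c (g s)) (u s) (w s)) has_vector_derivative
      (fd (\<lambda>y. hess c y (u t) (w t)) ?y (V t c) + hess c ?y (u t) w') + hess c ?y u' (w t)) (at t within I)"
    by (rule has_vector_derivative_linear_family[where L="\<lambda>s u. hess c (chart_map c (g s)) u (w s)",
        OF t eventually_mono[OF dom_eventually lin(2)[OF sf]] lin(2)[OF sf[OF dom_at]] 1 u])
  then show ?thesis
    using c by (simp add: dhess_def sym_form_simps[OF sf[OF dom_at]] algebra_simps)
qed

end

section \<open>The first three derivatives of \<open>f\<close> along a geodesic\<close>

context
  fixes I g V t
  assumes g: "geo I g V" and gC: "g ` I \<subseteq> C" and t: "t \<in> I"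
begin

lemma velocity_tangent: "V t \<in> TS (g t)"
  by (rule geodesicD(2)[OF g t])

lemma f_geodesic:
  "((\<lambda>s. f (g s)) has_real_derivative D (g t) (V t)) (at t within I)"
proof -
  obtain c where c: "c \<in> A" "g t \<in> chart_dom c" by (rule chart_cover)
  have "g t \<in> C" using gC t by auto
  then show ?thesis
    using f_along[OF g gC t c] differential_f[OF c(1) _ c(2) velocity_tangent] by simp
qed

lemma differential_geodesic:
  "((\<lambda>s. D (g s) (V s)) has_real_derivative H (g t) (V t) (V t)) (at t within I)"
proof -
  obtain c where c: "c \<in> A" "g t \<in> chart_dom c" by (rule chart_cover)
  have gt: "g t \<in> C" using gC t by auto
  have "((\<lambda>s. df c (chart_map c (g s)) (V s c)) has_vector_derivative H (g t) (V t) (V t)) (at t within I)"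
    using df_along[OF g gC t c geodesicD(4)[OF g t c]] hessian_chart[OF c gt velocity_tangent velocity_tangent]
    by (simp add: linear_0[OF linear_df[OF c(1) dom_at[OF g gC t c]]])
  then have "((\<lambda>s. D (g s) (V s)) has_vector_derivative H (g t) (V t) (V t)) (at t within I)"
    unfolding has_vector_derivative_def
  proof (rule has_derivative_transform_eventually[OF _ _ _ t])
    show "\<forall>\<^sub>F s in at t within I. df c (chart_map c (g s)) (V s c) = D (g s) (V s)"
      using chart_eventually[OF g gC t c]
      by eventually_elim (simp add: differential_f[OF c(1) _ _ geodesicD(2)[OF g]])
  qed (simp add: differential_f[OF c(1) gt c(2) velocity_tangent])
  then show ?thesis by (simp add: has_real_derivative_iff_has_vector_derivative)
qed

lemma hessian_geodesic:
  "((\<lambda>s. H (g s) (V s) (V s)) has_real_derivative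
    DH (g t) (V t) (V t) (V t)) (at t within I)"
proof -
  obtain c where c: "c \<in> A" "g t \<in> chart_dom c" by (rule chart_cover)
  have gt: "g t \<in> C" using gC t by auto
  have "((\<lambda>s. hess c (chart_map c (g s)) (V s c) (V s c)) has_vector_derivative
      DH (g t) (V t) (V t) (V t)) (at t within I)"
    using hess_along[OF g gC t c geodesicD(4)[OF g t c] geodesicD(4)[OF g t c]]
      cov_deriv_hessian_chart[OF c gt velocity_tangent velocity_tangent velocity_tangent]
    by (simp add: sym_form_simps[OF sym_form_hess[OF c(1) dom_at[OF g gC t c]]])
  then have "((\<lambda>s. H (g s) (V s) (V s)) has_vector_derivative
      DH (g t) (V t) (V t) (V t)) (at t within I)"
    unfolding has_vector_derivative_def
  proof (rule has_derivative_transform_eventually[OF _ _ _ t])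
    show "\<forall>\<^sub>F s in at t within I. hess c (chart_map c (g s)) (V s c) (V s c) = H (g s) (V s) (V s)"
      using chart_eventually[OF g gC t c]
      by eventually_elim (simp add: hessian_chart[OF c(1) _ _ geodesicD(2)[OF g] geodesicD(2)[OF g]])
  qed (simp add: hessian_chart[OF c gt velocity_tangent velocity_tangent])
  then show ?thesis by (simp add: has_real_derivative_iff_has_vector_derivative)
qed

end

end

locale self_concordant_function = affine_manifold A nabla
  for A :: "('m::{t2_space,second_countable_topology}, 'e::euclidean_space) chart set" and nabla +
  fixes C :: "'m set" and f :: "'m \<Rightarrow> real" and \<sigma> :: real
  assumes open_C: "open C" and convex_C: "geodesically_convex A nabla C"
    and sc: "self_concordant A nabla C \<sigma> f"
    and exp_def: "v \<in> TS p \<Longrightarrow> exp_defined A nabla p v"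
    and exp_surj: "Exp p ` TS p = UNIV"
begin

sublocale C3_function A nabla C f
  using open_C sc by unfold_locales (simp_all add: self_concordant_def)

abbreviation nrm where "nrm \<equiv> local_norm A nabla f"
abbreviation newton where "newton \<equiv> newton_direction A nabla f"
abbreviation decr where "decr \<equiv> newton_decrement A nabla f"

lemma sigma_nonneg: "\<sigma> \<ge> 0"
  using sc by (simp add: self_concordant_def)

lemma pos_form_hess:
  assumes c: "c \<in> A" and y: "y \<in> dom c"
  shows "pos_form (hess c y)"
  unfolding pos_form_def
proof (intro conjI allI impI sym_form_hess[OF assms])
  fix u :: 'e assume "u \<noteq> 0"
  obtain x where x: "x \<in> C" "x \<in> chart_dom c" "y = chart_map c x" using y by blast
  let ?u = "E c x u"
  have "?u \<noteq> (\<lambda>c. 0)" using \<open>u \<noteq> 0\<close> chart_tangent_self[OF c x(2), of u] by metis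
  then have "H x ?u ?u > 0"
    using sc x c chart_tangent_mem[OF c x(2)] unfolding self_concordant_def nondegenerate_def by blast
  then show "hess c y u u > 0"
    using hessian_chart[OF c x(2,1) chart_tangent_mem[OF c x(2)] chart_tangent_mem[OF c x(2)]] c x by simp
qed

text \<open>Self-concordance bounds the form on the diagonal; polarization with \<open>hess\<close>
  as inner product extends it to mixed arguments with the same constant. The Newton estimate needs
  it for the velocity paired with the residual vector.\<close>

lemma dhess_bound:
  assumes c: "c \<in> A" and y: "y \<in> dom c"
  shows "\<bar>dhess c y v u w\<bar> \<le> 2 * \<sigma> * sqrt (hess c y v v) * sqrt (hess c y u u) * sqrt (hess c y w w)"
proof (rule sym_form_polarization_bound[OF pos_form_hess[OF assms] sym_form_dhess[OF assms]])
  fix u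
  obtain x where x: "x \<in> C" "x \<in> chart_dom c" "y = chart_map c x" using y by blast
  let ?u = "E c x u" and ?v = "E c x v"
  have T: "?u \<in> TS x" "?v \<in> TS x" using chart_tangent_mem[OF c x(2)] by auto
  have "\<bar>DH x ?v ?u ?u\<bar> \<le> 2 * \<sigma> * sqrt (H x ?v ?v) * H x ?u ?u"
    using sc x(1) T unfolding self_concordant_def by blast
  then show "\<bar>dhess c y v u u\<bar> \<le> 2 * \<sigma> * sqrt (hess c y v v) * hess c y u u"
    using hessian_chart[OF c x(2,1)] cov_deriv_hessian_chart[OF c x(2,1)] T c x by simp
qed

lemma H_nonneg: "x \<in> C \<Longrightarrow> u \<in> TS x \<Longrightarrow> H x u u \<ge> 0"
proof -
  assume a: "x \<in> C" "u \<in> TS x"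
  obtain c where c: "c \<in> A" "x \<in> chart_dom c" by (rule chart_cover)
  show ?thesis using hessian_chart[OF c a(1,2,2)] pos_form_nonneg[OF pos_form_hess[OF c(1)]] a c by auto
qed

lemma nrm_nonneg: "x \<in> C \<Longrightarrow> u \<in> TS x \<Longrightarrow> nrm x u \<ge> 0"
  by (simp add: local_norm_def H_nonneg)

text \<open>Self-concordance with both arguments equal to the velocity: the derivative of
  \<open>H\<close> on the velocity is \<open>DH\<close> on three copies of it.\<close>

lemma speed_inequality:
  assumes g: "geo {a..b} g V" and gC: "g ` {a..b} \<subseteq> C"
    and st: "s \<in> {a..b}" "t \<in> {a..b}"
  shows "nrm (g s) (V s) - nrm (g t) (V t) \<le> \<sigma> * \<bar>s - t\<bar> * nrm (g s) (V s) * nrm (g t) (V t)"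
  unfolding local_norm_def
proof (rule self_concordant_real[OF hessian_geodesic[OF g gC] _ sigma_nonneg _ st])
  fix t assume t: "t \<in> {a..b}"
  then have gt: "g t \<in> C" "V t \<in> TS (g t)" using gC geodesicD(2)[OF g t] by auto
  then show "H (g t) (V t) (V t) \<ge> 0" by (rule H_nonneg)
  show "\<bar>DH (g t) (V t) (V t) (V t)\<bar> \<le> 2 * \<sigma> * sqrt (H (g t) (V t) (V t)) * H (g t) (V t) (V t)"
    using sc gt unfolding self_concordant_def by blast
qed

lemma speed_upper_bound:
  assumes g: "geo {0..b} g V" and gC: "g ` {0..b} \<subseteq> C" and t: "t \<in> {0..b}"
  shows "nrm (g t) (V t) * (1 - \<sigma> * nrm (g 0) (V 0) * t) \<le> nrm (g 0) (V 0)"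
  using speed_inequality[OF g gC t, of 0] t by (simp add: algebra_simps)

text \<open>The Dikin ellipsoid property: along the geodesic \<open>f\<close> stays bounded, so that a first exit
  point would contradict closedness of the epigraph.\<close>

lemma geodesic_stays:
  assumes g: "geo {0..1} g V" and g0: "g 0 \<in> C" and r: "\<sigma> * nrm (g 0) (V 0) < 1"
    and t: "t \<in> {0..1}"
  shows "g t \<in> C"
proof (rule interval_induct[of 0 t 1])
  define r where "r = nrm (g 0) (V 0)"
  have r0: "r \<ge> 0" unfolding r_def using geodesicD(2)[OF g, of 0] g0 by (intro nrm_nonneg) auto
  \<comment> \<open>Bound for the speed on the whole interval, from \<open>speed_upper_bound\<close>
    and \<open>t \<le> 1\<close>.\<close>
  define \<rho> where "\<rho> = r / (1 - \<sigma> * r)"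
  have ar: "\<sigma> * r < 1" using assms by (simp add: r_def)
  \<comment> \<open>The square of \<rho> bounds the second derivative of \<open>f\<close> along the
    curve; integrating twice over length at most 1 gives this height.\<close>
  define B where "B = f (g 0) + \<bar>D (g 0) (V 0)\<bar> + \<rho>\<^sup>2"
  have bounded: "f (g s) \<le> B" if s: "0 \<le> s" "s \<le> 1" and sC: "g ` {0..s} \<subseteq> C" for s
  proof -
    have gs: "geo {0..s} g V" using geodesic_subset[OF g] s by simp
    have q: "H (g t) (V t) (V t) \<le> \<rho>\<^sup>2" if t: "t \<in> {0..s}" for t
    proof -
      have gt: "g t \<in> C" "V t \<in> TS (g t)" using sC geodesicD(2)[OF gs t] t by auto
      have "\<sigma> * r * t \<le> \<sigma> * r * 1" using t s r0 sigma_nonneg by (intro mult_left_mono) auto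
      then have "nrm (g t) (V t) * (1 - \<sigma> * r) \<le> nrm (g t) (V t) * (1 - \<sigma> * r * t)"
        using nrm_nonneg[OF gt] by (intro mult_left_mono) auto
      also have "\<dots> \<le> r" using speed_upper_bound[OF gs sC t] by (simp add: r_def)
      finally have "nrm (g t) (V t) \<le> \<rho>" using ar by (simp add: \<rho>_def pos_le_divide_eq)
      then have "(nrm (g t) (V t))\<^sup>2 \<le> \<rho>\<^sup>2" using nrm_nonneg[OF gt] by (intro power_mono)
      then show ?thesis using H_nonneg[OF gt] by (simp add: local_norm_def)
    qed
    have D: "D (g t) (V t) \<le> \<bar>D (g 0) (V 0)\<bar> + \<rho>\<^sup>2" if t: "t \<in> {0..s}" for t
    proof -
      have sub: "{0..t} \<subseteq> {0..s}" using t by auto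
      note gt = geodesic_subset[OF gs sub]
      have "D (g t) (V t) - \<rho>\<^sup>2 * t \<le> D (g 0) (V 0) - \<rho>\<^sup>2 * 0"
      proof (rule real_derivative_nonpos_imp_le[where g="\<lambda>t. D (g t) (V t) - \<rho>\<^sup>2 * t"])
        fix \<tau> assume \<tau>: "\<tau> \<in> {0..t}"
        show "((\<lambda>t. D (g t) (V t) - \<rho>\<^sup>2 * t) has_real_derivative H (g \<tau>) (V \<tau>) (V \<tau>) - \<rho>\<^sup>2) (at \<tau> within {0..t})"
          using sC sub by (auto intro!: derivative_eq_intros differential_geodesic[OF gt _ \<tau>])
        show "H (g \<tau>) (V \<tau>) (V \<tau>) - \<rho>\<^sup>2 \<le> 0" using q[of \<tau>] \<tau> t by auto
      qed (use t in auto)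
      moreover have "\<rho>\<^sup>2 * t \<le> \<rho>\<^sup>2 * 1" using t s by (intro mult_left_mono) auto
      ultimately show ?thesis by simp
    qed
    let ?b = "\<bar>D (g 0) (V 0)\<bar> + \<rho>\<^sup>2"
    have "f (g s) - ?b * s \<le> f (g 0) - ?b * 0"
    proof (rule real_derivative_nonpos_imp_le[where g="\<lambda>t. f (g t) - ?b * t"])
      fix \<tau> assume \<tau>: "\<tau> \<in> {0..s}"
      show "((\<lambda>t. f (g t) - ?b * t) has_real_derivative D (g \<tau>) (V \<tau>) - ?b) (at \<tau> within {0..s})"
        by (auto intro!: derivative_eq_intros f_geodesic[OF gs sC \<tau>])
      show "D (g \<tau>) (V \<tau>) - ?b \<le> 0" using D[OF \<tau>] by simp
    qed (use s in auto)
    moreover have "?b * s \<le> ?b * 1" using s by (intro mult_left_mono) auto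
    ultimately show ?thesis by (simp add: B_def)
  qed
  have epi: "closed {(x, y). x \<in> C \<and> y \<ge> f x}" using sc by (simp add: self_concordant_def closed_function_def)
  {
    fix t assume t: "0 \<le> t" "t \<le> (1::real)" and IH: "\<And>s. 0 \<le> s \<Longrightarrow> s < t \<Longrightarrow> g s \<in> C"
    show "g t \<in> C"
    proof (cases "t = 0")
      case True
      then show ?thesis using g0 by simp
    next
      case False
      let ?F = "at t within {0..<t}"
      have nt: "?F \<noteq> bot" using t False by (simp add: at_within_Ico_at_left)
      have "(g \<longlongrightarrow> g t) (at t within {0..1})" using geodesicD(1)[OF g] t by (auto simp: continuous_on_def)
      then have "(g \<longlongrightarrow> g t) ?F" by (rule tendsto_mono[rotated]) (use t in \<open>auto intro: at_le\<close>)
      \<comment> \<open>The height \<open>B\<close> is constant, so the approaching points lie in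
        the closed epigraph, and so does their limit; this puts \<open>g t\<close> into
        \<open>C\<close>.\<close>
      then have lim: "((\<lambda>s. (g s, B)) \<longlongrightarrow> (g t, B)) ?F" by (intro tendsto_intros)
      have "\<forall>\<^sub>F s in ?F. s \<in> {0..<t}" by (simp add: eventually_at_filter)
      then have "\<forall>\<^sub>F s in ?F. (g s, B) \<in> {(x, y). x \<in> C \<and> y \<ge> f x}"
      proof eventually_elim
        case (elim s)
        then have "g ` {0..s} \<subseteq> C" using IH by auto
        with bounded[of s] elim t show ?case by auto
      qed
      from Lim_in_closed_set[OF epi this nt lim] show ?thesis by simp
    qed
  }
  fix t assume t: "0 \<le> t" "t < (1::real)" and IH: "\<And>s. 0 \<le> s \<Longrightarrow> s \<le> t \<Longrightarrow> g s \<in> C"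
  obtain d where d: "d > 0" "\<And>s. s \<in> {0..1} \<Longrightarrow> \<bar>s - t\<bar> < d \<Longrightarrow> g s \<in> C"
    using continuous_on_real_nbhd[OF geodesicD(1)[OF g] _ open_C IH[OF t(1) order_refl]] t by auto
  show "\<exists>h>0. \<forall>s. t < s \<and> s < t + h \<and> s \<le> 1 \<longrightarrow> g s \<in> C"
    using d t by (intro exI[of _ d]) auto
qed (use t in auto)

text \<open>Strong monotonicity of \<open>Df\<close>, with the lower bound for \<open>f''\<close> read off at whichever
  endpoint has the larger speed.\<close>

lemma geodesic_length_bound:
  assumes g: "geo {0..1} g V" and gC: "g ` {0..1} \<subseteq> C"
    and l: "l\<^sub>0 \<ge> 0" "l\<^sub>1 \<ge> 0" "\<sigma> * (l\<^sub>0 + l\<^sub>1) < 1"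
    and D0: "\<bar>D (g 0) (V 0)\<bar> \<le> l\<^sub>0 * nrm (g 0) (V 0)" and D1: "\<bar>D (g 1) (V 1)\<bar> \<le> l\<^sub>1 * nrm (g 1) (V 1)"
  shows "nrm (g 0) (V 0) \<le> (l\<^sub>0 + l\<^sub>1) / (1 - \<sigma> * (l\<^sub>0 + l\<^sub>1))"
proof -
  define p where "p t = nrm (g t) (V t)" for t
  have p0: "p t \<ge> 0" if "t \<in> {0..1}" for t
    unfolding p_def using gC geodesicD(2)[OF g that] that by (intro nrm_nonneg) auto
  have H: "H (g t) (V t) (V t) = (p t)\<^sup>2" if "t \<in> {0..1}" for t
  proof -
    have "g t \<in> C" using gC that by blast
    from H_nonneg[OF this geodesicD(2)[OF g that]] show ?thesis by (simp add: p_def local_norm_def)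
  qed
  have ineq: "p s - p t \<le> \<sigma> * \<bar>s - t\<bar> * p s * p t" if "s \<in> {0..1}" "t \<in> {0..1}" for s t
    unfolding p_def by (rule speed_inequality[OF g gC that])
  note dD = differential_geodesic[OF g gC]
  have lower: "(p s / (1 + \<sigma> * p s * \<bar>s - t\<bar>))\<^sup>2 \<le> H (g t) (V t) (V t)" if s: "s \<in> {0..1}" and t: "t \<in> {0..1}" for s t
  proof -
    have pos: "1 + \<sigma> * p s * \<bar>s - t\<bar> > 0"
      using p0[OF s] sigma_nonneg by (intro add_pos_nonneg) auto
    have "p s \<le> p t * (1 + \<sigma> * p s * \<bar>s - t\<bar>)" using ineq[OF s t] by (simp add: algebra_simps)
    then have "p s / (1 + \<sigma> * p s * \<bar>s - t\<bar>) \<le> p t" using pos by (simp add: pos_divide_le_eq)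
    then show ?thesis unfolding H[OF t] using p0[OF s] pos by (intro power_mono) auto
  qed
  have pos: "1 + \<sigma> * p s * x > 0" if "s \<in> {0..1}" "x \<ge> 0" for s x
    using p0[OF that(1)] sigma_nonneg that by (intro add_pos_nonneg) auto
  have "(p 0)\<^sup>2 / (1 + \<sigma> * p 0) \<le> D (g 1) (V 1) - D (g 0) (V 0)"
  proof -
    \<comment> \<open>\<open>(p 0)\<^sup>2 * t / (1 + \<sigma> * p 0 * t)\<close> is the
      antiderivative, zero at 0, of the lower bound \<open>lower\<close> with
      \<open>s = 0\<close>.\<close>
    have "(p 0)\<^sup>2 * 1 / (1 + \<sigma> * p 0 * 1) - D (g 1) (V 1) \<le> (p 0)\<^sup>2 * 0 / (1 + \<sigma> * p 0 * 0) - D (g 0) (V 0)"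
    proof (rule real_derivative_nonpos_imp_le[where g="\<lambda>t. (p 0)\<^sup>2 * t / (1 + \<sigma> * p 0 * t) - D (g t) (V t)"])
      fix t :: real assume t: "t \<in> {0..1}"
      have nz: "1 + \<sigma> * p 0 * t \<noteq> 0" using pos[of 0 t] t by auto
      show "((\<lambda>t. (p 0)\<^sup>2 * t / (1 + \<sigma> * p 0 * t) - D (g t) (V t)) has_real_derivative
          (p 0 / (1 + \<sigma> * p 0 * \<bar>0 - t\<bar>))\<^sup>2 - H (g t) (V t) (V t)) (at t within {0..1})"
        using nz t by (auto intro!: derivative_eq_intros dD[OF t] simp: power_divide power2_eq_square)
          (simp add: algebra_simps)
      show "(p 0 / (1 + \<sigma> * p 0 * \<bar>0 - t\<bar>))\<^sup>2 - H (g t) (V t) (V t) \<le> 0" using lower[of 0 t] t by simp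
    qed simp
    then show ?thesis by simp
  qed
  moreover have "(p 1)\<^sup>2 / (1 + \<sigma> * p 1) \<le> D (g 1) (V 1) - D (g 0) (V 0)"
  proof -
    \<comment> \<open>The same seen from the other end: an antiderivative that is zero at 1, for the
      lower bound with \<open>s = 1\<close>.\<close>
    have "- ((p 1)\<^sup>2 * (1 - 1) / (1 + \<sigma> * p 1 * (1 - 1))) - D (g 1) (V 1) \<le> - ((p 1)\<^sup>2 * (1 - 0) / (1 + \<sigma> * p 1 * (1 - 0))) - D (g 0) (V 0)"
    proof (rule real_derivative_nonpos_imp_le[where g="\<lambda>t. - ((p 1)\<^sup>2 * (1 - t) / (1 + \<sigma> * p 1 * (1 - t))) - D (g t) (V t)"])
      fix t :: real assume t: "t \<in> {0..1}"
      have nz: "1 + \<sigma> * p 1 * (1 - t) \<noteq> 0" using pos[of 1 "1 - t"] t by auto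
      show "((\<lambda>t. - ((p 1)\<^sup>2 * (1 - t) / (1 + \<sigma> * p 1 * (1 - t))) - D (g t) (V t)) has_real_derivative
          (p 1 / (1 + \<sigma> * p 1 * \<bar>1 - t\<bar>))\<^sup>2 - H (g t) (V t) (V t)) (at t within {0..1})"
        using nz t by (auto intro!: derivative_eq_intros dD[OF t] simp: power_divide power2_eq_square)
          (simp add: algebra_simps)
      show "(p 1 / (1 + \<sigma> * p 1 * \<bar>1 - t\<bar>))\<^sup>2 - H (g t) (V t) (V t) \<le> 0" using lower[of 1 t] t by simp
    qed simp
    then show ?thesis by simp
  qed
  \<comment> \<open>With the larger speed both the lower and the upper bound for the increase of
    \<open>D\<close> depend on \<open>m\<close> alone, although the upper bound involves the speeds
    at both ends.\<close>
  moreover define m where "m = max (p 0) (p 1)"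
  ultimately have "m\<^sup>2 / (1 + \<sigma> * m) \<le> D (g 1) (V 1) - D (g 0) (V 0)" by (simp add: max_def)
  also have "\<dots> \<le> l\<^sub>1 * p 1 + l\<^sub>0 * p 0" using D0 D1 by (simp add: p_def)
  also have "\<dots> \<le> l\<^sub>1 * m + l\<^sub>0 * m" using l by (intro add_mono mult_left_mono) (auto simp: m_def)
  finally have le: "m\<^sup>2 / (1 + \<sigma> * m) \<le> (l\<^sub>0 + l\<^sub>1) * m" by (simp add: algebra_simps)
  have m0: "m \<ge> 0" using p0[of 0] by (simp add: m_def le_max_iff_disj)
  then have "1 + \<sigma> * m > 0" using sigma_nonneg by (intro add_pos_nonneg) auto
  with le have "m * m \<le> m * ((l\<^sub>0 + l\<^sub>1) * (1 + \<sigma> * m))"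
    by (simp add: pos_divide_le_eq power2_eq_square mult_ac)
  then have "m = 0 \<or> m \<le> (l\<^sub>0 + l\<^sub>1) * (1 + \<sigma> * m)" using m0 by (auto simp: mult_le_cancel_left)
  then have "m \<le> (l\<^sub>0 + l\<^sub>1) * (1 + \<sigma> * m)" using l by auto
  then have "m * (1 - \<sigma> * (l\<^sub>0 + l\<^sub>1)) \<le> l\<^sub>0 + l\<^sub>1" by (simp add: algebra_simps)
  then have "m \<le> (l\<^sub>0 + l\<^sub>1) / (1 - \<sigma> * (l\<^sub>0 + l\<^sub>1))" using l by (simp add: pos_le_divide_eq)
  then show ?thesis by (simp add: m_def p_def)
qed

end

section \<open>The Newton step\<close>

context self_concordant_function
begin

abbreviation xplus where "xplus \<equiv> newton_step A nabla f"

text \<open>\<open>pos_form_riesz\<close> solves the equation in a chart and definiteness makes the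
  solution unique, so the description of the Newton direction denotes.\<close>

lemma newton_properties:
  assumes x: "x \<in> C"
  shows newton_tangent: "newton x \<in> TS x"
    and newton_equation: "w \<in> TS x \<Longrightarrow> D x w + H x (newton x) w = 0"
proof -
  obtain c where c: "c \<in> A" "x \<in> chart_dom c" by (rule chart_cover)
  let ?y = "chart_map c x"
  have y: "?y \<in> dom c" using c x by auto
  note pf = pos_form_hess[OF c(1) y] and lin = linear_df[OF c(1) y]
  obtain n where n: "\<And>w. hess c ?y n w = - df c ?y w"
    using pos_form_riesz[OF pf linear_compose_neg[OF lin]] by blast
  let ?n = "E c x n"
  have eq: "D x w + H x u w = df c ?y (w c) + hess c ?y (u c) (w c)"
    if "u \<in> TS x" "w \<in> TS x" for u w
    using hessian_chart[OF c x that] differential_f[OF c(1) x c(2) that(2)] by simp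
  have "newton x = ?n"
    unfolding newton_direction_def
  proof (rule the_equality)
    show "?n \<in> TS x \<and> (\<forall>w\<in>TS x. D x w + H x ?n w = 0)"
      using eq[of ?n] n c by simp
    fix u assume u: "u \<in> TS x \<and> (\<forall>w\<in>TS x. D x w + H x u w = 0)"
    have "hess c ?y (u c) w = hess c ?y n w" for w
      using u eq[of u "E c x w"] chart_tangent_mem[OF c, of w] n[of w] c by auto
    then have "u c = n" by (rule pos_form_unique[OF pf])
    then show "u = ?n" using u c by (intro tangent_eqI[OF _ _ c]) auto
  qed
  then show "newton x \<in> TS x" "w \<in> TS x \<Longrightarrow> D x w + H x (newton x) w = 0"
    using eq[of ?n] n c by auto
qed

lemma H_Cauchy:
  assumes x: "x \<in> C" and u: "u \<in> TS x" "w \<in> TS x"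
  shows "\<bar>H x u w\<bar> \<le> nrm x u * nrm x w"
proof -
  obtain c where c: "c \<in> A" "x \<in> chart_dom c" by (rule chart_cover)
  have y: "chart_map c x \<in> dom c" using c x by auto
  show ?thesis
    using pos_form_Cauchy[OF pos_form_hess[OF c(1) y]] hessian_chart[OF c x] u by (simp add: local_norm_def)
qed

lemma decr_nonneg: "x \<in> C \<Longrightarrow> decr x \<ge> 0"
  by (simp add: newton_decrement_def nrm_nonneg newton_tangent)

lemma differential_le_decr:
  assumes "x \<in> C" "w \<in> TS x"
  shows "\<bar>D x w\<bar> \<le> decr x * nrm x w"
proof -
  have "\<bar>D x w\<bar> = \<bar>H x (newton x) w\<bar>" using newton_equation[OF assms] by linarith
  also have "\<dots> \<le> decr x * nrm x w"
    unfolding newton_decrement_def by (rule H_Cauchy[OF assms(1) newton_tangent[OF assms(1)] assms(2)])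
  finally show ?thesis .
qed

text \<open>Tested with the Newton direction itself. Together with
  \<open>differential_le_decr\<close> this identifies the decrement as the dual norm of
  \<open>D x\<close>.\<close>

lemma decr_le:
  assumes x: "x \<in> C" and L: "L \<ge> 0" "\<And>w. w \<in> TS x \<Longrightarrow> \<bar>D x w\<bar> \<le> L * nrm x w"
  shows "decr x \<le> L"
proof -
  note n = newton_tangent[OF x]
  have "(decr x)\<^sup>2 = H x (newton x) (newton x)"
    by (simp add: newton_decrement_def local_norm_def H_nonneg[OF x n])
  also have "\<dots> \<le> \<bar>D x (newton x)\<bar>" using newton_equation[OF x n] by simp
  also have "\<dots> \<le> L * decr x" using L(2)[OF n] by (simp add: newton_decrement_def)
  finally have "decr x * decr x \<le> L * decr x" by (simp add: power2_eq_square)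
  then show ?thesis using decr_nonneg[OF x] L(1) by (cases "decr x = 0") (auto simp: mult_le_cancel_right)
qed

section \<open>The residual covector along the Newton geodesic\<close>

lemma exp_geodesic:
  assumes "v \<in> TS x"
  obtains g V where "geo {0..1} g V" "g 0 = x" "V 0 = v" "g 1 = Exp x v"
proof -
  obtain g V where "geo {0..1} g V" "g 0 = x" "V 0 = v"
    using exp_def[OF assms] unfolding exp_defined_def by blast
  then show thesis using that exp_map_eq by metis
qed

text \<open>\<open>restform\<close> is the covector \<open>\<alpha>\<^sub>t = Df + (1 - t) Hf(\<gamma>', \<cdot>)\<close> in a chart, and \<open>rest\<close> its Riesz vector.\<close>

definition rest :: "(real \<Rightarrow> 'm) \<Rightarrow> (real \<Rightarrow> ('m, 'e) tvec) \<Rightarrow> real \<Rightarrow> ('m, 'e) tvec" where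
  "rest g V t = (\<lambda>d. (1 - t) *\<^sub>R V t d - newton (g t) d)"

definition restform :: "(real \<Rightarrow> 'm) \<Rightarrow> (real \<Rightarrow> ('m, 'e) tvec) \<Rightarrow> ('m, 'e) chart \<Rightarrow> real \<Rightarrow> 'e \<Rightarrow> real" where
  "restform g V c t w = (1 - t) * hess c (chart_map c (g t)) (V t c) w + df c (chart_map c (g t)) w"

lemma rest_tangent:
  assumes "V t \<in> TS (g t)" "g t \<in> C"
  shows "rest g V t \<in> TS (g t)"
  using tangent_combo[OF assms(1) newton_tangent[OF assms(2)], of "1 - t" "-1"] by (simp add: rest_def)

lemma rest_riesz:
  assumes V: "V t \<in> TS (g t)" and gt: "g t \<in> C" and c: "c \<in> A" "g t \<in> chart_dom c"
  shows "hess c (chart_map c (g t)) (rest g V t c) w = restform g V c t w"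
proof -
  have sf: "sym_form (hess c (chart_map c (g t)))" using gt c by (intro sym_form_hess) auto
  let ?w = "E c (g t) w"
  have T: "?w \<in> TS (g t)" using c by simp
  have "hess c (chart_map c (g t)) (newton (g t) c) w = - df c (chart_map c (g t)) w"
    using newton_equation[OF gt T] differential_f[OF c(1) gt c(2) T]
      hessian_chart[OF c gt newton_tangent[OF gt] T] c by simp
  then show ?thesis by (simp add: rest_def restform_def sym_form_simps[OF sf])
qed

lemma rest_norm:
  assumes V: "V t \<in> TS (g t)" and gt: "g t \<in> C" and c: "c \<in> A" "g t \<in> chart_dom c"
  shows "(nrm (g t) (rest g V t))\<^sup>2 = hess c (chart_map c (g t)) (rest g V t c) (rest g V t c)"
  using hessian_chart[OF c gt rest_tangent[of V t g, OF V gt] rest_tangent[of V t g, OF V gt]]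
    H_nonneg[OF gt rest_tangent[of V t g, OF V gt]] by (simp add: local_norm_def)

text \<open>Provides the maximum used in \<open>newton_estimate\<close>. The Newton direction is
  known only through its equation, so continuity comes from \<open>riesz_tendsto\<close>, the form
  and the covector being continuous along the curve.\<close>

lemma continuous_on_rest_norm:
  assumes g: "geo {0..1} g V" and gC: "g ` {0..1} \<subseteq> C"
  shows "continuous_on {0..1} (\<lambda>t. nrm (g t) (rest g V t))"
  unfolding continuous_on_def
proof
  fix t :: real assume t: "t \<in> {0..1}"
  let ?F = "at t within {0..1}"
  define U where "U = rest g V"
  obtain c where c: "c \<in> A" "g t \<in> chart_dom c" by (rule chart_cover)
  define h where "h s = hess c (chart_map c (g s))" for s
  define \<alpha> where "\<alpha> = restform g V c"
  note ev = chart_eventually[OF g gC t c] and y = dom_at[OF g gC t c]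
  have riesz: "h s (U s c) w = \<alpha> s w" if s: "s \<in> {0..1}" "g s \<in> C" "g s \<in> chart_dom c" for s w
    using rest_riesz[of V s g c w, OF geodesicD(2)[OF g s(1)] s(2) c(1) s(3)] by (simp add: h_def \<alpha>_def U_def)
  have nrmU: "nrm (g s) (U s) = sqrt (\<alpha> s (U s c))" if s: "s \<in> {0..1}" "g s \<in> C" "g s \<in> chart_dom c" for s
    using rest_norm[of V s g c, OF geodesicD(2)[OF g s(1)] s(2) c(1) s(3)] riesz[OF s, of "U s c"]
      nrm_nonneg[OF s(2) rest_tangent[of V s g, OF geodesicD(2)[OF g s(1)] s(2)]]
    by (simp add: h_def U_def real_sqrt_unique[symmetric])
  have gt: "t \<in> {0..1}" "g t \<in> C" "g t \<in> chart_dom c" using gC t c by auto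
  have lin\<alpha>: "linear (\<alpha> s)" if "chart_map c (g s) \<in> dom c" for s
    using sym_form_simps[OF sym_form_hess[OF c(1) that]] linear_df[OF c(1) that]
    by (auto simp: \<alpha>_def restform_def linear_iff algebra_simps)
  have lim\<alpha>: "((\<lambda>s. \<alpha> s w) \<longlongrightarrow> \<alpha> t w) ?F" for w
  proof -
    have "((\<lambda>s. df c (chart_map c (g s)) w) \<longlongrightarrow> df c (chart_map c (g t)) w) ?F"
      using has_vector_derivative_continuous[OF df_along[OF g gC t c has_vector_derivative_const[of w]]]
      by (simp add: continuous_within)
    moreover have "((\<lambda>s. h s (V s c) w) \<longlongrightarrow> h t (V t c) w) ?F"
      using has_vector_derivative_continuous[OF hess_along[OF g gC t c geodesicD(4)[OF g t c] has_vector_derivative_const[of w]]]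
      by (simp add: continuous_within h_def)
    ultimately show ?thesis unfolding \<alpha>_def restform_def h_def by (intro tendsto_intros)
  qed
  have limU: "((\<lambda>s. U s c) \<longlongrightarrow> U t c) ?F"
  proof (rule riesz_tendsto)
    show "pos_form (h t)" unfolding h_def by (rule pos_form_hess[OF c(1) y])
    show "\<forall>\<^sub>F s in ?F. sym_form (h s)"
      unfolding h_def by (rule eventually_mono[OF dom_eventually[OF g gC t c] sym_form_hess[OF c(1)]])
    show "((\<lambda>s. h s u w) \<longlongrightarrow> h t u w) ?F" for u w
      using has_vector_derivative_continuous[OF hess_along[OF g gC t c has_vector_derivative_const[of u] has_vector_derivative_const[of w]]]
      by (simp add: continuous_within h_def)
    show "((\<lambda>s. \<alpha> s w) \<longlongrightarrow> \<alpha> t w) ?F" for w by (rule lim\<alpha>)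
    show "\<forall>\<^sub>F s in ?F. \<forall>w. h s (U s c) w = \<alpha> s w"
      using ev by eventually_elim (use riesz in blast)
    show "h t (U t c) w = \<alpha> t w" for w by (rule riesz[OF gt])
  qed
  have "((\<lambda>s. \<alpha> s (U s c)) \<longlongrightarrow> \<alpha> t (U t c)) ?F"
    by (rule linear_family_tendsto[OF eventually_mono[OF dom_eventually[OF g gC t c] lin\<alpha>] lin\<alpha>[OF y] lim\<alpha> limU])
  then have "((\<lambda>s. sqrt (\<alpha> s (U s c))) \<longlongrightarrow> nrm (g t) (U t)) ?F"
    unfolding nrmU[OF gt] by (rule tendsto_real_sqrt)
  moreover have "\<forall>\<^sub>F s in ?F. sqrt (\<alpha> s (U s c)) = nrm (g s) (U s)"
    using ev by eventually_elim (use nrmU in auto)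
  ultimately have "((\<lambda>s. nrm (g s) (U s)) \<longlongrightarrow> nrm (g t) (U t)) ?F"
    by (rule Lim_transform_eventually)
  then show "((\<lambda>t. nrm (g t) (rest g V t)) \<longlongrightarrow> nrm (g t) (rest g V t)) ?F"
    by (simp add: U_def)
qed

text \<open>Instead of differentiating the Riesz vector \<open>U\<close> or transporting vectors in parallel, its
  squared norm is touched from below at \<open>t\<close> by \<open>2 \<alpha>\<^sub>s(W) - Hf\<^sub>s(W, W)\<close> with \<open>W\<close> the constant
  extension of \<open>U(t)\<close> in a chart; the Christoffel terms of its derivative cancel.\<close>

lemma newton_support_function:
  assumes g: "geo {0..1} g V" and gC: "g ` {0..1} \<subseteq> C" and t: "t \<in> {0..1}"
    and U_def: "U = rest g V"
  obtains F F' where "(F has_real_derivative F') (at t within {0..1})" "F t = (nrm (g t) (U t))\<^sup>2"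
    "\<forall>\<^sub>F s in at t within {0..1}. F s \<le> (nrm (g s) (U s))\<^sup>2"
    "F' \<le> 4 * (1 - t) * \<sigma> * (nrm (g t) (V t))\<^sup>2 * nrm (g t) (U t) + 2 * \<sigma> * nrm (g t) (V t) * (nrm (g t) (U t))\<^sup>2"
proof -
  let ?F = "at t within {0..1}"
  obtain c where c: "c \<in> A" "g t \<in> chart_dom c" by (rule chart_cover)
  define h where "h s = hess c (chart_map c (g s))" for s
  define \<alpha> where "\<alpha> = restform g V c"
  note ev = chart_eventually[OF g gC t c] and y = dom_at[OF g gC t c]
  have riesz: "h s (U s c) w = \<alpha> s w" if s: "s \<in> {0..1}" "g s \<in> C" "g s \<in> chart_dom c" for s w
    using rest_riesz[of V s g c w, OF geodesicD(2)[OF g s(1)] s(2) c(1) s(3)] by (simp add: h_def \<alpha>_def U_def)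
  have nrmU: "(nrm (g s) (U s))\<^sup>2 = h s (U s c) (U s c)" if s: "s \<in> {0..1}" "g s \<in> C" "g s \<in> chart_dom c" for s
    using rest_norm[of V s g c, OF geodesicD(2)[OF g s(1)] s(2) c(1) s(3)] by (simp add: h_def U_def)
  have gt: "t \<in> {0..1}" "g t \<in> C" "g t \<in> chart_dom c" using gC t c by auto
  note pf = pos_form_hess[OF c(1) y, folded h_def]
  note sf = sym_form_simps[OF pos_form_sym_form[OF pf]]
  define v where "v = V t c"
  define W where "W = U t c"
  define \<Gamma>W where "\<Gamma>W = christoffel A nabla c (g t) v W"
  define F where "F s = 2 * \<alpha> s W - h s W W" for s
  define T where "T = dhess c (chart_map c (g t)) v"
  define F' where "F' = 2 * (1 - t) * T v W - T W W"
  have d1: "((\<lambda>s. df c (chart_map c (g s)) W) has_real_derivative h t v W + df c (chart_map c (g t)) \<Gamma>W) ?F"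
    using df_along[OF g gC t c has_vector_derivative_const[of W]]
    by (simp add: has_real_derivative_iff_has_vector_derivative h_def v_def \<Gamma>W_def)
  have d2: "((\<lambda>s. h s (V s c) W) has_real_derivative T v W + h t v \<Gamma>W) ?F"
    using hess_along[OF g gC t c geodesicD(4)[OF g t c] has_vector_derivative_const[of W]] sf(8)
    by (simp add: has_real_derivative_iff_has_vector_derivative h_def v_def \<Gamma>W_def T_def)
  have d3: "((\<lambda>s. h s W W) has_real_derivative T W W + h t \<Gamma>W W + h t W \<Gamma>W) ?F"
    using hess_along[OF g gC t c has_vector_derivative_const[of W] has_vector_derivative_const[of W]]
    by (simp add: has_real_derivative_iff_has_vector_derivative h_def v_def \<Gamma>W_def T_def)
  have "(F has_real_derivative
      2 * (((1 - t) * (T v W + h t v \<Gamma>W) - h t v W) + (h t v W + df c (chart_map c (g t)) \<Gamma>W))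
        - (T W W + h t \<Gamma>W W + h t W \<Gamma>W)) ?F"
    unfolding F_def \<alpha>_def restform_def h_def[symmetric] by (auto intro!: derivative_eq_intros d1 d2 d3 simp: v_def)
  \<comment> \<open>The Riesz property of \<open>W\<close> tested on \<open>\<Gamma>W\<close> is
    what removes the Christoffel terms.\<close>
  moreover have "h t W \<Gamma>W = (1 - t) * h t v \<Gamma>W + df c (chart_map c (g t)) \<Gamma>W"
    using riesz[OF gt, of \<Gamma>W] by (simp add: W_def \<alpha>_def restform_def h_def v_def)
  then have "2 * (((1 - t) * (T v W + h t v \<Gamma>W) - h t v W) + (h t v W + df c (chart_map c (g t)) \<Gamma>W))
        - (T W W + h t \<Gamma>W W + h t W \<Gamma>W) = F'"
    using sym_form_sym[OF pos_form_sym_form[OF pf], of \<Gamma>W W] by (simp add: F'_def algebra_simps)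
  ultimately have dF: "(F has_real_derivative F') ?F" by simp
  have Ft: "F t = (nrm (g t) (U t))\<^sup>2"
    using riesz[OF gt, of W] nrmU[OF gt] by (simp add: F_def W_def)
  have below: "\<forall>\<^sub>F s in ?F. F s \<le> (nrm (g s) (U s))\<^sup>2"
    using ev
  proof eventually_elim
    case (elim s)
    then have s: "s \<in> {0..1}" "g s \<in> C" "g s \<in> chart_dom c" by auto
    have p: "pos_form (h s)" unfolding h_def using s by (intro pos_form_hess[OF c(1)]) auto
    \<comment> \<open>Completing the square: this is the gap between the squared norm and
      \<open>F\<close>, and it is zero at \<open>s = t\<close>.\<close>
    have "0 \<le> h s (U s c - W) (U s c - W)" by (rule pos_form_nonneg[OF p])
    also have "\<dots> = h s (U s c) (U s c) - 2 * h s (U s c) W + h s W W"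
      using sym_form_sym[OF pos_form_sym_form[OF p], of W "U s c"] by (simp add: sym_form_simps[OF pos_form_sym_form[OF p]])
    finally show ?case using riesz[OF s, of W] nrmU[OF s] by (simp add: F_def)
  qed
  have N: "sqrt (h t W W) = nrm (g t) (U t)"
    unfolding W_def U_def
    using nrmU[OF gt] nrm_nonneg[OF gt(2) rest_tangent[of V t g, OF geodesicD(2)[OF g t] gt(2)]]
    by (intro real_sqrt_unique) (simp_all add: U_def)
  have p: "sqrt (h t v v) = nrm (g t) (V t)"
    using hessian_chart[OF c gt(2) geodesicD(2)[OF g t] geodesicD(2)[OF g t]] by (simp add: local_norm_def h_def v_def)
  note b = dhess_bound[OF c(1) y, of v, folded T_def h_def]
  have "(1 - t) * T v W \<le> (1 - t) * (2 * \<sigma> * nrm (g t) (V t) * nrm (g t) (V t) * nrm (g t) (U t))"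
    using b[of v W] t unfolding N p by (intro mult_left_mono) auto
  moreover have "- T W W \<le> 2 * \<sigma> * nrm (g t) (V t) * nrm (g t) (U t) * nrm (g t) (U t)"
    using b[of W W] unfolding N p by linarith
  moreover have "F' = 2 * ((1 - t) * T v W) + - T W W" by (simp add: F'_def)
  ultimately have "F' \<le> 2 * ((1 - t) * (2 * \<sigma> * nrm (g t) (V t) * nrm (g t) (V t) * nrm (g t) (U t)))
      + 2 * \<sigma> * nrm (g t) (V t) * nrm (g t) (U t) * nrm (g t) (U t)" by linarith
  also have "\<dots> = 4 * (1 - t) * \<sigma> * (nrm (g t) (V t))\<^sup>2 * nrm (g t) (U t) + 2 * \<sigma> * nrm (g t) (V t) * (nrm (g t) (U t))\<^sup>2"
    by (simp add: power2_eq_square)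
  finally have "F' \<le> \<dots>" .
  then show thesis using that dF Ft below by blast
qed

text \<open>The differential inequality for \<open>N\<close> is used in the form of a maximum
  principle: at a maximum the differentiable support function has a nonnegative left derivative,
  while the estimates make that derivative negative.\<close>

lemma newton_estimate:
  assumes x: "x \<in> C" and a: "\<sigma> * decr x < 1"
  shows "xplus x \<in> C"
    "decr (xplus x) \<le> \<sigma> * (decr x)\<^sup>2 / (1 - \<sigma> * decr x)\<^sup>2"
proof -
  obtain g V where g: "geo {0..1} g V" and g0: "g 0 = x" "V 0 = newton x"
    and g1: "g 1 = xplus x"
    using exp_geodesic[OF newton_tangent[OF x]] unfolding newton_step_def by metis
  define r where "r = decr x"
  have r: "nrm (g 0) (V 0) = r" "r \<ge> 0" using g0 decr_nonneg[OF x] by (auto simp: r_def newton_decrement_def)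
  define a where "a = \<sigma> * r"
  have a01: "0 \<le> a" "a < 1" using a r sigma_nonneg by (auto simp: a_def r_def)
  have gC: "g ` {0..1} \<subseteq> C"
    using geodesic_stays[OF g] x g0(1) a01 r(1) by (auto simp: a_def)
  then show "xplus x \<in> C" using g1 by (metis atLeastAtMost_iff image_subset_iff order_refl zero_le_one)
  define U where "U = rest g V"
  define N where "N t = nrm (g t) (U t)" for t
  define p where "p t = nrm (g t) (V t)" for t
  define K where "K = \<sigma> * r\<^sup>2 / (1 - a)"
  have K: "K \<ge> 0" using a01 sigma_nonneg by (simp add: K_def)
  have gt: "g t \<in> C" if "t \<in> {0..1}" for t using gC that by blast
  have UT: "U t \<in> TS (g t)" if "t \<in> {0..1}" for t
    unfolding U_def using geodesicD(2)[OF g that] gt[OF that] by (rule rest_tangent)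
  have N_nonneg: "N t \<ge> 0" if "t \<in> {0..1}" for t
    unfolding N_def by (rule nrm_nonneg[OF gt UT]) (use that in auto)
  have N_cont: "continuous_on {0..1} N"
    using continuous_on_rest_norm[OF g gC] by (simp add: N_def[abs_def] U_def)
  have nrm0: "nrm y (\<lambda>d. 0) = 0" if "y \<in> C" for y
    using hess_tangent_simps(2)[OF that tangent_zero tangent_zero tangent_zero, of 0 0] by (simp add: local_norm_def)
  \<comment> \<open>The curve starts in the Newton direction, so the residual is zero there.\<close>
  have N0: "N 0 = 0" using nrm0[OF x] g0 by (simp add: N_def U_def rest_def)
  have main: "N 1 * (1 - a) \<le> K + e" if e: "e > 0" for e
  proof -
    \<comment> \<open>\<open>2 * t - t\<^sup>2\<close> is the integral of 2 (1 - t) and equals 1 at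
      \<open>t = 1\<close>. The term \<open>e * t\<close> makes the inequality strict;
      \<open>e\<close> disappears at the end.\<close>
    define P where "P t = N t * (1 - a * t) - K * (2 * t - t\<^sup>2) - e * t" for t
    have "continuous_on {0..1} P"
      unfolding P_def by (intro continuous_intros N_cont)
    then obtain t where t: "t \<in> {0..1}" and max: "\<And>s. s \<in> {0..1} \<Longrightarrow> P s \<le> P t"
      using continuous_attains_sup[of "{0..1::real}" P] by auto
    have tt: "2 * t - t\<^sup>2 \<ge> 0" using t mult_left_mono[of t 2 t] by (simp add: power2_eq_square)
    have "P t \<le> 0"
    proof (cases "N t = 0")
      case True
      moreover have "0 \<le> K * (2 * t - t\<^sup>2)" "0 \<le> e * t" using K tt t e by auto
      ultimately show ?thesis by (simp add: P_def)
    next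
      case False
      \<comment> \<open>Since \<open>N\<close> vanishes at 0, the maximum has room to its
        left.\<close>
      have t0: "0 < t"
      proof (rule ccontr)
        assume "\<not> 0 < t"
        then have "t = 0" using t by auto
        then show False using False N0 by simp
      qed
      have Nt: "N t > 0" using False N_nonneg[OF t] by simp
      obtain F F' where F: "(F has_real_derivative F') (at t within {0..1})" "F t = (N t)\<^sup>2"
        "\<forall>\<^sub>F s in at t within {0..1}. F s \<le> (N s)\<^sup>2"
        "F' \<le> 4 * (1 - t) * \<sigma> * (p t)\<^sup>2 * N t + 2 * \<sigma> * p t * (N t)\<^sup>2"
        using newton_support_function[OF g gC t U_def] unfolding N_def p_def by blast
      define \<phi> where "\<phi> s = sqrt (F s) * (1 - a * s) - K * (2 * s - s\<^sup>2) - e * s" for s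
      have sF: "sqrt (F t) = N t" using F(2) Nt by simp
      define b where "b = 1 - a * t"
      have "a * t \<le> a * 1" using a01 t by (intro mult_left_mono) auto
      then have b: "b > 0" "1 - a \<le> b" using a01 by (auto simp: b_def)
      define d where "d = F' / (2 * N t) * b - a * N t - 2 * K * (1 - t) - e"
      have "(\<phi> has_real_derivative d) (at t within {0..1})"
        unfolding \<phi>_def d_def b_def using F(1) F(2) Nt
        by (auto intro!: derivative_eq_intros F(1) simp: sF field_simps)
      moreover have "\<forall>\<^sub>F s in at t within {0..1}. s < t \<longrightarrow> \<phi> s \<le> \<phi> t"
      proof -
        have "\<forall>\<^sub>F s in at t within {0..1}. s \<in> {0..1}" by (simp add: eventually_at_filter)
        with F(3) show ?thesis
        proof eventually_elim
          case (elim s)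
          have "sqrt (F s) \<le> sqrt ((N s)\<^sup>2)" using elim(1) by (rule real_sqrt_le_mono)
          then have "sqrt (F s) \<le> N s" using N_nonneg[OF elim(2)] by simp
          moreover have "a * s \<le> 1 * 1" using a01 elim(2) by (intro mult_mono) auto
          ultimately have "\<phi> s \<le> P s" unfolding \<phi>_def P_def by (simp add: mult_right_mono)
          also have "\<dots> \<le> P t" by (rule max[OF elim(2)])
          also have "\<dots> = \<phi> t" by (simp add: P_def \<phi>_def sF)
          finally show ?case by simp
        qed
      qed
      ultimately have "d \<ge> 0" using t by (intro left_derivative_at_max_nonneg[OF _ t0]) auto
      moreover have "d < 0"
      proof -
        have p0: "p t \<ge> 0" unfolding p_def by (rule nrm_nonneg[OF gt[OF t] geodesicD(2)[OF g t]])
        have pb: "p t * b \<le> r" using speed_upper_bound[OF g gC t] r(1) by (simp add: p_def b_def a_def)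
        have "p t * (1 - a) \<le> p t * b" using b p0 by (intro mult_left_mono) auto
        then have pa: "p t \<le> r / (1 - a)" using pb a01 by (simp add: pos_le_divide_eq)
        have "F' / (2 * N t) \<le> (4 * (1 - t) * \<sigma> * (p t)\<^sup>2 * N t + 2 * \<sigma> * p t * (N t)\<^sup>2) / (2 * N t)"
          using F(4) Nt by (intro divide_right_mono) auto
        also have "\<dots> = 2 * (1 - t) * \<sigma> * (p t)\<^sup>2 + \<sigma> * p t * N t"
          using Nt by (simp add: field_simps power2_eq_square)
        finally have "F' / (2 * N t) * b \<le> (2 * (1 - t) * \<sigma> * (p t)\<^sup>2 + \<sigma> * p t * N t) * b"
          using b by (intro mult_right_mono) auto
        also have "\<dots> = 2 * (1 - t) * \<sigma> * (p t * (p t * b)) + \<sigma> * N t * (p t * b)"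
          by (simp add: algebra_simps power2_eq_square)
        \<comment> \<open>Of the two factors \<open>p t\<close> one is paired with \<open>b\<close>,
          giving \<open>r\<close>, and the other is at most \<open>r / (1 - a)\<close>. The last
          summand becomes \<open>a * N t\<close> and cancels the derivative of the weight.\<close>
        also have "\<dots> \<le> 2 * (1 - t) * \<sigma> * (r / (1 - a) * r) + \<sigma> * N t * r"
          using t sigma_nonneg pb pa p0 b Nt r a01
          by (intro add_mono mult_left_mono mult_mono) auto
        also have "\<dots> = 2 * K * (1 - t) + a * N t"
          by (simp add: K_def a_def power2_eq_square mult_ac)
        finally show ?thesis using e by (simp add: d_def)
      qed
      ultimately show ?thesis by simp
    qed
    moreover have "P 1 \<le> P t" by (rule max) simp
    ultimately show ?thesis by (simp add: P_def)
  qed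
  then have "N 1 * (1 - a) \<le> K" by (rule field_le_epsilon)
  then have "N 1 \<le> \<sigma> * r\<^sup>2 / (1 - a)\<^sup>2" using a01 by (simp add: K_def power2_eq_square pos_le_divide_eq)
  \<comment> \<open>At \<open>t = 1\<close> the residual is minus the Newton direction, whose norm
    is the decrement.\<close>
  moreover have "N 1 = decr (g 1)"
  proof -
    have C1: "g 1 \<in> C" by (rule gt) simp
    have n: "newton (g 1) \<in> TS (g 1)" by (rule newton_tangent[OF C1])
    have m: "(\<lambda>d. - newton (g 1) d) \<in> TS (g 1)" using tangent_scale[OF n, of "-1"] by simp
    have "H (g 1) (\<lambda>d. - newton (g 1) d) (\<lambda>d. - newton (g 1) d) = H (g 1) (newton (g 1)) (newton (g 1))"
      using hess_tangent_simps(2)[OF C1 n n m, of "-1" 0] hess_tangent_simps(1)[OF C1 n n m]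
        hess_tangent_simps(2)[OF C1 n n n, of "-1" 0] by simp
    then show ?thesis by (simp add: N_def U_def rest_def newton_decrement_def local_norm_def)
  qed
  ultimately show "decr (xplus x) \<le> \<sigma> * (decr x)\<^sup>2 / (1 - \<sigma> * decr x)\<^sup>2"
    using g1 by (simp add: r_def a_def)
qed

end

section \<open>Quadratic convergence\<close>

context self_concordant_function
begin

text \<open>Convexity of \<open>C\<close> keeps the curve inside however long it is, in contrast to
  \<open>geodesic_stays\<close>.\<close>

lemma connecting_geodesic:
  assumes x: "x \<in> C" and y: "y \<in> C" and v: "v \<in> TS x" "Exp x v = y"
  obtains g V where "geo {0..1} g V" "g 0 = x" "V 0 = v" "g 1 = y" "g ` {0..1} \<subseteq> C"
proof -
  obtain g V where g: "geo {0..1} g V" "g 0 = x" "V 0 = v" "g 1 = y"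
    using exp_geodesic[OF v(1)] v(2) by metis
  then have "geodesic A nabla {0..1} g" unfolding geodesic_def by blast
  then have "g ` {0..1} \<subseteq> C"
    using convex_C x y g zero_le_one unfolding geodesically_convex_def by metis
  then show thesis using that g by blast
qed

lemma exp_reach:
  obtains v where "v \<in> TS x" "Exp x v = y"
proof -
  have "y \<in> Exp x ` TS x" by (simp add: exp_surj)
  then show thesis using that by (elim imageE) simp
qed

lemma connecting_norm_bound:
  assumes x: "x \<in> C" and y: "y \<in> C" and v: "v \<in> TS x" "Exp x v = y"
    and L: "\<sigma> * (decr x + decr y) < 1"
  shows "nrm x v \<le> (decr x + decr y) / (1 - \<sigma> * (decr x + decr y))"
proof -
  obtain g V where g: "geo {0..1} g V" "g 0 = x" "V 0 = v" "g 1 = y" "g ` {0..1} \<subseteq> C"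
    using connecting_geodesic[OF x y v] by blast
  have "V 1 \<in> TS y" using geodesicD(2)[OF g(1), of 1] g(4) by simp
  then have "\<bar>D (g 1) (V 1)\<bar> \<le> decr y * nrm (g 1) (V 1)" "\<bar>D (g 0) (V 0)\<bar> \<le> decr x * nrm (g 0) (V 0)"
    using differential_le_decr x y v g by auto
  from geodesic_length_bound[OF g(1,5) decr_nonneg[OF x] decr_nonneg[OF y] L this(2,1)] show ?thesis using g by simp
qed

text \<open>Along a connecting geodesic \<open>D (g t) (V t)\<close> starts at 0 and is
  nondecreasing, its derivative being a nonnegative Hessian value, so \<open>f\<close> cannot
  decrease.\<close>

lemma critical_point_minimal:
  assumes z: "z \<in> C" "\<And>w. w \<in> TS z \<Longrightarrow> D z w = 0" and y: "y \<in> C"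
  shows "f z \<le> f y"
proof -
  obtain v where v: "v \<in> TS z" "Exp z v = y" by (rule exp_reach)
  obtain g V where g: "geo {0..1} g V" "g 0 = z" "V 0 = v" "g 1 = y" "g ` {0..1} \<subseteq> C"
    using connecting_geodesic[OF z(1) y v] by blast
  have D: "- D (g t) (V t) \<le> - D (g 0) (V 0)" if t: "t \<in> {0..1}" for t
  proof (rule real_derivative_nonpos_imp_le[where g="\<lambda>t. - D (g t) (V t)"])
    fix s assume s: "s \<in> {0..t}"
    have sub: "{0..t} \<subseteq> {0..1}" using t by auto
    show "((\<lambda>t. - D (g t) (V t)) has_real_derivative - H (g s) (V s) (V s)) (at s within {0..t})"
      using g(5) sub s by (intro DERIV_minus differential_geodesic[OF geodesic_subset[OF g(1) sub]]) auto
    have "s \<in> {0..1}" using s sub by blast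
    moreover from this have "g s \<in> C" using g(5) by blast
    ultimately show "- H (g s) (V s) (V s) \<le> 0" using H_nonneg geodesicD(2)[OF g(1)] by auto
  qed (use t in auto)
  have "- f (g 1) \<le> - f (g 0)"
  proof (rule real_derivative_nonpos_imp_le[where g="\<lambda>t. - f (g t)"])
    fix s :: real assume s: "s \<in> {0..1}"
    show "((\<lambda>t. - f (g t)) has_real_derivative - D (g s) (V s)) (at s within {0..1})"
      by (intro DERIV_minus f_geodesic[OF g(1,5) s])
    show "- D (g s) (V s) \<le> 0" using D[OF s] z(2)[OF v(1)] g by simp
  qed simp
  then show ?thesis using g by simp
qed

text \<open>The mean value theorem writes the differential near a critical point as a second
  derivative applied to the displacement from \<open>z\<close>. Testing with the displacement itself
  gives the lower bound, and \<open>decr_le\<close> gives the upper one.\<close>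

lemma decr_chart_bounds:
  assumes z: "z \<in> C" "\<And>w. w \<in> TS z \<Longrightarrow> D z w = 0" and c: "c \<in> A" "z \<in> chart_dom c"
  obtains m M where "m > 0" "M > 0"
    "\<forall>\<^sub>F p in nhds z. m * norm (chart_map c p - chart_map c z) \<le> decr p \<and> decr p \<le> M * norm (chart_map c p - chart_map c z)"
proof -
  let ?y = "chart_map c z"
  have y: "?y \<in> dom c" using z c by auto
  \<comment> \<open>The plain second derivative without Christoffel correction; at \<open>z\<close>
    it agrees with the Hessian because the differential vanishes there, so it is uniformly positive
    definite nearby.\<close>
  define B where "B y u w = fd (\<lambda>y. df c y w) y u" for y u w
  have B: "sym_form (B y)" if "y \<in> dom c" for y
  proof -
    have s: "B y u w = B y w u" for u w using ddf_sym[OF c(1) that] by (simp add: B_def)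
    have "B y u = (\<lambda>w. B y w u)" for u using s by auto
    then have "linear (B y u)" for u using linear_ddf[OF c(1) that] by (simp add: B_def[abs_def])
    with s show ?thesis by (simp add: sym_form_def)
  qed
  have dfz: "df c ?y w = 0" for w
    using z(2)[OF chart_tangent_mem[OF c]] differential_f[OF c(1) z(1) c(2) chart_tangent_mem[OF c]] c by simp
  have Bz: "B ?y u w = hess c ?y u w" for u w using dfz by (simp add: B_def hess_def)
  have nhds: "(\<phi> \<longlongrightarrow> \<phi> ?y) (nhds ?y)" if "continuous_on (dom c) \<phi>" for \<phi> :: "'e \<Rightarrow> real"
  proof -
    have "isCont \<phi> ?y" using that open_dom[OF c(1)] y continuous_on_eq_continuous_at by blast
    then show ?thesis by (simp add: isCont_def tendsto_at_iff_tendsto_nhds)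
  qed
  have evd: "\<forall>\<^sub>F y in nhds ?y. y \<in> dom c" by (rule eventually_nhds_in_open[OF open_dom[OF c(1)] y])
  note pf = pos_form_hess[OF c(1) y]
  have limh: "((\<lambda>y. hess c y u w) \<longlongrightarrow> hess c ?y u w) (nhds ?y)" for u w
    by (rule nhds[OF Ck_on_continuous[OF Ck_hess[OF c(1)]]])
  have limB: "((\<lambda>y. B y u w) \<longlongrightarrow> hess c ?y u w) (nhds ?y)" for u w
    using nhds[OF Ck_on_continuous[OF Ck_ddf[OF c(1)]], of w u] by (simp add: Bz[symmetric] B_def)
  obtain m1 M1 where m1: "m1 > 0" "M1 > 0"
    and ev1: "\<forall>\<^sub>F y in nhds ?y. \<forall>u w. m1 * (norm u)\<^sup>2 \<le> hess c y u u \<and> \<bar>hess c y u w\<bar> \<le> M1 * norm u * norm w"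
    using pos_form_eventually_bounds[OF pf eventually_mono[OF evd sym_form_hess[OF c(1)]] limh] by blast
  obtain m2 M2 where m2: "m2 > 0" "M2 > 0"
    and ev2: "\<forall>\<^sub>F y in nhds ?y. \<forall>u w. m2 * (norm u)\<^sup>2 \<le> B y u u \<and> \<bar>B y u w\<bar> \<le> M2 * norm u * norm w"
    using pos_form_eventually_bounds[OF pf eventually_mono[OF evd B] limB] by blast
  from evd ev1 ev2 have "\<forall>\<^sub>F y in nhds ?y. y \<in> dom c
      \<and> (\<forall>u w. m1 * (norm u)\<^sup>2 \<le> hess c y u u \<and> \<bar>hess c y u w\<bar> \<le> M1 * norm u * norm w)
      \<and> (\<forall>u w. m2 * (norm u)\<^sup>2 \<le> B y u u \<and> \<bar>B y u w\<bar> \<le> M2 * norm u * norm w)"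
    by eventually_elim simp
  then obtain e where e: "e > 0" and near: "\<And>y. dist y ?y < e \<Longrightarrow> y \<in> dom c"
    "\<And>y u. dist y ?y < e \<Longrightarrow> m1 * (norm u)\<^sup>2 \<le> hess c y u u"
    "\<And>y u w. dist y ?y < e \<Longrightarrow> \<bar>hess c y u w\<bar> \<le> M1 * norm u * norm w"
    "\<And>y u. dist y ?y < e \<Longrightarrow> m2 * (norm u)\<^sup>2 \<le> B y u u"
    "\<And>y u w. dist y ?y < e \<Longrightarrow> \<bar>B y u w\<bar> \<le> M2 * norm u * norm w"
    unfolding eventually_nhds_metric by blast
  \<comment> \<open>The intermediate point depends on \<open>w\<close>, which is harmless because
    the bounds in \<open>near\<close> are uniform.\<close>
  have mvt: "\<exists>\<xi>. dist \<xi> ?y < e \<and> df c y w = B \<xi> (y - ?y) w" if "dist y ?y < e" for y w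
  proof -
    have seg: "dist (?y + t *\<^sub>R (y - ?y)) ?y < e" if "0 \<le> t" "t \<le> 1" for t
    proof -
      have "dist (?y + t *\<^sub>R (y - ?y)) ?y = t * dist y ?y" using that by (simp add: dist_norm)
      also have "\<dots> \<le> 1 * dist y ?y" using that by (intro mult_right_mono) auto
      finally show ?thesis using \<open>dist y ?y < e\<close> by simp
    qed
    have "\<exists>t. 0 < t \<and> t < 1 \<and> df c (?y + 1 *\<^sub>R (y - ?y)) w - df c (?y + 0 *\<^sub>R (y - ?y)) w
        = (1 - 0) * B (?y + t *\<^sub>R (y - ?y)) (y - ?y) w"
    proof (rule MVT2)
      fix t :: real assume t: "0 \<le> t" "t \<le> 1"
      have "((\<lambda>t. ?y + t *\<^sub>R (y - ?y)) has_vector_derivative (y - ?y)) (at t)"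
        by (auto intro!: derivative_eq_intros)
      from has_vector_derivative_compose[OF this df_has_derivative[OF c(1) near(1)[OF seg[OF t]]], of w]
      show "((\<lambda>t. df c (?y + t *\<^sub>R (y - ?y)) w) has_real_derivative B (?y + t *\<^sub>R (y - ?y)) (y - ?y) w) (at t)"
        by (simp add: B_def has_real_derivative_iff_has_vector_derivative)
    qed simp
    then obtain t where t: "0 < t" "t < 1" "df c y w = B (?y + t *\<^sub>R (y - ?y)) (y - ?y) w"
      using dfz by auto
    then show ?thesis using seg[of t] by (intro exI[of _ "?y + t *\<^sub>R (y - ?y)"]) auto
  qed
  have bounds: "m2 / sqrt M1 * norm (chart_map c p - ?y) \<le> decr p \<and> decr p \<le> M2 / sqrt m1 * norm (chart_map c p - ?y)"
    if p: "p \<in> C" "p \<in> chart_dom c" and d: "dist (chart_map c p) ?y < e" for p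
  proof
    define w where "w = chart_map c p - ?y"
    let ?u = "E c p w"
    have u: "?u \<in> TS p" using c(1) p by simp
    obtain \<xi> where \<xi>: "dist \<xi> ?y < e" "df c (chart_map c p) w = B \<xi> w w"
      using mvt[OF d, of w] by (auto simp: w_def)
    have "m2 * (norm w)\<^sup>2 \<le> D p ?u"
      using near(4)[OF \<xi>(1), of w] \<xi>(2) differential_f[OF c(1) p u] c(1) p by simp
    also have "\<dots> \<le> decr p * nrm p ?u" using differential_le_decr[OF p(1) u] by simp
    also have "\<dots> \<le> decr p * (sqrt M1 * norm w)"
    proof (rule mult_left_mono[OF _ decr_nonneg[OF p(1)]])
      have "H p ?u ?u \<le> M1 * (norm w)\<^sup>2"
        using near(3)[OF d, of w w] hessian_chart[OF c(1) p(2,1) u u] c(1) p by (simp add: power2_eq_square)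
      then have "nrm p ?u \<le> sqrt (M1 * (norm w)\<^sup>2)" unfolding local_norm_def by (rule real_sqrt_le_mono)
      then show "nrm p ?u \<le> sqrt M1 * norm w" by (simp add: real_sqrt_mult)
    qed
    finally have "norm w * (m2 * norm w) \<le> norm w * (decr p * sqrt M1)" by (simp add: power2_eq_square mult_ac)
    then have "m2 * norm w \<le> decr p * sqrt M1"
      using decr_nonneg[OF p(1)] m1 by (cases "w = 0") (auto simp: mult_le_cancel_left)
    then show "m2 / sqrt M1 * norm (chart_map c p - ?y) \<le> decr p"
      using m1 by (simp add: w_def pos_divide_le_eq)
    show "decr p \<le> M2 / sqrt m1 * norm (chart_map c p - ?y)"
    proof (rule decr_le[OF p(1)])
      fix u assume u: "u \<in> TS p"
      obtain \<xi> where \<xi>: "dist \<xi> ?y < e" "df c (chart_map c p) (u c) = B \<xi> w (u c)"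
        using mvt[OF d, of "u c"] by (auto simp: w_def)
      have "\<bar>D p u\<bar> \<le> M2 * norm w * norm (u c)"
        using near(5)[OF \<xi>(1)] \<xi>(2) differential_f[OF c(1) p u] by simp
      also have "\<dots> \<le> M2 * norm w * (nrm p u / sqrt m1)"
      proof (rule mult_left_mono)
        have "sqrt (m1 * (norm (u c))\<^sup>2) \<le> nrm p u"
          unfolding local_norm_def
          using near(2)[OF d, of "u c"] hessian_chart[OF c(1) p(2,1) u u] by (intro real_sqrt_le_mono) simp
        then show "norm (u c) \<le> nrm p u / sqrt m1"
          using m1 by (simp add: real_sqrt_mult pos_le_divide_eq mult.commute)
      qed (use m2 in auto)
      finally show "\<bar>D p u\<bar> \<le> M2 / sqrt m1 * norm (chart_map c p - ?y) * nrm p u" by (simp add: w_def)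
    qed (use m1 m2 in auto)
  qed
  have "\<forall>\<^sub>F p in nhds z. p \<in> C \<inter> chart_dom c"
    by (rule eventually_nhds_in_open[OF open_Int[OF open_C open_chart_dom[OF c(1)]]]) (use z c in auto)
  moreover have "\<forall>\<^sub>F p in nhds z. dist (chart_map c p) ?y < e"
  proof -
    have "isCont (chart_map c) z"
      using continuous_on_chart_map[OF c(1)] open_chart_dom[OF c(1)] c(2) continuous_on_eq_continuous_at by blast
    then have "(chart_map c \<longlongrightarrow> ?y) (nhds z)" by (simp add: isCont_def tendsto_at_iff_tendsto_nhds)
    then show ?thesis using e by (rule tendstoD)
  qed
  ultimately have "\<forall>\<^sub>F p in nhds z. m2 / sqrt M1 * norm (chart_map c p - ?y) \<le> decr p \<and> decr p \<le> M2 / sqrt m1 * norm (chart_map c p - ?y)"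
    by eventually_elim (use bounds in auto)
  then show thesis using that[of "m2 / sqrt M1" "M2 / sqrt m1"] m1 m2 by simp
qed

text \<open>Passage to the limit in \<open>differential_le_decr\<close>, with \<open>w\<close> moved
  to the iterates by constant coordinates in one chart.\<close>

lemma decr_limit_critical:
  assumes X: "\<And>k. X k \<in> C" "X \<longlonglongrightarrow> z" and z: "z \<in> C" and d: "(\<lambda>k. decr (X k)) \<longlonglongrightarrow> 0"
    and w: "w \<in> TS z"
  shows "D z w = 0"
proof -
  obtain c where c: "c \<in> A" "z \<in> chart_dom c" by (rule chart_cover)
  let ?y = "chart_map c z"
  have y: "?y \<in> dom c" using z c by auto
  have ev: "\<forall>\<^sub>F k in sequentially. X k \<in> chart_dom c"
    using X(2) open_chart_dom[OF c(1)] c(2) by (rule topological_tendstoD)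
  have lim: "(\<lambda>k. chart_map c (X k)) \<longlonglongrightarrow> ?y"
    by (rule continuous_on_tendsto_compose[OF continuous_on_chart_map[OF c(1)] X(2) c(2) ev])
  have cont: "(\<lambda>k. \<phi> (chart_map c (X k))) \<longlonglongrightarrow> \<phi> ?y" if "continuous_on (dom c) \<phi>" for \<phi> :: "'e \<Rightarrow> real"
    by (rule continuous_on_tendsto_compose[OF that lim y]) (use ev X(1) in \<open>auto elim: eventually_mono\<close>)
  have 1: "(\<lambda>k. \<bar>df c (chart_map c (X k)) (w c)\<bar>) \<longlonglongrightarrow> \<bar>df c ?y (w c)\<bar>"
    by (intro tendsto_rabs cont Ck_on_continuous[OF Ck_df[OF c(1)]])
  have 2: "(\<lambda>k. decr (X k) * sqrt (hess c (chart_map c (X k)) (w c) (w c))) \<longlonglongrightarrow> 0 * sqrt (hess c ?y (w c) (w c))"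
    by (intro tendsto_mult d tendsto_real_sqrt cont Ck_on_continuous[OF Ck_hess[OF c(1)]])
  have "\<forall>\<^sub>F k in sequentially. \<bar>df c (chart_map c (X k)) (w c)\<bar> \<le> decr (X k) * sqrt (hess c (chart_map c (X k)) (w c) (w c))"
    using ev
  proof eventually_elim
    case (elim k)
    let ?u = "E c (X k) (w c)"
    have u: "?u \<in> TS (X k)" using c(1) elim by simp
    show ?case
      using differential_le_decr[OF X(1) u] differential_f[OF c(1) X(1) elim u] hessian_chart[OF c(1) elim X(1) u u] c(1) elim
      by (simp add: local_norm_def)
  qed
  from tendsto_le[OF sequentially_bot 2 1 this] show ?thesis
    using differential_f[OF c(1) z c(2) w] by simp
qed

text \<open>Existence of the limit: the iterates are \<open>exp x (v k)\<close> with bounded \<open>v k\<close>, and a limit point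
  \<open>v\<close> of these has norm at most \<open>\<lambda> / (1 - \<sigma> \<lambda>) < 1 / \<sigma>\<close>, so that \<open>exp x v\<close> is still in \<open>C\<close>.\<close>

lemma critical_limit_exists:
  assumes X: "\<And>k. X k \<in> C" and x: "x \<in> C" and le: "\<And>k. decr (X k) \<le> decr x" and half: "\<sigma> * decr x < 1 / 2"
    and d: "(\<lambda>k. decr (X k)) \<longlonglongrightarrow> 0"
  obtains z where "z \<in> C" "\<And>w. w \<in> TS z \<Longrightarrow> D z w = 0" "X \<longlonglongrightarrow> z"
proof -
  define l where "l = decr x"
  have l: "l \<ge> 0" "\<sigma> * l < 1 / 2" using decr_nonneg[OF x] half by (auto simp: l_def)
  have small: "\<sigma> * (l + decr (X k)) < 1" for k
    using mult_left_mono[OF le[of k] sigma_nonneg] l by (simp add: l_def algebra_simps)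
  have "\<forall>k. \<exists>v\<in>TS x. Exp x v = X k" by (metis exp_reach)
  then obtain v where v: "\<And>k. v k \<in> TS x" "\<And>k. Exp x (v k) = X k" by metis
  have vb: "nrm x (v k) \<le> (l + decr (X k)) / (1 - \<sigma> * (l + decr (X k)))" for k
    unfolding l_def by (rule connecting_norm_bound[OF x X v]) (use small in \<open>simp add: l_def\<close>)
  obtain c where c: "c \<in> A" "x \<in> chart_dom c" by (rule chart_cover)
  let ?h = "hess c (chart_map c x)"
  have pf: "pos_form ?h" using x c by (intro pos_form_hess) auto
  obtain m where m: "m > 0" "\<And>u. m * (norm u)\<^sup>2 \<le> ?h u u" using pos_form_lower_bound[OF pf] by blast
  have vlim: "(\<lambda>k. (l + decr (X k)) / (1 - \<sigma> * (l + decr (X k)))) \<longlonglongrightarrow> (l + 0) / (1 - \<sigma> * (l + 0))"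
    using l by (intro tendsto_intros d) auto
  then have "bounded (range (\<lambda>k. (l + decr (X k)) / (1 - \<sigma> * (l + decr (X k)))))"
    by (rule convergent_imp_bounded)
  then obtain R where R: "\<And>k. \<bar>(l + decr (X k)) / (1 - \<sigma> * (l + decr (X k)))\<bar> \<le> R"
    by (auto simp: bounded_iff)
  have nv: "(nrm x (v k))\<^sup>2 = ?h (v k c) (v k c)" "nrm x (v k) \<ge> 0" for k
    using hessian_chart[OF c x v(1) v(1)] H_nonneg[OF x v(1)] nrm_nonneg[OF x v(1)] by (auto simp: local_norm_def)
  have "norm (v k c) \<le> R / sqrt m" for k
  proof -
    have "nrm x (v k) \<le> R" using vb[of k] R[of k] by linarith
    then have "(nrm x (v k))\<^sup>2 \<le> R\<^sup>2" using nv(2) by (intro power_mono)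
    then have "m * (norm (v k c))\<^sup>2 \<le> R\<^sup>2" using m(2)[of "v k c"] nv(1)[of k] by simp
    then have "sqrt (m * (norm (v k c))\<^sup>2) \<le> sqrt (R\<^sup>2)" by (rule real_sqrt_le_mono)
    moreover have "R \<ge> 0" using R[of 0] by linarith
    ultimately show ?thesis using m(1) by (simp add: real_sqrt_mult pos_le_divide_eq mult.commute)
  qed
  then have "bounded (range (\<lambda>k. v k c))" by (auto simp: bounded_iff)
  from bounded_imp_convergent_subsequence[OF this]
  obtain v0 r where r: "strict_mono r" "(\<lambda>k. v (r k) c) \<longlonglongrightarrow> v0" by (auto simp: comp_def)
  define u where "u = E c x v0"
  have u: "u \<in> TS x" "u c = v0" using c by (auto simp: u_def)
  define z where "z = Exp x u"
  have sf: "sym_form ?h" by (rule pos_form_sym_form[OF pf])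
  have hlim: "(\<lambda>k. ?h (v (r k) c) (v (r k) c)) \<longlonglongrightarrow> ?h v0 v0"
  proof (rule linear_family_tendsto[where L="\<lambda>k. ?h (v (r k) c)" and ?L0.0="?h v0", OF _ _ _ r(2)])
    fix w
    have "bounded_linear (?h w)" using sf by (simp add: sym_form_def linear_conv_bounded_linear)
    from bounded_linear.tendsto[OF this r(2)] show "(\<lambda>k. ?h (v (r k) c) w) \<longlonglongrightarrow> ?h v0 w"
      unfolding sym_form_sym[OF sf, of "v (r k) c" w for k] sym_form_sym[OF sf, of v0 w] .
  qed (use sf in \<open>auto simp: sym_form_def\<close>)
  have "(\<lambda>k. nrm x (v (r k))) \<longlonglongrightarrow> nrm x u"
    using tendsto_real_sqrt[OF hlim] hessian_chart[OF c x v(1) v(1)] hessian_chart[OF c x u(1) u(1)] u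
    by (simp add: local_norm_def)
  then have "nrm x u \<le> l / (1 - \<sigma> * l)"
    using LIMSEQ_le[OF _ LIMSEQ_subseq_LIMSEQ[OF vlim r(1)]] vb by (auto simp: comp_def)
  then have "\<sigma> * nrm x u \<le> \<sigma> * (l / (1 - \<sigma> * l))" by (rule mult_left_mono[OF _ sigma_nonneg])
  \<comment> \<open>Equivalent to \<open>\<sigma> * l < 1 / 2\<close>.\<close>
  also have "\<dots> < 1" using l by (simp add: pos_divide_less_eq)
  finally have "\<sigma> * nrm x u < 1" .
  moreover obtain g V where "geo {0..1} g V" "g 0 = x" "V 0 = u" "g 1 = z"
    using exp_geodesic[OF u(1)] z_def by metis
  ultimately have z: "z \<in> C" using geodesic_stays[of g V 1] x by simp
  have "(\<lambda>k. Exp x (v (r k))) \<longlonglongrightarrow> Exp x u"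
    by (rule exp_map_tendsto[OF u(1) v(1) exp_def[OF u(1)] exp_def[OF v(1)] c]) (use r u in simp)
  then have Xr: "(\<lambda>k. X (r k)) \<longlonglongrightarrow> z" by (simp add: v z_def)
  have crit: "D z w = 0" if "w \<in> TS z" for w
    by (rule decr_limit_critical[OF X Xr z _ that])
      (use LIMSEQ_subseq_LIMSEQ[OF d r(1)] in \<open>simp add: comp_def\<close>)
  \<comment> \<open>Now \<open>z\<close> contributes nothing to the length bound, so the initial
    vectors of geodesics from \<open>z\<close> to the iterates tend to 0. This upgrades convergence
    of the subsequence to convergence of \<open>X\<close>.\<close>
  have dz: "decr z = 0"
    using decr_le[OF z, of 0] crit decr_nonneg[OF z] by simp
  have "\<forall>k. \<exists>w\<in>TS z. Exp z w = X k" by (metis exp_reach)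
  then obtain w where w: "\<And>k. w k \<in> TS z" "\<And>k. Exp z (w k) = X k" by metis
  have wb: "nrm z (w k) \<le> decr (X k) / (1 - \<sigma> * decr (X k))" for k
  proof -
    have "\<sigma> * decr (X k) \<le> \<sigma> * (l + decr (X k))" using l sigma_nonneg by (intro mult_left_mono) auto
    then have "\<sigma> * (decr z + decr (X k)) < 1" using small[of k] dz by simp
    from connecting_norm_bound[OF z X w this] show ?thesis by (simp add: dz)
  qed
  obtain d where dd: "d \<in> A" "z \<in> chart_dom d" by (rule chart_cover)
  have pf': "pos_form (hess d (chart_map d z))" using z dd by (intro pos_form_hess) auto
  obtain m' where m': "m' > 0" "\<And>u. m' * (norm u)\<^sup>2 \<le> hess d (chart_map d z) u u" using pos_form_lower_bound[OF pf'] by blast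
  have wn: "norm (w k d) \<le> decr (X k) / (1 - \<sigma> * decr (X k)) / sqrt m'" for k
  proof -
    have "sqrt (m' * (norm (w k d))\<^sup>2) \<le> nrm z (w k)"
      unfolding local_norm_def using m'(2)[of "w k d"] hessian_chart[OF dd z w(1) w(1)] by (intro real_sqrt_le_mono) simp
    also have "\<dots> \<le> decr (X k) / (1 - \<sigma> * decr (X k))" by (rule wb)
    finally have "norm (w k d) * sqrt m' \<le> decr (X k) / (1 - \<sigma> * decr (X k))"
      by (simp add: real_sqrt_mult mult.commute)
    then show ?thesis using m'(1) by (simp only: pos_le_divide_eq real_sqrt_gt_zero)
  qed
  have "(\<lambda>k. decr (X k) / (1 - \<sigma> * decr (X k)) / sqrt m') \<longlonglongrightarrow> 0 / (1 - \<sigma> * 0) / sqrt m'"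
    using m' by (intro tendsto_intros \<open>(\<lambda>k. decr (X k)) \<longlonglongrightarrow> 0\<close>) auto
  then have "(\<lambda>k. decr (X k) / (1 - \<sigma> * decr (X k)) / sqrt m') \<longlonglongrightarrow> 0" by simp
  from Lim_null_comparison[OF always_eventually[OF allI[OF wn]] this]
  have w0: "(\<lambda>k. w k d) \<longlonglongrightarrow> 0" .
  have "(\<lambda>k. Exp z (w k)) \<longlonglongrightarrow> Exp z (\<lambda>c. 0)"
    by (rule exp_map_tendsto[OF tangent_zero w(1) exp_def[OF tangent_zero] exp_def[OF w(1)] dd w0])
  then have "X \<longlonglongrightarrow> z" by (simp add: w exp_map_zero)
  then show thesis using that z crit by blast
qed

text \<open>A step contracts the decrement by a factor \<theta> < 1; this preserves the hypothesis
  for the next step and gives all iterates a common quadratic constant \<open>K\<close>. Near the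
  limit the decrements are exchanged for chart distances.\<close>

lemma quadratic_region:
  assumes x: "x \<in> C" and small: "\<sigma> * decr x < (3 - sqrt 5) / 2"
  shows "x \<in> quadratic_convergence_region A nabla C f"
proof -
  define X where "X k = (xplus ^^ k) x" for k
  have XSuc: "X (Suc k) = xplus (X k)" for k by (simp add: X_def)
  define a where "a = \<sigma> * decr x"
  have s5: "sqrt 5 > 2" by (rule real_less_rsqrt) simp
  have a: "0 \<le> a" "a < (3 - sqrt 5) / 2" "a < 1 / 2"
    using small decr_nonneg[OF x] sigma_nonneg s5 by (auto simp: a_def)
  \<comment> \<open>The two subtracted numbers are the roots of (1 - a)^2 = a, and \<open>a\<close>
    lies below both.\<close>
  have "0 < (a - (3 - sqrt 5) / 2) * (a - (3 + sqrt 5) / 2)" using a s5 by (intro mult_neg_neg) auto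
  also have "\<dots> = (1 - a)\<^sup>2 - a" by (simp add: field_simps power2_eq_square)
  finally have a2: "a < (1 - a)\<^sup>2" by simp
  define K where "K = \<sigma> / (1 - a)\<^sup>2"
  define \<theta> where "\<theta> = a / (1 - a)\<^sup>2"
  have K: "K \<ge> 0" using sigma_nonneg by (simp add: K_def)
  have \<theta>: "0 \<le> \<theta>" "\<theta> < 1" using a a2 by (auto simp: \<theta>_def divide_less_eq)
  have step: "xplus y \<in> C \<and> decr (xplus y) \<le> K * (decr y)\<^sup>2
      \<and> decr (xplus y) \<le> \<theta> * decr y" if y: "y \<in> C" "decr y \<le> decr x" for y
  proof -
    have le: "\<sigma> * decr y \<le> a" unfolding a_def by (rule mult_left_mono[OF y(2) sigma_nonneg])
    then have lt: "\<sigma> * decr y < 1" using a by simp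
    have "decr (xplus y) \<le> \<sigma> * (decr y)\<^sup>2 / (1 - \<sigma> * decr y)\<^sup>2"
      by (rule newton_estimate(2)[OF y(1) lt])
    also have "\<dots> \<le> \<sigma> * (decr y)\<^sup>2 / (1 - a)\<^sup>2"
      using le a sigma_nonneg by (intro divide_left_mono power_mono) auto
    finally have q: "decr (xplus y) \<le> K * (decr y)\<^sup>2" by (simp add: K_def)
    also have "K * (decr y)\<^sup>2 \<le> K * (decr x * decr y)"
      unfolding power2_eq_square using y decr_nonneg[OF y(1)] K by (intro mult_left_mono mult_right_mono) auto
    finally have "decr (xplus y) \<le> \<theta> * decr y" by (simp add: K_def \<theta>_def a_def)
    then show ?thesis using q newton_estimate(1)[OF y(1) lt] by simp
  qed
  have X: "X k \<in> C \<and> decr (X k) \<le> decr x * \<theta> ^ k" for k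
  proof (induction k)
    case 0
    then show ?case using x by (simp add: X_def)
  next
    case (Suc k)
    have "decr x * \<theta> ^ k \<le> decr x * 1"
      using \<theta> decr_nonneg[OF x] by (intro mult_left_mono power_le_one) auto
    then have "decr (X k) \<le> decr x" using Suc by simp
    from step[OF _ this] Suc have "X (Suc k) \<in> C" "decr (X (Suc k)) \<le> \<theta> * decr (X k)" by (auto simp: XSuc)
    moreover have "\<theta> * decr (X k) \<le> \<theta> * (decr x * \<theta> ^ k)" using Suc \<theta> by (intro mult_left_mono) auto
    ultimately show ?case by (simp add: mult_ac)
  qed
  have XC: "X k \<in> C" for k using X by blast
  have le: "decr (X k) \<le> decr x" for k
  proof -
    have "decr x * \<theta> ^ k \<le> decr x * 1"
      using \<theta> decr_nonneg[OF x] by (intro mult_left_mono power_le_one) auto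
    then show ?thesis using X[of k] by simp
  qed
  have quad: "decr (X (Suc k)) \<le> K * (decr (X k))\<^sup>2" for k
    using step[OF XC le] by (simp add: XSuc)
  have "(\<lambda>k. decr x * \<theta> ^ k) \<longlonglongrightarrow> decr x * 0"
    using \<theta> by (intro tendsto_intros LIMSEQ_realpow_zero)
  then have d0: "(\<lambda>k. decr (X k)) \<longlonglongrightarrow> 0"
    by (intro Lim_null_comparison[of "\<lambda>k. decr (X k)"]) (use X decr_nonneg[OF XC] in auto)
  obtain z where z: "z \<in> C" "\<And>w. w \<in> TS z \<Longrightarrow> D z w = 0" "X \<longlonglongrightarrow> z"
    using critical_limit_exists[OF XC x le _ d0] a by (auto simp: a_def)
  have "converges_quadratically A X z"
    unfolding converges_quadratically_def
  proof (intro conjI ballI impI z(3))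
    fix c assume c: "c \<in> A" "z \<in> chart_dom c"
    obtain m M where m: "m > 0" "M > 0"
      and ev: "\<forall>\<^sub>F p in nhds z. m * norm (chart_map c p - chart_map c z) \<le> decr p \<and> decr p \<le> M * norm (chart_map c p - chart_map c z)"
      using decr_chart_bounds[OF z(1,2) c] by blast
    have "\<forall>\<^sub>F k in sequentially. m * norm (chart_map c (X k) - chart_map c z) \<le> decr (X k) \<and> decr (X k) \<le> M * norm (chart_map c (X k) - chart_map c z)"
      by (rule eventually_compose_filterlim[OF ev z(3)])
    \<comment> \<open>The lower comparison is needed at the next iterate, hence the shift by
      one.\<close>
    moreover from this have "\<forall>\<^sub>F k in sequentially. m * norm (chart_map c (X (Suc k)) - chart_map c z) \<le> decr (X (Suc k))"
      by (subst (asm) eventually_sequentially_Suc[symmetric]) (auto elim: eventually_mono)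
    ultimately have "\<forall>\<^sub>F k in sequentially. norm (chart_map c (X (Suc k)) - chart_map c z)
        \<le> K * M\<^sup>2 / m * (norm (chart_map c (X k) - chart_map c z))\<^sup>2"
    proof eventually_elim
      case (elim k)
      have "m * norm (chart_map c (X (Suc k)) - chart_map c z) \<le> K * (decr (X k))\<^sup>2" using elim(2) quad[of k] by simp
      also have "\<dots> \<le> K * (M * norm (chart_map c (X k) - chart_map c z))\<^sup>2"
        using elim(1) decr_nonneg[OF XC] K by (intro mult_left_mono power_mono) auto
      finally show ?case using m by (simp add: pos_le_divide_eq power_mult_distrib mult_ac)
    qed
    then show "\<exists>K. \<forall>\<^sub>F k in sequentially. norm (chart_map c (X (Suc k)) - chart_map c z)
        \<le> K * (norm (chart_map c (X k) - chart_map c z))\<^sup>2" by blast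
  qed
  then show ?thesis
    using XC z(1) critical_point_minimal[OF z(1,2)] d0 quad
    unfolding quadratic_convergence_region_def X_def[abs_def] by blast
qed

end

theorem theorem3p9:
  fixes A :: "('m::{t2_space,second_countable_topology}, 'e::euclidean_space) chart set"
    and nabla :: "'m \<Rightarrow> ('m, 'e) tvec \<Rightarrow> ('m \<Rightarrow> ('m, 'e) tvec) \<Rightarrow> ('m, 'e) tvec"
    and C :: "'m set" and f :: "'m \<Rightarrow> real" and \<sigma> :: real and x :: 'm
  assumes "smooth_atlas A"
    and "affine_connection A nabla"
    and "torsion_free A nabla"
    and "\<forall>p. \<forall>v\<in>tangent_space A p. exp_defined A nabla p v"
    and "\<forall>p. exp_map A nabla p ` tangent_space A p = UNIV"
    and "open C"
    and "geodesically_convex A nabla C"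
    and "self_concordant A nabla C \<sigma> f"
    and "x \<in> C"
  shows "(ereal (newton_decrement A nabla f x) < 1 / ereal \<sigma> \<longrightarrow>
            newton_step A nabla f x \<in> C \<and>
            newton_decrement A nabla f (newton_step A nabla f x)
              \<le> \<sigma> * (newton_decrement A nabla f x)\<^sup>2 / (1 - \<sigma> * newton_decrement A nabla f x)\<^sup>2) \<and>
         (ereal (newton_decrement A nabla f x) < ereal (3 - sqrt 5) / (2 * ereal \<sigma>) \<longrightarrow>
            x \<in> quadratic_convergence_region A nabla C f) \<and>
         0.3819 \<le> (3 - sqrt 5) / 2 \<and> (3 - sqrt 5) / 2 < (0.3820 :: real)"
proof -
  interpret self_concordant_function A nabla C f \<sigma>
    using assms by unfold_locales auto
  \<comment> \<open>Subtracted from 3 and halved, these decimals give exactly 0.3819 and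
    0.3820.\<close>
  have "sqrt 5 \<le> 2.2362" by (rule real_le_lsqrt) (simp_all add: power2_eq_square)
  moreover have "2.236 < sqrt 5" by (rule real_less_rsqrt) (simp add: power2_eq_square)
  ultimately have s5: "sqrt 5 \<le> 2.2362" "2.236 < sqrt 5" by auto
  \<comment> \<open>Serves both thresholds, with \<open>q\<close> equal to 1 or 2. For
    \<open>\<sigma> = 0\<close> the quotient in \<open>ereal\<close> is infinite, as the convention
    asks, and the claim reduces to \<open>0 < a\<close>.\<close>
  have less: "\<sigma> * decr x < a" if "ereal (decr x) < ereal b / (q * ereal \<sigma>)" "q = ereal q'" "q' > 0" "a = b / q'" "a > 0" for a b q q'
  proof (cases "\<sigma> = 0")
    case False
    then have "\<sigma> > 0" using sigma_nonneg by simp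
    then have "decr x < b / (q' * \<sigma>)" using that by simp
    then have "\<sigma> * decr x * q' < a * q'" using \<open>\<sigma> > 0\<close> that(3,4) by (simp add: field_simps)
    then show ?thesis using that(3) by simp
  qed (use that in simp)
  have "\<sigma> * decr x < 1" if "ereal (decr x) < 1 / ereal \<sigma>"
    using less[of 1 1 1 1] that by (simp flip: one_ereal_def)
  moreover have "\<sigma> * decr x < (3 - sqrt 5) / 2" if "ereal (decr x) < ereal (3 - sqrt 5) / (2 * ereal \<sigma>)"
    using less[of "3 - sqrt 5" 2 2 "(3 - sqrt 5) / 2"] that s5 by simp
  ultimately show ?thesis
    using newton_estimate[OF \<open>x \<in> C\<close>] quadratic_region[OF \<open>x \<in> C\<close>] s5 by simp
qed

end
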